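(* Let $(X_n)_{n\ge 1}$ be a sequence of i.i.d. random vectors with the same law as $X$, let $(\widehat\theta_n)_{n\ge1}$ be the projected Robbins-Monro sequence defined in the context, with step sequence of the form $\gamma_n=c_\gamma n^{-\alpha}$, where $c_\gamma>0$ and $\alpha\in(1/2,1)$, and let $\overline\theta_n=\frac1n\sum_{k=1}^n\widehat\theta_k$ for $n\ge1$. Assume that [A1], [A2], [A3] and [A4] hold and that $\mathbb E[\|X-\mu\|^{12}]<\infty$. Then $(\overline\theta_n)$ satisfies the convergence in distribution $$\sqrt n\left(\overline\theta_n-\theta\right)\xrightarrow[n\to\infty]{\mathcal L}\mathcal N\left(0,\Gamma_\theta^{-1}\Sigma\,\Gamma_\theta^{-1}\right),$$ with $$\Sigma:=\mathbb E\left[\begin{pmatrix}\mu-X-r^\star\frac{\mu-X}{\|\mu-X\|}\\ r^\star-\|\mu-X\|\end{pmatrix}\begin{pmatrix}\mu-X-r^\star\frac{\mu-X}{\|\mu-X\|}\\ r^\star-\|\mu-X\|\end{pmatrix}^T\right].$$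
   Context: Model. Let $d\ge2$ and let $X$ be a random vector of $\mathbb R^d$ of the form $X=\mu+r\,W\,U_\Omega$, where $\mu\in\mathbb R^d$, $r>0$, $W$ is a positive real continuous random variable (with a bounded density if $d=2$), $U_\Omega$ is uniformly distributed on a measurable subset $\Omega$ (of positive surface measure) of the unit sphere of $\mathbb R^d$, and $W$ and $U_\Omega$ are independent. Set $r^\star:=r\,\mathbb E[W]$ and $\theta:=(\mu,r^\star)\in\mathbb R^d\times\mathbb R$. Norms are Euclidean, $\langle\cdot,\cdot\rangle$ is the usual inner product, $\mathcal B(x,\rho)$ is the ball of center $x$ and radius $\rho$, and $\lambda_{\max}(M)$ is the largest eigenvalue of the matrix $M$. Assumptions. [A1] $\mathbb E[\|X-\mu\|^{-2}]<\infty$. [A2] $\mathbb E[\|X-\mu\|^{2}]<\infty$. [A3] There are positive constants $R_\mu,R_r$ such that $$\sup_{z\in\overline{\mathcal B(\mu,R_\mu)}}\lambda_{\max}(\Gamma(z))<\frac{1-\|\mathbb E[U_\Omega]\|^2/A}{r^\star+\frac32R_r}$$ for some $A$ with $\|\mathbb E[U_\Omega]\|^2<A<1$, where $$\Gamma(z):=\mathbb E\left[\frac1{\|X-z\|}\left(I_d-\frac{(X-z)(X-z)^T}{\|X-z\|^2}\right)\right].$$ [A4] The matrix (Hessian at $\theta$ of $G(z,a)=\frac12\mathbb E[(\|X-z\|-a)^2]$) $$\Gamma_\theta:=\begin{pmatrix}I_d-r^\star\,\mathbb E\left[\frac1{\|X-\mu\|}\left(I_d-\frac{(X-\mu)(X-\mu)^T}{\|X-\mu\|^2}\right)\right]&\mathbb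 E\left[\frac{X-\mu}{\|X-\mu\|}\right]\\ \mathbb E\left[\frac{X-\mu}{\|X-\mu\|}\right]^T&1\end{pmatrix}$$ is positive definite. Compact set and projection. With $R_\mu,R_r$ the constants of [A3], $\mathcal K$ is a compact convex subset of $\mathbb R^d\times(0,\infty)$ contained in $\overline{\mathcal B(\mu,R_\mu)}\times\overline{\mathcal B(r^\star,R_r)}$ such that $\theta\in\mathcal K\setminus\partial\mathcal K$ ($\partial\mathcal K$ is the boundary of $\mathcal K$ in $\mathbb R^d\times\mathbb R$). The map $\pi:\mathbb R^d\times\mathbb R\to\mathcal K$ is a projection onto $\mathcal K$ satisfying: $\pi(y)=y$ for $y\in\mathcal K$; $\|\pi(y)-\pi(y')\|\le\|y-y'\|$ for all $y,y'$; and $\pi(y)\in\partial\mathcal K$ for all $y\notin\mathcal K$. Projected Robbins-Monro algorithm. For $x\in\mathbb R^d$ and $y=(z,a)\in\mathbb R^d\times(0,\infty)$ let $g(x,y):=\frac12(\|x-z\|-a)^2$, so that for $x\neq z$ $$\nabla_yg(x,y)=\begin{pmatrix}z-x-a\,\frac{z-x}{\|z-x\|}\\ a-\|z-x\|\end{pmatrix}.$$ (For each fixed $z$, $X\ne z$ almost surely.) The sequence is defined by $\widehat\theta_1$ arbitrarily chosen in $\mathcal K$ and, for $n\ge1$, $$\widehat\theta_{n+1}=\pi\left(\widehat\theta_n-\gamma_n\nabla_yg(X_{n+1},\widehat\theta_n)\right).$$ *)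

theory Defs
  imports "HOL-Probability.Probability" "HOL-Library.Numeral_Type"
begin

text \<open>
  Points of \<open>R^d \<times> R\<close> are pairs of type \<open>(real^'n) \<times> real\<close>, whose norm is the Euclidean one.
  Vectors and matrices of dimension \<open>d + 1\<close> written in blocks are indexed by the type \<open>'n + 1\<close>.
\<close>

definition join_vec :: "(real^'n) \<times> real \<Rightarrow> real^('n::finite + 1)" where
  "join_vec y = (\<chi> i. case i of Inl k \<Rightarrow> fst y $ k | Inr _ \<Rightarrow> snd y)"

definition block_mat ::
  "real^'n^'n \<Rightarrow> real^'n \<Rightarrow> real^'n \<Rightarrow> real \<Rightarrow> real^('n::finite + 1)^('n + 1)" where
  "block_mat A b c e = (\<chi> i j.
     (case i of
        Inl k \<Rightarrow> (case j of Inl l \<Rightarrow> A $ k $ l | Inr _ \<Rightarrow> b $ k)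
      | Inr _ \<Rightarrow> (case j of Inl l \<Rightarrow> c $ l | Inr _ \<Rightarrow> e)))"

definition outer :: "real^'m \<Rightarrow> real^'m \<Rightarrow> real^'m^'m" where
  "outer u v = (\<chi> i j. u $ i * v $ j)"

definition pos_def_mat :: "real^'m^'m \<Rightarrow> bool" where
  "pos_def_mat A \<longleftrightarrow> transpose A = A \<and> (\<forall>v. v \<noteq> 0 \<longrightarrow> 0 < v \<bullet> (A *v v))"

text \<open>
  Meant for symmetric matrices, whose set of real eigenvalues is finite and nonempty.
\<close>

definition lambda_max :: "real^'m^'m \<Rightarrow> real" where
  "lambda_max A = Max {l. \<exists>v. v \<noteq> 0 \<and> A *v v = l *\<^sub>R v}"

text \<open>
  The surface measure of the unit sphere, regarded as a Borel measure on the whole space: the mass of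
  a Borel subset \<open>A\<close> of the sphere is the dimension times the Lebesgue measure of the cone
  \<open>{t x | 0 < t < 1, x \<in> A}\<close> (integration in polar coordinates). Recall that \<open>sgn x = x / norm x\<close>.
\<close>

definition surface_measure :: "'a::euclidean_space measure" where
  "surface_measure = scale_measure (of_nat DIM('a))
     (distr (restrict_space lborel (ball 0 1 - {0})) borel sgn)"

definition conv_in_distribution ::
  "'s measure \<Rightarrow> (nat \<Rightarrow> 's \<Rightarrow> 'a::euclidean_space) \<Rightarrow> 'a measure \<Rightarrow> bool" where
  "conv_in_distribution M Y N \<longleftrightarrow>
     (\<forall>n. Y n \<in> borel_measurable M) \<and> prob_space N \<and> sets N = sets borel \<and>
     (\<forall>f :: 'a \<Rightarrow> real. continuous_on UNIV f \<longrightarrow> bounded (range f) \<longrightarrow>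
        (\<lambda>n. \<integral>w. f (Y n w) \<partial>M) \<longlonglongrightarrow> (\<integral>x. f x \<partial>N))"

definition std_normal_vec :: "(real^'m) measure" where
  "std_normal_vec = density lborel (\<lambda>x. ennreal (\<Prod>i\<in>UNIV. std_normal_density (x $ i)))"

text \<open>
  The normal law with mean \<open>m\<close> and positive semidefinite covariance matrix \<open>S\<close> is the law of
  \<open>m + A Z\<close>, where \<open>Z\<close> is standard normal, \<open>A\<close> is a square matrix and \<open>A A\<^sup>T = S\<close>. This law is the same for all such \<open>A\<close>.
\<close>

definition normal_law :: "real^'m \<Rightarrow> real^'m^'m \<Rightarrow> (real^'m) measure" where
  "normal_law m S =
     distr std_normal_vec borel (\<lambda>z. m + (SOME A :: real^'m^'m. A ** transpose A = S) *v z)"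

definition g :: "real^'n \<Rightarrow> (real^'n) \<times> real \<Rightarrow> real" where
  "g x y = (norm (x - fst y) - snd y)\<^sup>2 / 2"

text \<open>
  The gradient of \<open>g x\<close> at \<open>(z, a)\<close>, for \<open>x \<noteq> z\<close> (lemma \<open>GDERIV_g\<close>). For \<open>x = z\<close> the quotient
  below is \<open>0\<close>, an arbitrary value.
\<close>

definition grad_g :: "real^'n \<Rightarrow> (real^'n) \<times> real \<Rightarrow> (real^'n) \<times> real" where
  "grad_g x y = (case y of (z, a) \<Rightarrow>
     (z - x - a *\<^sub>R ((z - x) /\<^sub>R norm (z - x)), a - norm (z - x)))"

lemma GDERIV_g:
  fixes x :: "real^'n"
  assumes "x \<noteq> fst y"
  shows "GDERIV (g x) y :> grad_g x y"
proof -
  obtain z a where y: "y = (z, a)" by (cases y)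
  have ne: "x - z \<noteq> 0" using assms y by simp
  have "((\<lambda>y. x - fst y) has_derivative (\<lambda>h. - fst h)) (at (z, a))"
    by (auto intro!: derivative_eq_intros)
  moreover have "(norm has_derivative (\<lambda>h. h \<bullet> sgn (x - z))) (at (x - fst (z, a)))"
    using GDERIV_norm[OF ne] by (simp add: gderiv_def)
  ultimately have *: "((\<lambda>y. norm (x - fst y)) has_derivative
      (\<lambda>h. (- fst h) \<bullet> sgn (x - z))) (at (z, a))"
    by (rule has_derivative_compose)
  have "((\<lambda>y. (norm (x - fst y) - snd y)\<^sup>2 / 2) has_derivative
      (\<lambda>h. (norm (x - z) - a) * ((- fst h) \<bullet> sgn (x - z) - snd h))) (at (z, a))"
  proof -
    have "((\<lambda>y. norm (x - fst y) - snd y) has_derivative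
        (\<lambda>h. (- fst h) \<bullet> sgn (x - z) - snd h)) (at (z, a))"
      by (intro has_derivative_diff * has_derivative_snd has_derivative_ident)
    from has_derivative_scaleR_right[OF has_derivative_mult[OF this this], of "1 / 2"]
    show ?thesis
      by (simp add: power2_eq_square algebra_simps add_divide_distrib diff_divide_distrib)
  qed
  moreover have "(norm (x - z) - a) * ((- fst h) \<bullet> sgn (x - z) - snd h) = h \<bullet> grad_g x y" for h
    using ne
    by (cases h) (simp add: y grad_g_def sgn_div_norm inner_simps norm_minus_commute field_simps)
  ultimately show ?thesis
    unfolding gderiv_def g_def[abs_def] y by simp
qed

definition Gamma_mat :: "'p measure \<Rightarrow> ('p \<Rightarrow> real^'n) \<Rightarrow> real^'n \<Rightarrow> real^'n^'n" where
  "Gamma_mat P X z = (\<integral>w. (1 / norm (X w - z)) *\<^sub>R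
     (mat 1 - (1 / (norm (X w - z))\<^sup>2) *\<^sub>R outer (X w - z) (X w - z)) \<partial>P)"

definition Gamma_theta ::
  "'p measure \<Rightarrow> ('p \<Rightarrow> real^'n) \<Rightarrow> real^'n \<Rightarrow> real \<Rightarrow> real^('n::finite + 1)^('n + 1)" where
  "Gamma_theta P X \<mu> rs = block_mat
     (mat 1 - rs *\<^sub>R Gamma_mat P X \<mu>)
     (\<integral>w. (X w - \<mu>) /\<^sub>R norm (X w - \<mu>) \<partial>P)
     (\<integral>w. (X w - \<mu>) /\<^sub>R norm (X w - \<mu>) \<partial>P)
     1"

definition Sigma_mat ::
  "'p measure \<Rightarrow> ('p \<Rightarrow> real^'n) \<Rightarrow> real^'n \<Rightarrow> real \<Rightarrow> real^('n::finite + 1)^('n + 1)" where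
  "Sigma_mat P X \<mu> rs =
     (\<integral>w. outer (join_vec (grad_g (X w) (\<mu>, rs))) (join_vec (grad_g (X w) (\<mu>, rs))) \<partial>P)"

end

theory Submission
  imports Defs
begin

text \<open>
  Summing the recursion, solved for the stochastic gradients, gives (with \<open>\<Gamma>\<close> the Hessian, \<open>\<Delta>_k\<close> the
  error at time \<open>k\<close> and \<open>\<eta>_k\<close> the gradient at the target, evaluated at the \<open>k\<close>-th observation)
  \<open>\<Gamma> (\<Sum>k\<le>n. \<Delta>_k) = - (\<Sum>k\<le>n. \<eta>_(k+1)) + remainder\<close>. The \<open>\<eta>_k\<close> are i.i.d. and centred, so the classical central
  limit theorem applies, without any martingale limit theorem, once the remainder is \<open>o(\<surd>n)\<close> in \<open>L\<^sup>1\<close>.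
  This follows from the mean square rate \<open>E \<parallel>\<Delta>_k\<parallel>\<^sup>2 = O(k powr -\<alpha>)\<close>: the telescoping term is summed by parts,
  the linearization error is quadratic and the Lipschitz modulus of the gradient is square integrable
  (both by [A1]), and the projection acts only when the error or the step is large. The rate itself needs strong
  monotonicity of the mean field on \<open>K\<close>, obtained from [A3] by integrating the Hessian along
  segments from \<open>\<mu>\<close>.
\<close>

section \<open>Positive semidefinite matrices\<close>

text \<open>The two bounds on \<alpha> do different work. The quadratic error and the projection
  contribute the sum of k powr -\<alpha>, of order n powr (1 - \<alpha>), which is o(sqrt n) because
  \<alpha> > 1/2. The terms weighted by the inverse step size are of order n powr (\<alpha>/2),
  which is o(sqrt n) because \<alpha> < 1. The constant 3/2 in [A3] arises as follows. Along a
  segment from \<mu> the mean field contains the second derivative of the norm twice: with weight 1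
  and factor rs + b, and with weight 1 - s and factor b, where b is the error in the radius. The
  weights have integrals 1 and 1/2, so the factors add up to rs + 3/2 b. The number A splits the
  cross term between b and the mean direction, leaving 1 - A for the radius and one minus the
  squared norm of E U over A for the center. The covariance may be singular, so the limit need not
  have a density; the normal law is built from a square root of its covariance and all limits are
  taken on characteristic functions.\<close>

lemma psd_mult_eq_0:
  fixes B :: "real^'m^'m"
  assumes sym: "transpose B = B" and psd: "\<And>v. 0 \<le> v \<bullet> (B *v v)" and 0: "v \<bullet> (B *v v) = 0"
  shows "B *v v = 0"
proof (rule ccontr)
  assume "B *v v \<noteq> 0"
  define w where "w = B *v v"
  have w: "w \<bullet> w > 0" using \<open>B *v v \<noteq> 0\<close> by (simp add: w_def)
  have sw: "v \<bullet> (B *v w) = w \<bullet> w"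
    by (metis dot_lmul_matrix inner_commute sym transpose_matrix_vector w_def)
  define q where "q = w \<bullet> (B *v w)"
  have q: "q \<ge> 0" unfolding q_def by (rule psd)
  have *: "0 \<le> 2 * t * (w \<bullet> w) + t\<^sup>2 * q" for t
  proof -
    have "(v + t *\<^sub>R w) \<bullet> (B *v (v + t *\<^sub>R w)) = 2 * t * (w \<bullet> w) + t\<^sup>2 * q"
      using 0 sw by (simp add: q_def matrix_vector_right_distrib matrix_vector_mult_scaleR inner_simps
          power2_eq_square algebra_simps flip: w_def)
    then show ?thesis using psd by metis
  qed
  \<comment> \<open>The form vanishes at v, so near v the linear term decides: a small step against
    B v would make the form negative. The \<open>+ 1\<close> covers q = 0.\<close>
  define t where "t = - (w \<bullet> w) / (q + 1)"
  have tq: "t * (q + 1) = - (w \<bullet> w)" using q by (simp add: t_def)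
  have "2 * t * (w \<bullet> w) + t\<^sup>2 * q \<le> 2 * t * (w \<bullet> w) + t * (t * (q + 1))"
    by (simp add: power2_eq_square algebra_simps)
  also have "\<dots> = t * (w \<bullet> w)" unfolding tq by simp
  also have "\<dots> < 0"
    using w q by (intro mult_neg_pos) (auto simp: t_def field_simps)
  finally show False using * by (simp add: leD)
qed

lemma outer_vec_mult: "outer u v *v x = (v \<bullet> x) *\<^sub>R u"
  by (simp add: outer_def vec_eq_iff matrix_vector_mult_def inner_vec_def sum_distrib_left mult_ac)

lemma transpose_outer_self [simp]: "transpose (outer u u) = outer u u"
  by (simp add: outer_def transpose_def mult.commute)

lemma transpose_diff_matrix: "transpose (A - B :: real^'n^'m) = transpose A - transpose B"
  by (simp add: transpose_def vec_eq_iff)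

text \<open>Cholesky elimination, one index at a time. Requiring that the columns of
  \<open>A\<close> outside \<open>J\<close> vanish keeps column \<open>k\<close> free for the pivot
  column, so the induction can fill it without disturbing the rest. Zero pivots must be allowed,
  since a covariance may be singular.\<close>

lemma psd_factorization_supported:
  fixes S :: "real^'m^'m"
  assumes "finite J" and "transpose S = S" and "\<And>v. 0 \<le> v \<bullet> (S *v v)"
    and "\<And>i j. i \<notin> J \<or> j \<notin> J \<Longrightarrow> S $ i $ j = 0"
  shows "\<exists>A. A ** transpose A = S \<and> (\<forall>i j. j \<notin> J \<longrightarrow> A $ i $ j = 0)"
  using assms
proof (induction J arbitrary: S rule: finite_induct)
  case empty
  then have "S = 0" by (simp add: vec_eq_iff)
  then show ?case by (intro exI[of _ 0]) (simp add: matrix_matrix_mult_def vec_eq_iff)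
next
  case (insert k J)
  have sym: "S $ i $ j = S $ j $ i" for i j
    using insert.prems(1) by (metis transpose_def vec_lambda_beta)
  define s :: "real^'m" where "s = S *v axis k 1"
  have s: "s $ i = S $ i $ k" for i
    by (simp add: s_def matrix_vector_mult_basis column_def)
  have sv: "axis k 1 \<bullet> (S *v v) = s \<bullet> v" for v
    by (metis dot_lmul_matrix insert.prems(1) s_def transpose_matrix_vector)
  define d where "d = S $ k $ k"
  have d: "d = axis k 1 \<bullet> s" by (simp add: d_def s inner_axis' flip: sv)
  have "d \<ge> 0" unfolding d s_def by (rule insert.prems)
  show ?case
  \<comment> \<open>A zero pivot forces the whole column to vanish by \<open>psd_mult_eq_0\<close>,
    and then S is already supported on J. Otherwise the Schur complement S' of the pivot is
    eliminated next.\<close>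
  proof (cases "d = 0")
    case True
    then have "s = 0" unfolding s_def d
      by (intro psd_mult_eq_0 insert.prems) (simp add: s_def)
    then have Sk: "S $ i $ k = 0" for i using s by (metis zero_index)
    have "\<exists>A. A ** transpose A = S \<and> (\<forall>i j. j \<notin> J \<longrightarrow> A $ i $ j = 0)"
    proof (rule insert.IH[OF insert.prems(1,2)])
      show "S $ i $ j = 0" if "i \<notin> J \<or> j \<notin> J" for i j
        using that Sk sym[of k j] insert.prems(3)[of i j]
        by (cases "i = k"; cases "j = k") auto
    qed
    then show ?thesis by blast
  next
    case False
    with \<open>d \<ge> 0\<close> have dp: "d > 0" by simp
    define S' where "S' = S - (1 / d) *\<^sub>R outer s s"
    have S'v: "S' *v v = S *v v - ((s \<bullet> v) / d) *\<^sub>R s" for v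
      by (simp add: S'_def matrix_vector_mult_diff_rdistrib outer_vec_mult flip: scaleR_matrix_vector_assoc)
    have "\<exists>A. A ** transpose A = S' \<and> (\<forall>i j. j \<notin> J \<longrightarrow> A $ i $ j = 0)"
    proof (rule insert.IH)
      show "transpose S' = S'"
        by (simp add: S'_def transpose_diff_matrix insert.prems transpose_scalar)
      show "0 \<le> v \<bullet> (S' *v v)" for v
      proof -
        \<comment> \<open>This is the minimizer of the form of S on the line through v in direction
          \<open>axis k 1\<close>; the minimum is the value of the Schur complement at v, hence
          nonnegative.\<close>
        define w where "w = v - ((s \<bullet> v) / d) *\<^sub>R axis k 1"
        have "w \<bullet> (S *v w) = v \<bullet> (S' *v v)"
          using dp by (simp add: w_def S'v matrix_vector_mult_diff_distrib matrix_vector_mult_scaleR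
              inner_simps sv inner_commute[of v s] flip: s_def d)
        then show ?thesis using insert.prems(2) by metis
      qed
      show "S' $ i $ j = 0" if "i \<notin> J \<or> j \<notin> J" for i j
        using that insert.prems(3)[of i j] insert.prems(3)[of i k] insert.prems(3)[of j k] dp sym[of k j]
        by (cases "i = k"; cases "j = k") (auto simp: S'_def outer_def s d_def)
    qed
    then obtain A where A: "A ** transpose A = S'" "\<And>i j. j \<notin> J \<Longrightarrow> A $ i $ j = 0" by blast
    define B :: "real^'m^'m" where "B = (\<chi> i j. if j = k then s $ i / sqrt d else A $ i $ j)"
    have "(B ** transpose B) $ i $ j = S $ i $ j" for i j
    proof -
      have "(B ** transpose B) $ i $ j = (\<Sum>l\<in>UNIV. B $ i $ l * B $ j $ l)"
        by (simp add: matrix_matrix_mult_def transpose_def)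
      also have "\<dots> = (\<Sum>l\<in>UNIV. A $ i $ l * A $ j $ l + (if l = k then s $ i * s $ j / d else 0))"
        using insert.hyps A(2) dp by (intro sum.cong) (auto simp: B_def)
      also have "\<dots> = S' $ i $ j + s $ i * s $ j / d"
        by (simp add: sum.distrib matrix_matrix_mult_def transpose_def flip: A(1))
      finally show ?thesis by (simp add: S'_def outer_def)
    qed
    then show ?thesis
      using A(2) by (intro exI[of _ B]) (auto simp: vec_eq_iff B_def)
  qed
qed

lemma psd_factorization:
  fixes S :: "real^'m^'m"
  assumes "transpose S = S" and "\<And>v. 0 \<le> v \<bullet> (S *v v)"
  shows "\<exists>A :: real^'m^'m. A ** transpose A = S"
  using psd_factorization_supported[of UNIV S] assms by auto

text \<open>A maximizer w of the quadratic form on the unit sphere is an eigenvector: l times the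
  identity minus S is positive semidefinite and its form vanishes at w, so
  \<open>psd_mult_eq_0\<close> applies. Finiteness of the set of eigenvalues has to be shown because
  \<open>Max\<close> says nothing otherwise; it follows from orthogonality of eigenvectors to
  distinct eigenvalues.\<close>

lemma lambda_max_bound:
  fixes S :: "real^'m^'m"
  assumes sym: "transpose S = S"
  shows "v \<bullet> (S *v v) \<le> lambda_max S * (norm v)\<^sup>2"
proof -
  define E where "E = {l. \<exists>v. v \<noteq> 0 \<and> S *v v = l *\<^sub>R v}"
  have sw: "x \<bullet> (S *v y) = (S *v x) \<bullet> y" for x y
    by (metis dot_lmul_matrix sym transpose_matrix_vector)
  define f where "f = (\<lambda>l. SOME v. v \<noteq> 0 \<and> S *v v = l *\<^sub>R v)"
  have f: "f l \<noteq> 0" "S *v f l = l *\<^sub>R f l" if "l \<in> E" for l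
    using someI_ex[of "\<lambda>v. v \<noteq> 0 \<and> S *v v = l *\<^sub>R v"] that unfolding E_def f_def by blast+
  have orth: "f l \<bullet> f l' = 0" if "l \<in> E" "l' \<in> E" "l \<noteq> l'" for l l'
    using sw[of "f l" "f l'"] f[OF that(1)] f[OF that(2)] that(3) by simp
  have "inj_on f E" 
  proof (rule inj_onI, rule ccontr)
    fix l l' assume l: "l \<in> E" "l' \<in> E" "f l = f l'" "l \<noteq> l'"
    then show False using orth[OF l(1,2,4)] f(1)[OF l(1)] by simp
  qed
  moreover have "finite (f ` E)"
    using orth by (intro pairwise_orthogonal_imp_finite) (auto simp: pairwise_def orthogonal_def)
  ultimately have finE: "finite E" using finite_imageD by blast
  have "continuous_on (sphere 0 1) (\<lambda>v. v \<bullet> (S *v v))"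
    
    by (intro continuous_on_inner continuous_on_id linear_continuous_on matrix_vector_mul_bounded_linear)
  moreover have "sphere (0::real^'m) 1 \<noteq> {}" by simp
  ultimately obtain w where w: "w \<in> sphere 0 1"
      and max: "\<And>v. v \<in> sphere 0 1 \<Longrightarrow> v \<bullet> (S *v v) \<le> w \<bullet> (S *v w)"
    using continuous_attains_sup[OF compact_sphere, of 0 1 "\<lambda>v. v \<bullet> (S *v v)"] by blast
  define l where "l = w \<bullet> (S *v w)"
  have bd: "v \<bullet> (S *v v) \<le> l * (norm v)\<^sup>2" for v
  proof (cases "v = 0")
    case False
    then have "(v /\<^sub>R norm v) \<bullet> (S *v (v /\<^sub>R norm v)) \<le> l"
      unfolding l_def by (intro max) simp
    then show ?thesis using False
      by (simp add: matrix_vector_mult_scaleR field_simps power2_eq_square)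
  qed simp
  define B where "B = l *\<^sub>R mat 1 - S"
  have Bv: "B *v v = l *\<^sub>R v - S *v v" for v
    by (simp add: B_def matrix_vector_mult_diff_rdistrib flip: scaleR_matrix_vector_assoc)
  have "B *v w = 0"
  proof (rule psd_mult_eq_0)
    show "transpose B = B" by (simp add: B_def transpose_diff_matrix sym transpose_scalar)
    show "0 \<le> v \<bullet> (B *v v)" for v
      using bd[of v] by (simp add: Bv inner_simps power2_norm_eq_inner)
    show "w \<bullet> (B *v w) = 0"
      using w by (simp add: Bv inner_simps l_def norm_eq_1)
  qed
  then have "l \<in> E" using w by (auto simp: E_def Bv intro!: exI[of _ w])
  then have "l \<le> lambda_max S" unfolding lambda_max_def E_def[symmetric] using finE by simp
  then show ?thesis using bd[of v] by (meson mult_right_mono order_trans zero_le_power2)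
qed

section \<open>Block vectors and block matrices\<close>

lemma sum_UNIV_plus: "(\<Sum>i\<in>(UNIV::('a::finite + 'b::finite) set). f i) = (\<Sum>k\<in>UNIV. f (Inl k)) + (\<Sum>k\<in>UNIV. f (Inr k))"
  by (simp flip: UNIV_Plus_UNIV add: sum.Plus)

lemma linear_join_vec: "linear (join_vec :: (real^'n) \<times> real \<Rightarrow> real^('n::finite + 1))"
  by (rule linearI) (auto simp: join_vec_def vec_eq_iff split: sum.split)

lemma inner_join_vec: "join_vec x \<bullet> join_vec y = x \<bullet> (y :: (real^'n) \<times> real)"
  by (simp add: inner_vec_def sum_UNIV_plus join_vec_def inner_prod_def)

lemma norm_join_vec: "norm (join_vec y) = norm (y :: (real^'n) \<times> real)"
  by (simp add: norm_eq_sqrt_inner inner_join_vec)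

lemma block_mat_mult_join_vec:
  "block_mat A b c e *v join_vec (h, s) = join_vec (A *v h + s *\<^sub>R b, c \<bullet> h + e * s)"
  by (auto simp: block_mat_def join_vec_def vec_eq_iff matrix_vector_mult_def sum_UNIV_plus
      inner_vec_def split: sum.split)

section \<open>Multivariate Levy continuity theorem\<close>

lemma prod_Basis_vec: "(\<Prod>b\<in>Basis. f b) = (\<Prod>i\<in>UNIV. f (axis i (1::real)))" for f :: "real^'m \<Rightarrow> 'c::comm_monoid_mult"
proof -
  have *: "(Basis :: (real^'m) set) = range (\<lambda>i. axis i 1)" by (auto simp: Basis_vec_def)
  have "inj (\<lambda>i::'m. axis i (1::real))" by (auto simp: inj_on_def axis_eq_axis)
  then show ?thesis by (simp add: * prod.reindex)
qed

lemma lborel_integral_prod: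
  fixes f :: "'a::euclidean_space \<Rightarrow> real \<Rightarrow> complex"
  assumes "\<And>b. b \<in> Basis \<Longrightarrow> integrable lborel (f b)"
  shows "(\<integral>x. (\<Prod>b\<in>Basis. f b (x \<bullet> b)) \<partial>lborel) = (\<Prod>b\<in>Basis. \<integral>x. f b x \<partial>lborel)"
proof -
  interpret product_sigma_finite "\<lambda>_::'a. lborel :: real measure" by standard
  have [measurable]: "\<And>b. b \<in> Basis \<Longrightarrow> f b \<in> borel_measurable borel"
    using assms borel_measurable_integrable by fastforce
  have "(\<integral>x. (\<Prod>b\<in>Basis. f b (x \<bullet> b)) \<partial>lborel)
      = (\<integral>x. (\<Prod>b\<in>Basis. f b (x b)) \<partial>(\<Pi>\<^sub>M b\<in>Basis. lborel))"
    unfolding lborel_def[where 'a='a] by (subst integral_distr) (simp_all add: lborel_eq_real)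
  also have "\<dots> = (\<Prod>b\<in>Basis. \<integral>x. f b x \<partial>lborel)"
    using assms by (intro product_integral_prod) auto
  finally show ?thesis .
qed

section \<open>The standard Gaussian law on the coordinate space\<close>

definition vec_density :: "real^'m \<Rightarrow> real" where
  "vec_density x = (\<Prod>i\<in>UNIV. std_normal_density (x $ i))"

lemma std_normal_vec_eq: "std_normal_vec = density lborel (\<lambda>x. ennreal (vec_density x))"
  by (simp add: std_normal_vec_def vec_density_def)

lemma power2_norm_vec: "(norm x)\<^sup>2 = (\<Sum>i\<in>UNIV. (x $ i)\<^sup>2)" for x :: "real^'m"
  by (simp add: norm_vec_def L2_set_def sum_nonneg)

lemma vec_density_eq:
  "vec_density (x::real^'m) = (1 / sqrt (2 * pi)) ^ CARD('m) * exp (- (norm x)\<^sup>2 / 2)"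
proof -
  have "(\<Prod>i\<in>UNIV. exp (- (x $ i)\<^sup>2 / 2)) = exp (\<Sum>i\<in>UNIV. - (x $ i)\<^sup>2 / 2)"
    by (simp add: exp_sum)
  also have "(\<Sum>i\<in>UNIV. - (x $ i)\<^sup>2 / 2) = - (norm x)\<^sup>2 / 2"
    by (simp add: power2_norm_vec sum_negf sum_divide_distrib)
  finally show ?thesis
    by (simp add: vec_density_def std_normal_density_def prod.distrib power_divide prod_dividef)
qed

lemma borel_measurable_cis [measurable]: "cis \<in> borel_measurable borel"
  by (intro borel_measurable_continuous_onI continuous_intros)

lemma sets_std_normal_vec [simp, measurable_cong]: "sets std_normal_vec = sets borel"
  by (simp add: std_normal_vec_def)

lemma space_std_normal_vec [simp]: "space std_normal_vec = UNIV"
  by (simp add: std_normal_vec_def)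

lemma borel_measurable_vec_density [measurable]: "vec_density \<in> borel_measurable borel"
  unfolding vec_density_eq[abs_def] by measurable

lemma prob_space_std_normal_vec: "prob_space (std_normal_vec :: (real^'m) measure)"
proof
  have "emeasure (std_normal_vec :: (real^'m) measure) (space std_normal_vec)
      = (\<integral>\<^sup>+x. (\<Prod>b\<in>Basis. ennreal (std_normal_density (x \<bullet> b))) \<partial>(lborel :: (real^'m) measure))"
    by (simp add: std_normal_vec_eq vec_density_def emeasure_density prod_Basis_vec inner_axis prod_ennreal)
  also have "\<dots> = 1"
    by (subst nn_integral_lborel_prod)
      (simp_all add: nn_integral_eq_integral integrable_normal_density integral_normal_density)
  finally show "emeasure (std_normal_vec :: (real^'m) measure) (space std_normal_vec) = 1" .
qed

lemma measure_std_normal_vec_UNIV [simp]: "measure std_normal_vec (UNIV :: (real^'m) set) = 1"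
  using prob_space.prob_space[OF prob_space_std_normal_vec] by simp

lemma integral_std_normal_vec:
  fixes f :: "real^'m \<Rightarrow> 'b::{banach, second_countable_topology}"
  assumes [measurable]: "f \<in> borel_measurable borel"
  shows "(\<integral>x. f x \<partial>std_normal_vec) = (\<integral>x. vec_density x *\<^sub>R f x \<partial>lborel)"
  unfolding std_normal_vec_eq
  by (intro integral_density) (auto simp: vec_density_eq)

text \<open>The density and \<open>cis\<close> of an inner product both factor over the coordinates,
  which reduces the claim to the one-dimensional characteristic function.\<close>

lemma char_std_normal_vec:
  fixes t :: "real^'m"
  shows "(\<integral>x. cis (t \<bullet> x) \<partial>std_normal_vec) = complex_of_real (exp (- (norm t)\<^sup>2 / 2))"
proof -
  have 1: "(\<integral>x. std_normal_density x *\<^sub>R cis (s * x) \<partial>lborel) = complex_of_real (exp (- s\<^sup>2 / 2))" for s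
    using fun_cong[OF char_std_normal_distribution, of s]
    by (simp add: char_def integral_density cis_conv_exp)
  have 2: "integrable lborel (\<lambda>x. std_normal_density x *\<^sub>R cis (s * x))" for s
    by (rule Bochner_Integration.integrable_bound[OF integrable_normal_density[of 1 0]]) auto
  have cis_prod: "cis (\<Sum>i\<in>I. h i) = (\<Prod>i\<in>I. cis (h i))" if "finite I" for I and h :: "'m \<Rightarrow> real"
    using that by induction (auto simp flip: cis_mult)
  have cis_inner: "cis (t \<bullet> x) = (\<Prod>i\<in>UNIV. cis (t $ i * x $ i))" for x
    by (simp add: inner_vec_def cis_prod)
  have "(\<integral>x. cis (t \<bullet> x) \<partial>std_normal_vec)
      = (\<integral>x. vec_density x *\<^sub>R cis (t \<bullet> x) \<partial>lborel)"
    by (intro integral_std_normal_vec) simp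
  also have "\<dots> = (\<integral>x. (\<Prod>b\<in>Basis. std_normal_density (x \<bullet> b) *\<^sub>R cis ((t \<bullet> b) * (x \<bullet> b))) \<partial>lborel)"
    by (intro Bochner_Integration.integral_cong refl)
      (simp add: prod_Basis_vec vec_density_def inner_axis cis_inner scaleR_conv_of_real prod.distrib)
  also have "\<dots> = (\<Prod>b\<in>Basis. complex_of_real (exp (- (t \<bullet> b)\<^sup>2 / 2)))"
    using lborel_integral_prod[where 'a="real^'m" and f="\<lambda>b x. std_normal_density x *\<^sub>R cis ((t \<bullet> b) * x)"] 1 2
    by simp
  also have "\<dots> = complex_of_real (exp (\<Sum>i\<in>UNIV. - (t $ i)\<^sup>2 / 2))"
    by (simp add: prod_Basis_vec inner_axis exp_sum)
  also have "(\<Sum>i\<in>UNIV. - (t $ i)\<^sup>2 / 2) = - (norm t)\<^sup>2 / 2"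
    by (simp add: power2_norm_vec sum_negf sum_divide_distrib)
  finally show ?thesis .
qed

lemma vec_density_eq_char:
  fixes x :: "real^'m"
  shows "complex_of_real (vec_density x)
    = complex_of_real (vec_density (0::real^'m)) * (\<integral>z. cis (x \<bullet> z) \<partial>std_normal_vec)"
  unfolding char_std_normal_vec by (simp add: vec_density_eq)

lemma vec_density_le: "vec_density (x :: real^'m) \<le> vec_density (0 :: real^'m)"
  by (simp add: vec_density_eq mult_left_le)

lemma vec_density_nonneg: "0 \<le> vec_density x"
  by (simp add: vec_density_eq)

text \<open>The Gaussian density is, up to a constant, its own characteristic function, so the density of
  the convolution of a law with a Gaussian is an average of the characteristic function of that law.\<close>

lemma integral_vec_density_eq_char:
  fixes M :: "(real^'m) measure" and x :: "real^'m"
  assumes "prob_space M" and [measurable_cong]: "sets M = sets borel"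
  shows "complex_of_real (\<integral>y. vec_density ((x - y) /\<^sub>R s) \<partial>M)
    = complex_of_real (vec_density (0::real^'m)) *
        (\<integral>z. cis ((x /\<^sub>R s) \<bullet> z) * (\<integral>y. cis ((- z /\<^sub>R s) \<bullet> y) \<partial>M) \<partial>std_normal_vec)"
proof -
  interpret M: prob_space M by fact
  interpret N: prob_space "std_normal_vec :: (real^'m) measure" by (rule prob_space_std_normal_vec)
  interpret MN: pair_prob_space M "std_normal_vec :: (real^'m) measure" ..
  have "complex_of_real (\<integral>y. vec_density ((x - y) /\<^sub>R s) \<partial>M)
      = (\<integral>y. complex_of_real (vec_density ((x - y) /\<^sub>R s)) \<partial>M)"
    by simp
  also have "\<dots> = (\<integral>y. complex_of_real (vec_density (0::real^'m)) *
      (\<integral>z. cis (((x - y) /\<^sub>R s) \<bullet> z) \<partial>std_normal_vec) \<partial>M)"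
    by (intro Bochner_Integration.integral_cong refl vec_density_eq_char)
  also have "\<dots> = complex_of_real (vec_density (0::real^'m)) *
      (\<integral>y. (\<integral>z. cis (((x - y) /\<^sub>R s) \<bullet> z) \<partial>std_normal_vec) \<partial>M)"
    by simp
  also have "(\<integral>y. (\<integral>z. cis (((x - y) /\<^sub>R s) \<bullet> z) \<partial>std_normal_vec) \<partial>M)
      = (\<integral>z. (\<integral>y. cis (((x - y) /\<^sub>R s) \<bullet> z) \<partial>M) \<partial>std_normal_vec)"
    by (intro MN.Fubini_integral[symmetric] MN.integrable_const_bound[where B=1]) (auto simp: case_prod_beta')
  also have "\<dots> = (\<integral>z. (\<integral>y. cis ((x /\<^sub>R s) \<bullet> z) * cis ((- z /\<^sub>R s) \<bullet> y) \<partial>M) \<partial>std_normal_vec)"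
    by (intro Bochner_Integration.integral_cong refl)
      (simp add: cis_mult inner_simps inner_commute algebra_simps)
  finally show ?thesis by simp
qed

text \<open>The substitution x = y + s z and Fubini's theorem move the smoothing from
  \<open>f\<close> to the law: on the right stands, up to the power of s, the density at x of the
  convolution of \<open>M\<close> with a Gaussian of scale s. Convergence can then be checked on
  densities.\<close>

lemma integral_gaussian_smoothing:
  fixes M :: "(real^'m) measure" and f :: "real^'m \<Rightarrow> real"
  assumes "prob_space M" and [measurable_cong]: "sets M = sets borel"
    and f: "integrable lborel f" and s: "s > 0"
  shows "(\<integral>y. (\<integral>z. f (y + s *\<^sub>R z) \<partial>std_normal_vec) \<partial>M)
    = (\<integral>x. f x * (\<integral>y. vec_density ((x - y) /\<^sub>R s) \<partial>M) \<partial>lborel) / s ^ CARD('m)"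
proof -
  interpret M: prob_space M by fact
  interpret MB: pair_sigma_finite M "lborel :: (real^'m) measure" ..
  define C where "C = vec_density (0::real^'m)"
  have C: "C \<ge> 0" "vec_density x \<le> C" "\<bar>vec_density x\<bar> \<le> C" for x :: "real^'m"
    by (auto simp: C_def abs_of_nonneg vec_density_le vec_density_nonneg)
  have [measurable]: "f \<in> borel_measurable borel" using f by (simp add: integrable_iff_bounded)
  have le: "\<bar>f x * vec_density y\<bar> \<le> C * \<bar>f x\<bar>" for x and y :: "real^'m"
    by (metis C(3) abs_ge_zero abs_mult mult.commute mult_left_mono)
  have int: "integrable lborel (\<lambda>x. f x * vec_density ((x - y) /\<^sub>R s))" for y :: "real^'m"
    using C(1) le
    by (intro Bochner_Integration.integrable_bound[OF integrable_mult_right[OF f, of C]] AE_I2)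
      (simp_all add: abs_mult)
  have *: "(\<integral>z. f (y + s *\<^sub>R z) \<partial>std_normal_vec)
      = (\<integral>x. f x * vec_density ((x - y) /\<^sub>R s) \<partial>lborel) / s ^ CARD('m)" for y
  proof -
    have "(\<integral>x. f x * vec_density ((x - y) /\<^sub>R s) \<partial>lborel)
      = (\<integral>x. f x * vec_density ((x - y) /\<^sub>R s)
          \<partial>density (distr lborel borel (\<lambda>z. y + s *\<^sub>R z)) (\<lambda>_. ennreal (\<bar>s\<bar> ^ DIM(real^'m))))"
      using lborel_affine[of s y] s by simp
    also have "\<dots> = s ^ CARD('m) * (\<integral>z. f (y + s *\<^sub>R z) * vec_density z \<partial>lborel)"
      using s by (subst integral_density) (simp_all add: integral_distr)
    finally show ?thesis using s by (subst integral_std_normal_vec) (simp_all add: mult.commute)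
  qed
  have "(\<integral>y. (\<integral>x. f x * vec_density ((x - y) /\<^sub>R s) \<partial>lborel) \<partial>M)
      = (\<integral>x. (\<integral>y. f x * vec_density ((x - y) /\<^sub>R s) \<partial>M) \<partial>lborel)"
  proof (intro MB.Fubini_integral[symmetric] MB.Fubini_integrable)
    show "AE y in M. integrable lborel (\<lambda>x. case (y, x) of (y, x) \<Rightarrow> f x * vec_density ((x - y) /\<^sub>R s))"
      using int by simp
    show "integrable M (\<lambda>y. \<integral>x. norm (case (y, x) of (y, x) \<Rightarrow> f x * vec_density ((x - y) /\<^sub>R s)) \<partial>lborel)"
    proof (rule M.integrable_const_bound[where B="C * (\<integral>x. norm (f x) \<partial>lborel)"])
      show "AE y in M. norm (\<integral>x. norm (case (y, x) of (y, x) \<Rightarrow> f x * vec_density ((x - y) /\<^sub>R s)) \<partial>lborel)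
          \<le> C * (\<integral>x. norm (f x) \<partial>lborel)"
      proof (rule AE_I2)
        fix y :: "real^'m"
        have "(\<integral>x. norm (f x * vec_density ((x - y) /\<^sub>R s)) \<partial>lborel) \<le> (\<integral>x. C * norm (f x) \<partial>lborel)"
          using le by (intro integral_mono integrable_norm int integrable_mult_right f) simp
        then show "norm (\<integral>x. norm (case (y, x) of (y, x) \<Rightarrow> f x * vec_density ((x - y) /\<^sub>R s)) \<partial>lborel)
          \<le> C * (\<integral>x. norm (f x) \<partial>lborel)"
          by (simp add: integral_nonneg_AE)
      qed
    qed measurable
  qed measurable
  then show ?thesis by (simp add: *)
qed

text \<open>Dominated convergence is used twice: under the Gaussian, where characteristic functions
  are bounded by 1, to get pointwise convergence of the smoothed densities \<open>p\<close>; then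
  under Lebesgue measure, where these densities have a common bound and \<open>f\<close> is
  integrable.\<close>

lemma gaussian_smoothing_tendsto:
  fixes M :: "nat \<Rightarrow> (real^'m) measure" and N :: "(real^'m) measure" and f :: "real^'m \<Rightarrow> real"
  assumes M: "\<And>n. prob_space (M n)" "\<And>n. sets (M n) = sets borel"
    and N: "prob_space N" "sets N = sets borel"
    and char: "\<And>t. (\<lambda>n. \<integral>x. cis (t \<bullet> x) \<partial>M n) \<longlonglongrightarrow> (\<integral>x. cis (t \<bullet> x) \<partial>N)"
    and f: "integrable lborel f" and s: "s > 0"
  shows "(\<lambda>n. \<integral>y. (\<integral>z. f (y + s *\<^sub>R z) \<partial>std_normal_vec) \<partial>M n)
    \<longlonglongrightarrow> (\<integral>y. (\<integral>z. f (y + s *\<^sub>R z) \<partial>std_normal_vec) \<partial>N)"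
proof -
  note [measurable_cong] = M(2) N(2)
  interpret G: prob_space "std_normal_vec :: (real^'m) measure" by (rule prob_space_std_normal_vec)
  have [measurable]: "f \<in> borel_measurable borel" using f by (simp add: integrable_iff_bounded)
  define C where "C = vec_density (0::real^'m)"
  have C: "C \<ge> 0" "vec_density x \<le> C" "\<bar>vec_density x\<bar> \<le> C" for x :: "real^'m"
    by (auto simp: C_def abs_of_nonneg vec_density_le vec_density_nonneg)
  define p where "p L x = (\<integral>y. vec_density ((x - y) /\<^sub>R s) \<partial>L)" for L and x :: "real^'m"
  have p_meas [measurable]: "p L \<in> borel_measurable borel"
    if "prob_space L" and [measurable_cong]: "sets L = sets borel" for L
  proof -
    interpret prob_space L by fact
    show ?thesis unfolding p_def by measurable
  qed
  have p_bd: "\<bar>p L x\<bar> \<le> C" if "prob_space L" and [measurable_cong]: "sets L = sets borel" for L x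
  proof -
    interpret prob_space L by fact
    have "0 \<le> p L x" unfolding p_def by (intro integral_nonneg_AE AE_I2 vec_density_nonneg)
    moreover have "p L x \<le> C" unfolding p_def
      using C vec_density_nonneg by (intro integral_le_const integrable_const_bound[where B=C]) (auto simp: abs_of_nonneg)
    ultimately show ?thesis by simp
  qed
  have char_meas: "(\<lambda>z. \<integral>y. cis ((- z /\<^sub>R s) \<bullet> y) \<partial>L) \<in> borel_measurable borel"
    if "prob_space L" and [measurable_cong]: "sets L = sets borel" for L :: "(real^'m) measure"
  proof -
    interpret prob_space L by fact
    show ?thesis by measurable
  qed
  have char_bd: "norm (\<integral>y. cis (t \<bullet> y) \<partial>L) \<le> 1" if "prob_space L" "sets L = sets borel"
    for L :: "(real^'m) measure" and t
  proof -
    interpret prob_space L by fact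
    show ?thesis using integral_norm_bound[of L "\<lambda>y. cis (t \<bullet> y)"] by (simp add: prob_space)
  qed
  have p_lim: "(\<lambda>n. p (M n) x) \<longlonglongrightarrow> p N x" for x
  proof -
    have "(\<lambda>n. \<integral>z. cis ((x /\<^sub>R s) \<bullet> z) * (\<integral>y. cis ((- z /\<^sub>R s) \<bullet> y) \<partial>M n) \<partial>std_normal_vec)
       \<longlonglongrightarrow> (\<integral>z. cis ((x /\<^sub>R s) \<bullet> z) * (\<integral>y. cis ((- z /\<^sub>R s) \<bullet> y) \<partial>N) \<partial>std_normal_vec)"
      using char_meas[OF M] char_meas[OF N]
      by (intro integral_dominated_convergence[where w="\<lambda>_. 1"] AE_I2 tendsto_mult tendsto_const char)
        (auto simp: norm_mult char_bd[OF M] char_bd[OF N] simp del: inner_scaleR_left inner_minus_left)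
    from tendsto_mult[OF tendsto_const[of "complex_of_real C"] this]
    have "(\<lambda>n. complex_of_real (p (M n) x)) \<longlonglongrightarrow> complex_of_real (p N x)"
      unfolding p_def integral_vec_density_eq_char[OF M] integral_vec_density_eq_char[OF N] C_def .
    then show ?thesis by (simp only: tendsto_of_real_iff)
  qed
  have "(\<lambda>n. \<integral>x. f x * p (M n) x \<partial>lborel) \<longlonglongrightarrow> (\<integral>x. f x * p N x \<partial>lborel)"
    using C p_bd[OF M] p_bd[OF N] p_meas[OF M] p_meas[OF N]
    by (intro integral_dominated_convergence[where w="\<lambda>x. norm (f x) * C"] AE_I2 tendsto_mult
        tendsto_const p_lim integrable_mult_left integrable_norm f)
      (auto simp: abs_mult intro!: mult_left_mono)
  from tendsto_divide[OF this tendsto_const[of "s ^ CARD('m)"]] s show ?thesis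
    unfolding integral_gaussian_smoothing[OF M f s] integral_gaussian_smoothing[OF N f s] p_def
    by simp
qed

lemma uniformly_continuous_compact_support:
  fixes f :: "'a::euclidean_space \<Rightarrow> 'b::real_normed_vector"
  assumes f: "continuous_on UNIV f" and R: "\<And>x. norm x > R \<Longrightarrow> f x = 0" and "e > 0"
  shows "\<exists>d>0. \<forall>x y. norm (x - y) < d \<longrightarrow> norm (f x - f y) < e"
proof -
  \<comment> \<open>With the margin 1, two points at distance less than 1 lie either both in the
    larger ball or both where f vanishes.\<close>
  have "uniformly_continuous_on (cball 0 (R + 1)) f"
    using f by (intro compact_uniformly_continuous) (auto intro: continuous_on_subset)
  then obtain d where d: "d > 0"
      "\<And>x y. x \<in> cball 0 (R + 1) \<Longrightarrow> y \<in> cball 0 (R + 1) \<Longrightarrow> dist y x < d \<Longrightarrow> dist (f y) (f x) < e"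
    using \<open>e > 0\<close> unfolding uniformly_continuous_on_def by blast
  show ?thesis
  proof (intro exI[of _ "min d 1"] conjI allI impI)
    show "min d 1 > 0" using d by simp
    fix x y :: 'a assume xy: "norm (x - y) < min d 1"
    show "norm (f x - f y) < e"
    proof (cases "norm x \<le> R \<or> norm y \<le> R")
      case True
      then have "norm x \<le> R + 1" "norm y \<le> R + 1"
        using xy norm_triangle_ineq2[of x y] norm_triangle_ineq3[of x y] by auto
      then show ?thesis using d(2)[of y x] xy by (simp add: dist_norm)
    next
      case False
      then show ?thesis using R \<open>e > 0\<close> by simp
    qed
  qed
qed

text \<open>By uniform continuity f is uniformly close to its Gaussian smoothing, for which
  convergence is known. The closeness is the same under all laws, so tightness is not an issue at
  this stage.\<close>

lemma vague_convergence_of_char: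
  fixes M :: "nat \<Rightarrow> (real^'m) measure" and N :: "(real^'m) measure" and f :: "real^'m \<Rightarrow> real"
  assumes M: "\<And>n. prob_space (M n)" "\<And>n. sets (M n) = sets borel"
    and N: "prob_space N" "sets N = sets borel"
    and char: "\<And>t. (\<lambda>n. \<integral>x. cis (t \<bullet> x) \<partial>M n) \<longlonglongrightarrow> (\<integral>x. cis (t \<bullet> x) \<partial>N)"
    and f: "continuous_on UNIV f" and R: "\<And>x. norm x > R \<Longrightarrow> f x = 0"
  shows "(\<lambda>n. \<integral>x. f x \<partial>M n) \<longlonglongrightarrow> (\<integral>x. f x \<partial>N)"
proof -
  interpret G: prob_space "std_normal_vec :: (real^'m) measure" by (rule prob_space_std_normal_vec)
  have [measurable]: "f \<in> borel_measurable borel" using f by (rule borel_measurable_continuous_onI)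
  have "bounded (f ` cball 0 R)"
    using f by (intro compact_imp_bounded compact_continuous_image) (auto intro: continuous_on_subset)
  then obtain B' where B': "\<And>x. x \<in> cball 0 R \<Longrightarrow> norm (f x) \<le> B'" unfolding bounded_iff by blast
  define B where "B = max B' 0"
  have B: "B \<ge> 0" "\<bar>f x\<bar> \<le> B" for x
    using B'[of x] R[of x] by (cases "norm x \<le> R"; force simp: B_def)+
  have f_int: "integrable lborel f"
  proof -
    have "integrable lborel (\<lambda>x. indicator (cball 0 R) x *\<^sub>R f x)"
      using f by (intro borel_integrable_compact) (auto intro: continuous_on_subset)
    moreover have "(\<lambda>x. indicator (cball 0 R) x *\<^sub>R f x) = f"
      using R by (auto simp: indicator_def fun_eq_iff)
    ultimately show ?thesis by simp
  qed
  show ?thesis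
  proof (rule LIMSEQ_I)
    fix e :: real assume "e > 0"
    then obtain d where d: "d > 0" "\<And>x y. norm (x - y) < d \<Longrightarrow> norm (f x - f y) < e / 8"
      using uniformly_continuous_compact_support[OF f R, of R "e / 8"] by auto
    have "(\<lambda>k. measure std_normal_vec {z::real^'m. real k \<le> norm z}) \<longlonglongrightarrow>
        measure std_normal_vec (\<Inter>k. {z::real^'m. real k \<le> norm z})"
      by (intro G.finite_Lim_measure_decseq) (auto simp: decseq_def)
    also have "(\<Inter>k. {z::real^'m. real k \<le> norm z}) = {}"
    proof (rule equals0I)
      fix z :: "real^'m" assume z: "z \<in> (\<Inter>k. {z. real k \<le> norm z})"
      obtain k where "norm z < real k" using reals_Archimedean2 by blast
      then show False using z by (auto simp: not_le[symmetric])
    qed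
    finally have "eventually (\<lambda>k. measure std_normal_vec {z::real^'m. real k \<le> norm z} < e / (16 * (B + 1))) sequentially"
      using \<open>e > 0\<close> B by (intro order_tendstoD) auto
    then obtain k where k: "measure std_normal_vec {z::real^'m. real k \<le> norm z} < e / (16 * (B + 1))"
      by (auto simp: eventually_sequentially)
    \<comment> \<open>At this scale the shift s z stays below d whenever norm z < k, while larger z
      have Gaussian mass below e / (16 (B + 1)). Each of the two parts contributes at most e / 8;
      the \<open>+ 1\<close> next to B covers B = 0.\<close>
    define s where "s = d / (real k + 1)"
    have s: "s > 0" using d by (simp add: s_def)
    define F where "F y = (\<integral>z. f (y + s *\<^sub>R z) \<partial>std_normal_vec)" for y
    have F_meas [measurable]: "F \<in> borel_measurable borel" unfolding F_def by measurable
    have F: "\<bar>F y - f y\<bar> \<le> e / 4" for y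
    proof -
      have int: "integrable std_normal_vec (\<lambda>z. f (y + s *\<^sub>R z))"
        using B by (intro G.integrable_const_bound[where B=B]) auto
      have "F y - f y = (\<integral>z. f (y + s *\<^sub>R z) - f y \<partial>std_normal_vec)"
        unfolding F_def using int by (simp add: G.prob_space)
      also have "\<bar>\<dots>\<bar> \<le> (\<integral>z. \<bar>f (y + s *\<^sub>R z) - f y\<bar> \<partial>std_normal_vec)"
        by (rule integral_abs_bound)
      also have "\<dots> \<le> (\<integral>z. e / 8 + 2 * B * indicator {z::real^'m. real k \<le> norm z} z \<partial>std_normal_vec)"
      proof (rule integral_mono)
        show "integrable std_normal_vec (\<lambda>z. \<bar>f (y + s *\<^sub>R z) - f y\<bar>)" using int by simp
        show "integrable std_normal_vec (\<lambda>z. e / 8 + 2 * B * indicator {z::real^'m. real k \<le> norm z} z)"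
          by (intro Bochner_Integration.integrable_add integrable_mult_right) (auto simp: G.emeasure_eq_measure)
        fix z :: "real^'m"
        show "\<bar>f (y + s *\<^sub>R z) - f y\<bar> \<le> e / 8 + 2 * B * indicator {z. real k \<le> norm z} z"
        proof (cases "real k \<le> norm z")
          case True
          then show ?thesis using B(2)[of y] B(2)[of "y + s *\<^sub>R z"] \<open>e > 0\<close> by simp
        next
          case False
          then have "norm z < real k + 1" by simp
          then have "s * norm z < s * (real k + 1)" using s by (rule mult_strict_left_mono)
          then have "s * norm z < d" using add_pos_nonneg[of 1 "real k"] by (simp add: s_def)
          then show ?thesis using d(2)[of "y + s *\<^sub>R z" y] False s by simp
        qed
      qed
      also have "\<dots> = e / 8 + 2 * B * measure std_normal_vec {z::real^'m. real k \<le> norm z}"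
        by (subst Bochner_Integration.integral_add) (auto simp: G.emeasure_eq_measure G.prob_space)
      also have "\<dots> \<le> e / 8 + 2 * (B + 1) * (e / (16 * (B + 1)))"
        using k B by (intro add_left_mono mult_mono) auto
      also have "\<dots> = e / 4" using B by (simp add: field_simps)
      finally show ?thesis .
    qed
    have FL: "\<bar>(\<integral>y. F y \<partial>L) - (\<integral>y. f y \<partial>L)\<bar> \<le> e / 4"
      if "prob_space L" and [measurable_cong]: "sets L = sets borel" for L
    proof -
      interpret L: prob_space L by fact
      have f: "integrable L f" using B by (intro L.integrable_const_bound[where B=B]) auto
      have F': "integrable L F"
      proof (rule L.integrable_const_bound[where B="B + e / 4"])
        show "AE x in L. norm (F x) \<le> B + e / 4"
        proof (rule AE_I2)
          show "norm (F x) \<le> B + e / 4" for x using F[of x] B(2)[of x] unfolding real_norm_def by linarith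
        qed
      qed measurable
      have "\<bar>(\<integral>y. F y \<partial>L) - (\<integral>y. f y \<partial>L)\<bar> = \<bar>\<integral>y. F y - f y \<partial>L\<bar>"
        using f F' by simp
      also have "\<dots> \<le> (\<integral>y. \<bar>F y - f y\<bar> \<partial>L)" by (rule integral_abs_bound)
      also have "\<dots> \<le> e / 4" using f F' F by (intro L.integral_le_const) auto
      finally show ?thesis .
    qed
    have "(\<lambda>n. \<integral>y. F y \<partial>M n) \<longlonglongrightarrow> (\<integral>y. F y \<partial>N)"
      unfolding F_def by (intro gaussian_smoothing_tendsto M N char f_int s)
    then obtain n0 where n0: "\<And>n. n \<ge> n0 \<Longrightarrow> norm ((\<integral>y. F y \<partial>M n) - (\<integral>y. F y \<partial>N)) < e / 4"
      using \<open>e > 0\<close> by (metis LIMSEQ_D zero_less_divide_iff zero_less_numeral)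
    have "norm ((\<integral>x. f x \<partial>M n) - (\<integral>x. f x \<partial>N)) < e" if "n \<ge> n0" for n
      using n0[OF that] FL[OF M, of n] FL[OF N] \<open>e > 0\<close> unfolding real_norm_def by linarith
    then show "\<exists>n0. \<forall>n\<ge>n0. norm ((\<integral>x. f x \<partial>M n) - (\<integral>x. f x \<partial>N)) < e" by blast
  qed
qed

text \<open>Tightness comes for free: the cutoffs \<open>h k\<close> have compact support, so their
  integrals converge by \<open>vague_convergence_of_char\<close>, and since the limit has total mass
  1, little mass of \<open>M n\<close> can escape for large n. Cutting off f costs at most
  \<open>B\<close> times the escaped mass.\<close>

theorem levy_continuity_vec:
  fixes M :: "nat \<Rightarrow> (real^'m) measure" and N :: "(real^'m) measure" and f :: "real^'m \<Rightarrow> real"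
  assumes M: "\<And>n. prob_space (M n)" "\<And>n. sets (M n) = sets borel"
    and N: "prob_space N" "sets N = sets borel"
    and char: "\<And>t. (\<lambda>n. \<integral>x. cis (t \<bullet> x) \<partial>M n) \<longlonglongrightarrow> (\<integral>x. cis (t \<bullet> x) \<partial>N)"
    and f: "continuous_on UNIV f" "bounded (range f)"
  shows "(\<lambda>n. \<integral>x. f x \<partial>M n) \<longlonglongrightarrow> (\<integral>x. f x \<partial>N)"
proof -
  interpret N: prob_space N by (rule N)
  note [measurable_cong] = N(2)
  have f_meas [measurable]: "f \<in> borel_measurable borel" using f(1) by (rule borel_measurable_continuous_onI)
  obtain B where "\<And>x. norm (f x) \<le> B" using f(2) by (auto simp: bounded_iff)
  then have B: "B \<ge> 0" "\<And>x. \<bar>f x\<bar> \<le> B" using norm_ge_zero order_trans by (blast, simp)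
  define h :: "nat \<Rightarrow> real^'m \<Rightarrow> real" where "h k x = max 0 (min 1 (real k + 1 - norm x))" for k x
  have h: "0 \<le> h k x" "h k x \<le> 1" for k x by (auto simp: h_def)
  have h0: "h k x = 0" if "norm x > real k + 1" for k x using that by (simp add: h_def)
  have h_cont: "continuous_on UNIV (h k)" for k unfolding h_def by (intro continuous_intros)
  then have h_meas [measurable]: "h k \<in> borel_measurable borel" for k by (rule borel_measurable_continuous_onI)
  have int: "integrable L (h k)" "integrable L f" "integrable L (\<lambda>x. f x * h k x)"
    if "prob_space L" and [measurable_cong]: "sets L = sets borel" for L k
  proof -
    interpret L: prob_space L by fact
    show "integrable L (h k)" using h by (intro L.integrable_const_bound[where B=1]) auto
    show "integrable L f" using B by (intro L.integrable_const_bound[where B=B]) auto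
    show "integrable L (\<lambda>x. f x * h k x)"
      using B h mult_mono[of "\<bar>f x\<bar>" B "\<bar>h k x\<bar>" 1 for x]
      by (intro L.integrable_const_bound[where B=B] AE_I2) (auto simp: abs_mult)
  qed
  have cut: "\<bar>(\<integral>x. f x \<partial>L) - (\<integral>x. f x * h k x \<partial>L)\<bar> \<le> B * (1 - (\<integral>x. h k x \<partial>L))"
    if L: "prob_space L" "sets L = sets borel" for L k
  proof -
    interpret L: prob_space L by fact
    have "\<bar>(\<integral>x. f x \<partial>L) - (\<integral>x. f x * h k x \<partial>L)\<bar> = \<bar>\<integral>x. f x - f x * h k x \<partial>L\<bar>"
      using int[OF L] by simp
    also have "\<dots> \<le> (\<integral>x. \<bar>f x - f x * h k x\<bar> \<partial>L)" by (rule integral_abs_bound)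
    also have "\<dots> \<le> (\<integral>x. B * (1 - h k x) \<partial>L)"
    proof (rule integral_mono)
      show "\<bar>f x - f x * h k x\<bar> \<le> B * (1 - h k x)" for x
      proof -
        have "\<bar>f x - f x * h k x\<bar> = \<bar>f x\<bar> * (1 - h k x)"
          using h[of k x] abs_mult[of "f x" "1 - h k x"] by (simp add: right_diff_distrib)
        then show ?thesis using B h by (simp add: mult_right_mono)
      qed
    qed (use int[OF L] in auto)
    also have "\<dots> = B * (1 - (\<integral>x. h k x \<partial>L))" using int[OF L] by (simp add: L.prob_space)
    finally show ?thesis .
  qed
  have "(\<lambda>k. \<integral>x. h k x \<partial>N) \<longlonglongrightarrow> (\<integral>x. 1 \<partial>N)"
  proof (rule integral_dominated_convergence[where w="\<lambda>_. 1"])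
    show "AE x in N. (\<lambda>k. h k x) \<longlonglongrightarrow> 1"
    proof (rule AE_I2)
      fix x :: "real^'m"
      obtain k0 where "norm x \<le> real k0" using real_arch_simple by blast
      then have "eventually (\<lambda>k. h k x = 1) sequentially"
        by (auto simp: eventually_sequentially h_def intro!: exI[of _ k0])
      then show "(\<lambda>k. h k x) \<longlonglongrightarrow> 1" by (rule tendsto_eventually)
    qed
  qed (use h in auto)
  then have hN: "(\<lambda>k. \<integral>x. h k x \<partial>N) \<longlonglongrightarrow> 1" by (simp add: N.prob_space)
  show ?thesis
  proof (rule LIMSEQ_I)
    fix e :: real assume "e > 0"
    \<comment> \<open>The cutoffs under \<open>M n\<close> and under \<open>N\<close> cost at most B
      \<delta> <= e / 4 each, and the truncated integrals differ by less than e / 4.\<close>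
    define \<delta> where "\<delta> = e / (4 * (B + 1))"
    have \<delta>: "\<delta> > 0" "B * \<delta> \<le> e / 4" using \<open>e > 0\<close> B by (auto simp: \<delta>_def field_simps)
    from hN \<delta> obtain k where k: "\<bar>(\<integral>x. h k x \<partial>N) - 1\<bar> < \<delta> / 2"
      using LIMSEQ_D[of "\<lambda>k. \<integral>x. h k x \<partial>N" 1 "\<delta> / 2"] by (auto)
    have 1: "(\<lambda>n. \<integral>x. h k x \<partial>M n) \<longlonglongrightarrow> (\<integral>x. h k x \<partial>N)"
      by (intro vague_convergence_of_char[where R="real k + 1"] M N char h_cont h0)
    have 2: "(\<lambda>n. \<integral>x. f x * h k x \<partial>M n) \<longlonglongrightarrow> (\<integral>x. f x * h k x \<partial>N)"
      by (intro vague_convergence_of_char[where R="real k + 1"] M N char continuous_on_mult f h_cont)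
        (simp add: h0)
    obtain n1 where n1: "\<And>n. n \<ge> n1 \<Longrightarrow> \<bar>(\<integral>x. h k x \<partial>M n) - (\<integral>x. h k x \<partial>N)\<bar> < \<delta> / 2"
      using LIMSEQ_D[OF 1, of "\<delta> / 2"] \<delta> by auto
    obtain n2 where n2: "\<And>n. n \<ge> n2 \<Longrightarrow> \<bar>(\<integral>x. f x * h k x \<partial>M n) - (\<integral>x. f x * h k x \<partial>N)\<bar> < e / 4"
      using LIMSEQ_D[OF 2, of "e / 4"] \<open>e > 0\<close> by auto
    have "norm ((\<integral>x. f x \<partial>M n) - (\<integral>x. f x \<partial>N)) < e" if n: "n \<ge> max n1 n2" for n
    proof -
      have "1 - (\<integral>x. h k x \<partial>M n) \<le> \<delta>" using n1[of n] k n by (simp add: abs_real_def split: if_splits)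
      then have "B * (1 - (\<integral>x. h k x \<partial>M n)) \<le> e / 4"
        using mult_left_mono[of _ \<delta> B] B \<delta> by fastforce
      moreover have "1 - (\<integral>x. h k x \<partial>N) \<le> \<delta>" using k \<delta> by (simp add: abs_real_def split: if_splits)
      then have "B * (1 - (\<integral>x. h k x \<partial>N)) \<le> e / 4"
        using mult_left_mono[of _ \<delta> B] B \<delta> by fastforce
      moreover have "\<bar>(\<integral>x. f x * h k x \<partial>M n) - (\<integral>x. f x * h k x \<partial>N)\<bar> < e / 4" using n2 n by simp
      ultimately show ?thesis using cut[OF M, of n k] cut[OF N, of k]
        unfolding real_norm_def by linarith
    qed
    then show "\<exists>n0. \<forall>n\<ge>n0. norm ((\<integral>x. f x \<partial>M n) - (\<integral>x. f x \<partial>N)) < e" by blast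
  qed
qed

section \<open>The unit vector map, and deterministic recursions\<close>

lemma borel_measurable_sgn_vec [measurable]: "(sgn :: 'a::euclidean_space \<Rightarrow> 'a) \<in> borel_measurable borel"
  unfolding sgn_div_norm[abs_def] by measurable

lemma norm_sgn_le: "norm (sgn x) \<le> 1"
  by (simp add: norm_sgn)

lemma norm_scaleR_sgn: "norm x *\<^sub>R sgn x = (x :: 'a::real_normed_vector)"
  by (cases "x = 0") (auto simp: sgn_div_norm)

text \<open>Multiplication by \<open>norm v\<close> leaves only norms and h itself, so the bound
  holds for all h, including h = v where the convention sgn 0 = 0 applies. The next two expansions
  are global in h in the same way; the price is an inverse power of \<open>norm v\<close>, whose
  expectation [A1] controls.\<close>

lemma norm_sgn_diff_le:
  fixes v h :: "'a::real_inner"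
  assumes "v \<noteq> 0"
  shows "norm (sgn (v - h) - sgn v) \<le> 2 * norm h / norm v"
proof -
  have "norm v *\<^sub>R (sgn (v - h) - sgn v) = (norm v - norm (v - h)) *\<^sub>R sgn (v - h) - h"
    by (simp add: algebra_simps norm_scaleR_sgn)
  also have "norm \<dots> \<le> \<bar>norm v - norm (v - h)\<bar> * norm (sgn (v - h)) + norm h"
    by (metis norm_scaleR norm_triangle_ineq4)
  also have "\<dots> \<le> norm h * 1 + norm h"
    using norm_triangle_ineq3[of v "v - h"] by (intro add_mono mult_mono norm_sgn_le) auto
  finally have "norm v * norm (sgn (v - h) - sgn v) \<le> 2 * norm h"
    by (simp flip: norm_scaleR[of "norm v", simplified])
  then show ?thesis using assms by (simp add: field_simps)
qed

lemma norm_diff_expansion: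
  fixes v h :: "'a::real_inner"
  assumes "v \<noteq> 0"
  shows "\<bar>norm (v - h) - norm v + sgn v \<bullet> h\<bar> \<le> 2 * (norm h)\<^sup>2 / norm v"
proof -
  define a b p where "a = norm v" and "b = norm (v - h)" and "p = sgn v \<bullet> h"
  have a: "a > 0" "b \<ge> 0" using assms by (auto simp: a_def b_def)
  have p: "v \<bullet> h = a * p" using norm_scaleR_sgn[of v] by (metis a_def inner_scaleR_left p_def)
  have b2: "b\<^sup>2 = a\<^sup>2 - 2 * (a * p) + (norm h)\<^sup>2"
    using p by (simp add: a_def b_def power2_norm_eq_inner inner_simps inner_commute)
  have ab: "\<bar>a - b\<bar> \<le> norm h" using norm_triangle_ineq3[of v "v - h"] by (simp add: a_def b_def)
  have pp: "\<bar>p\<bar> \<le> norm h"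
    using Cauchy_Schwarz_ineq2[of "sgn v" h] assms by (simp add: p_def norm_sgn)
  \<comment> \<open>The difference of squares is known exactly, so after multiplication by a + b the
    error becomes a sum of terms quadratic in h.\<close>
  have "(a + b) * (b - a + p) = (norm h)\<^sup>2 - (a - b) * p"
    using b2 by (simp add: algebra_simps power2_eq_square)
  then have "(a + b) * \<bar>b - a + p\<bar> = \<bar>(norm h)\<^sup>2 - (a - b) * p\<bar>"
    using a by (metis abs_mult abs_of_nonneg add_nonneg_nonneg less_eq_real_def)
  also have "\<dots> \<le> (norm h)\<^sup>2 + \<bar>a - b\<bar> * \<bar>p\<bar>"
    using abs_triangle_ineq4[of "(norm h)\<^sup>2" "(a - b) * p"] by (simp add: abs_mult)
  also have "\<dots> \<le> 2 * (norm h)\<^sup>2"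
    using mult_mono[OF ab pp] by (simp add: power2_eq_square)
  finally have "(a + b) * \<bar>b - a + p\<bar> \<le> 2 * (norm h)\<^sup>2" .
  moreover have "a * \<bar>b - a + p\<bar> \<le> (a + b) * \<bar>b - a + p\<bar>" using a by (intro mult_right_mono) auto
  ultimately have "a * \<bar>b - a + p\<bar> \<le> 2 * (norm h)\<^sup>2" by linarith
  then show ?thesis using a by (simp add: field_simps a_def b_def p_def)
qed

lemma sgn_diff_expansion:
  fixes v h :: "'a::real_inner"
  assumes "v \<noteq> 0"
  shows "norm (sgn (v - h) - sgn v + (h - (sgn v \<bullet> h) *\<^sub>R sgn v) /\<^sub>R norm v) \<le> 4 * (norm h)\<^sup>2 / (norm v)\<^sup>2"
proof -
  define a b p where "a = norm v" and "b = norm (v - h)" and "p = sgn v \<bullet> h"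
  have a: "a > 0" using assms by (auto simp: a_def)
  have va: "v = a *\<^sub>R sgn v" "v - h = b *\<^sub>R sgn (v - h)" by (simp_all add: a_def b_def norm_scaleR_sgn)
  have "a *\<^sub>R (sgn (v - h) - sgn v + (h - p *\<^sub>R sgn v) /\<^sub>R a)
      = a *\<^sub>R sgn (v - h) - (v - h) - p *\<^sub>R sgn v"
    using a va(1) by (simp add: scaleR_add_right scaleR_diff_right)
  \<comment> \<open>The first summand is a product of two first-order quantities, the second is the
    second-order remainder of the norm; both are already estimated.\<close>
  also have "\<dots> = (a - b) *\<^sub>R (sgn (v - h) - sgn v) - (b - a + p) *\<^sub>R sgn v"
    by (subst va(2)) (simp add: algebra_simps)
  also have "norm \<dots> \<le> \<bar>a - b\<bar> * norm (sgn (v - h) - sgn v) + \<bar>b - a + p\<bar> * norm (sgn v)"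
    by (metis norm_scaleR norm_triangle_ineq4)
  also have "\<dots> \<le> norm h * (2 * norm h / a) + (2 * (norm h)\<^sup>2 / a) * 1"
    using norm_triangle_ineq3[of v "v - h"] norm_sgn_diff_le[OF assms, of h] norm_diff_expansion[OF assms, of h]
    by (intro add_mono mult_mono norm_sgn_le) (auto simp: a_def b_def p_def)
  also have "\<dots> = 4 * (norm h)\<^sup>2 / a" by (simp add: power2_eq_square)
  finally have "a * norm (sgn (v - h) - sgn v + (h - p *\<^sub>R sgn v) /\<^sub>R a) \<le> 4 * (norm h)\<^sup>2 / a"
    using a by simp
  then show ?thesis using a by (simp add: field_simps power2_eq_square a_def p_def)
qed

section \<open>Scalar recursions and sums of powers\<close>

lemma le_one_plus_square: "a \<le> 1 + a\<^sup>2" for a :: real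
  using zero_le_power2[of "a - 1 / 2"] by (simp add: power2_diff power_divide)

lemma powr_step_le:
  assumes "0 < a" "(n::nat) \<ge> 1"
  shows "real n powr (- a) - real (n + 1) powr (- a) \<le> a * real n powr (- a - 1)"
proof -
  have "\<exists>z>real n. z < real (n + 1) \<and> (- (real (n + 1) powr (- a))) - (- (real n powr (- a)))
      = (real (n + 1) - real n) * (a * z powr (- a - 1))"
    using assms by (intro MVT2) (auto intro!: derivative_eq_intros)
  then obtain z where z: "z > real n"
    "(- (real (n + 1) powr (- a))) - (- (real n powr (- a))) = (real (n + 1) - real n) * (a * z powr (- a - 1))"
    by blast
  have "z powr (- a - 1) \<le> real n powr (- a - 1)"
    using z assms by (intro powr_mono2') auto
  then show ?thesis using z assms by (simp add: mult_left_mono)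
qed

text \<open>Comparison with D times n powr -\<alpha>. Half of the contraction absorbs the noise as
  soon as D >= 2 B / \<kappa>. The other half absorbs the decrease of the comparison sequence, which
  has order n powr (-\<alpha> - 1) and is negligible against n powr (-2 \<alpha>) because \<alpha> <
  1.\<close>

lemma robbins_monro_recursion:
  fixes v :: "nat \<Rightarrow> real" and \<kappa> B \<alpha> :: real
  assumes a: "0 < \<alpha>" "\<alpha> < 1" and k: "\<kappa> > 0" and B: "B \<ge> 0"
    and rec: "\<And>n. n \<ge> 1 \<Longrightarrow> v (n + 1) \<le> (1 - \<kappa> * real n powr (- \<alpha>)) * v n + B * real n powr (- (2 * \<alpha>))"
  shows "\<exists>D\<ge>0. \<forall>n\<ge>1. v n \<le> D * real n powr (- \<alpha>)"
proof -
  have "(\<lambda>n. real n powr (- \<alpha>)) \<longlonglongrightarrow> 0"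
    using a by (intro tendsto_neg_powr filterlim_real_sequentially) auto
  then have "eventually (\<lambda>n. real n powr (- \<alpha>) < 1 / \<kappa>) sequentially"
    using k by (intro order_tendstoD) auto
  moreover have "(\<lambda>n. real n powr (- (1 - \<alpha>))) \<longlonglongrightarrow> 0"
    using a by (intro tendsto_neg_powr filterlim_real_sequentially) auto
  then have "eventually (\<lambda>n. real n powr (- (1 - \<alpha>)) < \<kappa> / (2 * \<alpha>)) sequentially"
    using k a by (intro order_tendstoD) auto
  ultimately have "eventually (\<lambda>n. real n powr (- \<alpha>) < 1 / \<kappa> \<and> real n powr (- (1 - \<alpha>)) < \<kappa> / (2 * \<alpha>)) sequentially"
    by eventually_elim simp
  then obtain n1 where n1: "\<And>n. n \<ge> n1 \<Longrightarrow> real n powr (- \<alpha>) < 1 / \<kappa> \<and> real n powr (- (1 - \<alpha>)) < \<kappa> / (2 * \<alpha>)"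
    by (auto simp: eventually_sequentially)
  \<comment> \<open>From n0 on, the contraction factor is nonnegative, so the induction hypothesis
    may be multiplied by it, and the comparison sequence decreases slowly enough.\<close>
  define n0 where "n0 = max n1 1"
  have n0: "n0 \<ge> 1" "\<And>n. n \<ge> n0 \<Longrightarrow> \<kappa> * real n powr (- \<alpha>) \<le> 1"
     "\<And>n. n \<ge> n0 \<Longrightarrow> \<alpha> * real n powr (- (1 - \<alpha>)) \<le> \<kappa> / 2"
    using n1 k a by (auto simp: n0_def field_simps less_imp_le)
  \<comment> \<open>The maximum takes care of the finitely many indices up to n0, the second summand
    of the noise.\<close>
  define D where "D = Max ((\<lambda>n. max 0 (v n / real n powr (- \<alpha>))) ` {1..n0}) + 2 * B / \<kappa>"
  have D1: "v n \<le> D * real n powr (- \<alpha>)" "0 \<le> D" if "n \<in> {1..n0}" for n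
  proof -
    have "max 0 (v n / real n powr (- \<alpha>)) \<le> Max ((\<lambda>n. max 0 (v n / real n powr (- \<alpha>))) ` {1..n0})"
      using that by (intro Max_ge) auto
    moreover have "2 * B / \<kappa> \<ge> 0" using B k by simp
    ultimately have *: "max 0 (v n / real n powr (- \<alpha>)) \<le> D" unfolding D_def by linarith
    then show "0 \<le> D" by simp
    have "real n powr (- \<alpha>) > 0" using that by simp
    with * show "v n \<le> D * real n powr (- \<alpha>)" by (simp add: pos_divide_le_eq)
  qed
  have D0: "D \<ge> 0" using D1(2)[of 1] n0 by simp
  have DB: "B \<le> D * \<kappa> / 2"
  proof -
    have "0 \<le> Max ((\<lambda>n. max 0 (v n / real n powr (- \<alpha>))) ` {1..n0})"
      using n0 by (subst Max_ge_iff) (auto intro!: bexI[of _ 1])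
    then have "2 * B / \<kappa> \<le> D" by (simp add: D_def)
    then show ?thesis using k by (simp add: field_simps)
  qed
  have "v n \<le> D * real n powr (- \<alpha>)" if "n \<ge> n0" for n
    using that
  proof (induction n rule: dec_induct)
    case base
    then show ?case using D1 n0 by simp
  next
    case (step n)
    have n: "n \<ge> 1" using step n0 by simp
    define u where "u = real n powr (- \<alpha>)"
    have u: "u > 0" using n by (simp add: u_def)
    have u2: "real n powr (- (2 * \<alpha>)) = u * u" by (simp add: u_def flip: powr_add)
    have u3: "real n powr (- \<alpha> - 1) = real n powr (- (1 - \<alpha>)) * (u * u)"
      by (simp add: u_def flip: powr_add)
    have "v (n + 1) \<le> (1 - \<kappa> * u) * v n + B * (u * u)" using rec[OF n] by (simp add: u_def u2)
    also have "\<dots> \<le> (1 - \<kappa> * u) * (D * u) + (D * \<kappa> / 2) * (u * u)"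
      using step n0(2)[of n] DB u by (intro add_mono mult_left_mono mult_right_mono) (auto simp: u_def)
    also have "\<dots> = D * (u - (\<kappa> / 2) * (u * u))" by (simp add: algebra_simps)
    also have "\<dots> \<le> D * real (n + 1) powr (- \<alpha>)"
    proof (rule mult_left_mono[OF _ D0])
      have "u - real (n + 1) powr (- \<alpha>) \<le> (\<alpha> * real n powr (- (1 - \<alpha>))) * (u * u)"
        using powr_step_le[of \<alpha> n] a n by (simp add: u_def[symmetric] u3)
      also have "\<dots> \<le> (\<kappa> / 2) * (u * u)" using n0(3)[of n] step u by (intro mult_right_mono) auto
      finally show "u - (\<kappa> / 2) * (u * u) \<le> real (n + 1) powr (- \<alpha>)" by simp
    qed
    finally show ?case by simp
  qed
  then have "\<forall>n\<ge>1. v n \<le> D * real n powr (- \<alpha>)" using D1 by (metis atLeastAtMost_iff linear)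
  then show ?thesis using D0 by blast
qed

lemma sum_powr_le:
  fixes b :: real
  assumes "0 < b" "b < 1"
  shows "(\<Sum>k=1..n. real k powr (- b)) \<le> real n powr (1 - b) / (1 - b)"
proof (induction n)
  case (Suc n)
  have "real (Suc n) powr (- b) \<le> (real (Suc n) powr (1 - b) - real n powr (1 - b)) / (1 - b)"
  proof (cases "n = 0")
    case True
    then show ?thesis using assms by (simp add: field_simps)
  next
    case False
    have "\<exists>z>real n. z < real (Suc n) \<and> real (Suc n) powr (1 - b) - real n powr (1 - b)
        = (real (Suc n) - real n) * ((1 - b) * z powr (- b))"
      using False by (intro MVT2) (auto intro!: derivative_eq_intros)
    then obtain z where z: "z > real n" "z < real (Suc n)"
      "real (Suc n) powr (1 - b) - real n powr (1 - b) = (1 - b) * z powr (- b)" by auto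
    have "real (Suc n) powr (- b) \<le> z powr (- b)"
      using z False assms by (intro powr_mono2') auto
    then have "(1 - b) * real (Suc n) powr (- b) \<le> (1 - b) * z powr (- b)"
      using assms by (intro mult_left_mono) auto
    then show ?thesis unfolding z(3) using assms by (simp add: field_simps)
  qed
  then show ?case using Suc assms by (simp add: diff_divide_distrib)
qed simp

lemma mean_powr_tendsto_0:
  fixes b :: real
  assumes "1 / 2 < b" "b < 1"
  shows "(\<lambda>n. (\<Sum>k=1..n. real k powr (- b)) / sqrt (real n)) \<longlonglongrightarrow> 0"
proof (rule tendsto_sandwich)
  show "\<forall>\<^sub>F n in sequentially. 0 \<le> (\<Sum>k=1..n. real k powr (- b)) / sqrt (real n)"
    by (intro always_eventually allI divide_nonneg_nonneg sum_nonneg) auto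
  show "\<forall>\<^sub>F n in sequentially. (\<Sum>k=1..n. real k powr (- b)) / sqrt (real n) \<le> real n powr (- (b - 1 / 2)) / (1 - b)"
  proof (rule eventually_sequentiallyI[of 1])
    fix n :: nat assume n: "n \<ge> 1"
    have "(\<Sum>k=1..n. real k powr (- b)) / sqrt (real n) \<le> (real n powr (1 - b) / (1 - b)) / sqrt (real n)"
      using assms by (intro divide_right_mono sum_powr_le) auto
    also have "\<dots> = (real n powr (1 - b) / real n powr (1 / 2)) / (1 - b)"
      using n by (simp add: powr_half_sqrt)
    also have "\<dots> = real n powr (- (b - 1 / 2)) / (1 - b)" by (simp flip: powr_diff)
    finally show "(\<Sum>k=1..n. real k powr (- b)) / sqrt (real n) \<le> real n powr (- (b - 1 / 2)) / (1 - b)" .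
  qed
  have "(\<lambda>n. real n powr (- (b - 1 / 2)) / (1 - b)) \<longlonglongrightarrow> 0 / (1 - b)"
    using assms by (intro tendsto_divide tendsto_neg_powr filterlim_real_sequentially) auto
  then show "(\<lambda>n. real n powr (- (b - 1 / 2)) / (1 - b)) \<longlonglongrightarrow> 0" by simp
qed (rule tendsto_const)

section \<open>Averaged projected Robbins-Monro algorithms\<close>

text \<open>All that the averaging argument uses of the model, expressed through the mean field, the
  integral of G x y under Q. A single B serves as bound in all estimates. Monotonicity is asked on
  all of K and not only near \<theta>, so the mean square rate follows without a separate
  consistency proof. \<open>L\<close> is merely linear here; the Hessian is inverted in the final
  proof.\<close>

locale projected_robbins_monro = prob_space M for M :: "'s measure" +
  fixes X :: "nat \<Rightarrow> 's \<Rightarrow> 'x::euclidean_space" and Q :: "'x measure"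
    and G :: "'x \<Rightarrow> 'y::euclidean_space \<Rightarrow> 'y" and K :: "'y set" and \<theta> \<theta>\<^sub>1 :: 'y
    and \<pi> L :: "'y \<Rightarrow> 'y" and \<gamma> :: "nat \<Rightarrow> real" and B c d \<alpha> \<kappa> :: real
    and \<theta>h :: "nat \<Rightarrow> 's \<Rightarrow> 'y"
  assumes X_indep: "indep_vars (\<lambda>_. borel) X {1..}"
    and X_law: "\<And>n. n \<ge> 1 \<Longrightarrow> distr M borel (X n) = Q"
    and G_measurable [measurable]: "(\<lambda>(x, y). G x y) \<in> borel_measurable (borel \<Otimes>\<^sub>M borel)"
    and G_square_integrable: "\<And>y. y \<in> K \<Longrightarrow> integrable Q (\<lambda>x. (norm (G x y))\<^sup>2)"
    and G_square_bound: "\<And>y. y \<in> K \<Longrightarrow> (\<integral>x. (norm (G x y))\<^sup>2 \<partial>Q) \<le> B"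
    and G_lipschitz: "\<And>y. y \<in> K \<Longrightarrow> (\<integral>x. (norm (G x y - G x \<theta>))\<^sup>2 \<partial>Q) \<le> B * (norm (y - \<theta>))\<^sup>2"
    and mean_root: "(\<integral>x. G x \<theta> \<partial>Q) = 0"
    and mean_expansion: "\<And>y. y \<in> K \<Longrightarrow> norm ((\<integral>x. G x y \<partial>Q) - L (y - \<theta>)) \<le> B * (norm (y - \<theta>))\<^sup>2"
    and mean_monotone: "\<And>y. y \<in> K \<Longrightarrow> \<kappa> * (norm (y - \<theta>))\<^sup>2 \<le> (\<integral>x. G x y \<partial>Q) \<bullet> (y - \<theta>)"
    and \<kappa>_pos: "\<kappa> > 0" and d_pos: "d > 0" and c_pos: "c > 0" and \<alpha>: "1 / 2 < \<alpha>" "\<alpha> < 1"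
    and L_linear: "linear L"
    and K_bounded: "bounded K" and K_ball: "ball \<theta> d \<subseteq> K"
    and \<pi>_range: "\<And>y. \<pi> y \<in> K" and \<pi>_fix: "\<And>y. y \<in> K \<Longrightarrow> \<pi> y = y"
    and \<pi>_nonexpansive: "\<And>y y'. norm (\<pi> y - \<pi> y') \<le> norm (y - y')"
    and \<gamma>_eq: "\<And>n. n \<ge> 1 \<Longrightarrow> \<gamma> n = c * real n powr (- \<alpha>)"
    and init: "\<theta>\<^sub>1 \<in> K" "\<And>w. w \<in> space M \<Longrightarrow> \<theta>h 1 w = \<theta>\<^sub>1"
    and rec: "\<And>n w. n \<ge> 1 \<Longrightarrow> w \<in> space M \<Longrightarrow>
      \<theta>h (n + 1) w = \<pi> (\<theta>h n w - \<gamma> n *\<^sub>R G (X (n + 1) w) (\<theta>h n w))"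
begin

abbreviation \<Delta> :: "nat \<Rightarrow> 's \<Rightarrow> 'y" where
  "\<Delta> n \<omega> \<equiv> \<theta>h n \<omega> - \<theta>"

abbreviation \<xi> :: "nat \<Rightarrow> 's \<Rightarrow> 'y" where
  "\<xi> n \<omega> \<equiv> G (X (n + 1) \<omega>) (\<theta>h n \<omega>)"

abbreviation \<tau> :: "nat \<Rightarrow> 's \<Rightarrow> 'y" where
  "\<tau> n \<omega> \<equiv> (\<Sum>k=1..n. L (\<Delta> k \<omega>) + G (X (k + 1) \<omega>) \<theta>)"

section \<open>The past and the next observation\<close>

definition F :: "nat \<Rightarrow> 's measure" where
  "F k = vimage_algebra (space M) (\<lambda>\<omega>. restrict (\<lambda>i. X i \<omega>) {1..k}) (\<Pi>\<^sub>M i\<in>{1..k}. borel)"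

definition \<Phi> :: "'y \<Rightarrow> 'y" where
  "\<Phi> y = (\<integral>x. G x y \<partial>Q)"

lemma space_F [simp]: "space (F k) = space M"
  by (simp add: F_def)

lemma X_measurable_M [measurable]: "n \<ge> 1 \<Longrightarrow> X n \<in> borel_measurable M"
  using X_indep by (auto simp: indep_vars_def2)

lemma X_measurable_F: "i \<in> {1..k} \<Longrightarrow> X i \<in> borel_measurable (F k)"
proof -
  assume i: "i \<in> {1..k}"
  have "(\<lambda>\<omega>. restrict (\<lambda>i. X i \<omega>) {1..k}) \<in> measurable (F k) (\<Pi>\<^sub>M i\<in>{1..k}. borel)"
    unfolding F_def by (rule measurable_vimage_algebra1) (auto simp: space_PiM)
  from measurable_compose[OF this measurable_component_singleton[OF i]] i
  show ?thesis by simp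
qed

lemma sets_Q [simp, measurable_cong]: "sets Q = sets borel"
  using X_law[of 1] by (metis sets_distr order_refl)

lemma space_Q [simp]: "space Q = UNIV"
  using sets_eq_imp_space_eq[OF sets_Q] by simp

lemma prob_space_Q: "prob_space Q"
  using X_law[of 1] prob_space_distr[of "X 1" borel] by simp

sublocale Q: prob_space Q by (rule prob_space_Q)

lemma measure_Q_UNIV [simp]: "measure Q UNIV = 1"
  using Q.prob_space by simp

lemma history_measurable: "(\<lambda>\<omega>. restrict (\<lambda>i. X i \<omega>) {1..k}) \<in> measurable M (\<Pi>\<^sub>M i\<in>{1..k}. borel)"
  by (intro measurable_restrict) simp

lemma id_measurable_F [measurable]: "(\<lambda>\<omega>. \<omega>) \<in> measurable M (F k)"
  unfolding F_def by (rule measurable_vimage_algebra2) (use history_measurable in auto)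

lemma F_measurable_M: "f \<in> measurable (F k) N \<Longrightarrow> f \<in> measurable M N"
  using measurable_compose[OF id_measurable_F] by auto

text \<open>This product form replaces conditioning on the past. The identity map, regarded as a
  random element of \<open>F k\<close>, carries the whole history, so functions of the past need not
  be rewritten in terms of the observations. As \<open>F k\<close> is generated by the first k
  observations, independence of the next one makes the joint law a product.\<close>

lemma distr_fresh: "distr M (F k \<Otimes>\<^sub>M borel) (\<lambda>\<omega>. (\<omega>, X (k + 1) \<omega>)) = distr M (F k) (\<lambda>\<omega>. \<omega>) \<Otimes>\<^sub>M Q"
proof (rule pair_measure_eqI[symmetric])
  let ?H = "\<lambda>\<omega>. restrict (\<lambda>i. X i \<omega>) {1..k}" and ?H' = "\<lambda>\<omega>. restrict (\<lambda>i. X i \<omega>) {k+1}"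
  let ?P = "\<Pi>\<^sub>M i\<in>{1..k}. (borel :: 'x measure)" and ?P' = "\<Pi>\<^sub>M i\<in>{k+1}. (borel :: 'x measure)"
  interpret D: prob_space "distr M (F k) (\<lambda>\<omega>. \<omega>)" by (rule prob_space_distr) measurable
  show "sigma_finite_measure (distr M (F k) (\<lambda>\<omega>. \<omega>))" "sigma_finite_measure Q"
    by (simp_all add: D.sigma_finite_measure_axioms Q.sigma_finite_measure_axioms)
  show "sets (distr M (F k) (\<lambda>\<omega>. \<omega>) \<Otimes>\<^sub>M Q) = sets (distr M (F k \<Otimes>\<^sub>M borel) (\<lambda>\<omega>. (\<omega>, X (k + 1) \<omega>)))"
    by (simp cong: sets_pair_measure_cong)
  have indep: "indep_var ?P ?H ?P' ?H'"
    by (rule indep_var_restrict[OF X_indep]) auto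
  fix A C assume "A \<in> sets (distr M (F k) (\<lambda>\<omega>. \<omega>))" and "C \<in> sets Q"
  then have A: "A \<in> sets (F k)" and C: "C \<in> sets borel" by auto
  have "sets (F k) = {?H -` A \<inter> space M | A. A \<in> sets ?P}"
    unfolding F_def by (rule sets_vimage_algebra2) (auto simp: space_PiM)
  with A obtain A' where A': "A' \<in> sets ?P" "A = ?H -` A' \<inter> space M" by auto
  define C' where "C' = (\<lambda>f. f (k + 1)) -` C \<inter> space ?P'"
  have C': "C' \<in> sets ?P'"
    unfolding C'_def using C by (intro measurable_sets[of _ _ borel] measurable_component_singleton) auto
  have H': "?H' -` C' \<inter> space M = X (k + 1) -` C \<inter> space M"
    by (auto simp: C'_def space_PiM)
  have AM: "A \<in> events" using id_measurable_F[of k] A sets.sets_into_space[OF A]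
    by (metis Int_absorb2 measurable_sets space_F vimage_ident)
  have "prob (A \<inter> (X (k + 1) -` C \<inter> space M)) = prob A * prob (X (k + 1) -` C \<inter> space M)"
  proof -
    have "(\<lambda>x. (?H x, ?H' x)) -` (A' \<times> C') \<inter> space M = A \<inter> (?H' -` C' \<inter> space M)"
      unfolding A' by auto
    then show ?thesis using indep_varD[OF indep A'(1) C'] unfolding H' A'(2)[symmetric] by simp
  qed
  moreover have "emeasure (distr M (F k) (\<lambda>\<omega>. \<omega>)) A = prob A"
    using A AM sets.sets_into_space[OF A] by (simp add: emeasure_distr emeasure_eq_measure Int_absorb2)
  moreover have "emeasure Q C = prob (X (k + 1) -` C \<inter> space M)"
    using C by (simp add: emeasure_distr emeasure_eq_measure flip: X_law[of "k + 1"])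
  moreover have "emeasure (distr M (F k \<Otimes>\<^sub>M borel) (\<lambda>\<omega>. (\<omega>, X (k + 1) \<omega>))) (A \<times> C)
      = prob (A \<inter> (X (k + 1) -` C \<inter> space M))"
  proof -
    have "(\<lambda>\<omega>. (\<omega>, X (k + 1) \<omega>)) -` (A \<times> C) \<inter> space M = A \<inter> (X (k + 1) -` C \<inter> space M)"
      by auto
    then show ?thesis using A C by (subst emeasure_distr) (auto simp: emeasure_eq_measure)
  qed
  ultimately show "emeasure (distr M (F k) (\<lambda>\<omega>. \<omega>)) A * emeasure Q C
      = emeasure (distr M (F k \<Otimes>\<^sub>M borel) (\<lambda>\<omega>. (\<omega>, X (k + 1) \<omega>))) (A \<times> C)"
    by (simp add: ennreal_mult)
qed

text \<open>The bound \<open>b\<close>, uniform in the past, is what Fubini's theorem needs to pass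
  from integrability for each frozen past to joint integrability.\<close>

lemma fresh_integrable:
  fixes \<psi> :: "'s \<Rightarrow> 'x \<Rightarrow> 'z::{banach, second_countable_topology}"
  assumes [measurable]: "(\<lambda>(\<omega>, x). \<psi> \<omega> x) \<in> borel_measurable (F k \<Otimes>\<^sub>M borel)"
    and int: "\<And>\<omega>. \<omega> \<in> space M \<Longrightarrow> integrable Q (\<psi> \<omega>)"
    and bound: "\<And>\<omega>. \<omega> \<in> space M \<Longrightarrow> (\<integral>x. norm (\<psi> \<omega> x) \<partial>Q) \<le> b"
  shows "integrable M (\<lambda>\<omega>. \<psi> \<omega> (X (k + 1) \<omega>))"
proof -
  interpret D: prob_space "distr M (F k) (\<lambda>\<omega>. \<omega>)" by (rule prob_space_distr) measurable
  interpret DQ: pair_prob_space "distr M (F k) (\<lambda>\<omega>. \<omega>)" Q ..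
  have "integrable (distr M (F k) (\<lambda>\<omega>. \<omega>) \<Otimes>\<^sub>M Q) (\<lambda>(\<omega>, x). \<psi> \<omega> x)"
  proof (rule DQ.Fubini_integrable)
    show "integrable (distr M (F k) (\<lambda>\<omega>. \<omega>)) (\<lambda>\<omega>. \<integral>x. norm (case (\<omega>, x) of (\<omega>, x) \<Rightarrow> \<psi> \<omega> x) \<partial>Q)"
      using bound by (intro D.integrable_const_bound[where B=b] AE_I2) auto
    show "AE \<omega> in distr M (F k) (\<lambda>\<omega>. \<omega>). integrable Q (\<lambda>x. case (\<omega>, x) of (\<omega>, x) \<Rightarrow> \<psi> \<omega> x)"
      using int by (intro AE_I2) simp
  qed measurable
  then show ?thesis
    unfolding distr_fresh[symmetric] by (subst (asm) integrable_distr_eq) auto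
qed

text \<open>The tower property: averaging over the fresh observation with the past frozen computes
  the conditional expectation.\<close>

lemma fresh_integral:
  fixes \<psi> :: "'s \<Rightarrow> 'x \<Rightarrow> 'z::{banach, second_countable_topology}"
  assumes [measurable]: "(\<lambda>(\<omega>, x). \<psi> \<omega> x) \<in> borel_measurable (F k \<Otimes>\<^sub>M borel)"
    and int: "integrable M (\<lambda>\<omega>. \<psi> \<omega> (X (k + 1) \<omega>))"
  shows "(\<integral>\<omega>. \<psi> \<omega> (X (k + 1) \<omega>) \<partial>M) = (\<integral>\<omega>. (\<integral>x. \<psi> \<omega> x \<partial>Q) \<partial>M)"
    and "integrable M (\<lambda>\<omega>. \<integral>x. \<psi> \<omega> x \<partial>Q)"
proof -
  interpret D: prob_space "distr M (F k) (\<lambda>\<omega>. \<omega>)" by (rule prob_space_distr) measurable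
  interpret DQ: pair_prob_space "distr M (F k) (\<lambda>\<omega>. \<omega>)" Q ..
  have int': "integrable (distr M (F k) (\<lambda>\<omega>. \<omega>) \<Otimes>\<^sub>M Q) (\<lambda>(\<omega>, x). \<psi> \<omega> x)"
    unfolding distr_fresh[symmetric] using int by (subst integrable_distr_eq) auto
  have "(\<integral>\<omega>. \<psi> \<omega> (X (k + 1) \<omega>) \<partial>M) = (\<integral>p. (\<lambda>(\<omega>, x). \<psi> \<omega> x) p \<partial>(distr M (F k) (\<lambda>\<omega>. \<omega>) \<Otimes>\<^sub>M Q))"
    unfolding distr_fresh[symmetric] by (subst integral_distr) auto
  also have "\<dots> = (\<integral>\<omega>. (\<integral>x. \<psi> \<omega> x \<partial>Q) \<partial>distr M (F k) (\<lambda>\<omega>. \<omega>))"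
    using DQ.integral_fst'[OF int'] by simp
  also have "\<dots> = (\<integral>\<omega>. (\<integral>x. \<psi> \<omega> x \<partial>Q) \<partial>M)" by (subst integral_distr) auto
  finally show "(\<integral>\<omega>. \<psi> \<omega> (X (k + 1) \<omega>) \<partial>M) = (\<integral>\<omega>. (\<integral>x. \<psi> \<omega> x \<partial>Q) \<partial>M)" .
  show "integrable M (\<lambda>\<omega>. \<integral>x. \<psi> \<omega> x \<partial>Q)"
    using DQ.integrable_fst'[OF int'] by (subst (asm) integrable_distr_eq) auto
qed

section \<open>The mean square rate\<close>

lemma \<gamma>_pos: "n \<ge> 1 \<Longrightarrow> \<gamma> n > 0"
  using c_pos by (simp add: \<gamma>_eq)

lemma \<theta>h_in_K: "n \<ge> 1 \<Longrightarrow> \<omega> \<in> space M \<Longrightarrow> \<theta>h n \<omega> \<in> K"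
  by (induction n rule: nat_induct_at_least) (use init rec \<pi>_range in auto)

lemma \<pi>_measurable [measurable]: "\<pi> \<in> borel_measurable borel"
proof (intro borel_measurable_continuous_onI continuous_onI)
  show "\<exists>d>0. \<forall>x'\<in>UNIV. dist x' x < d \<longrightarrow> dist (\<pi> x') (\<pi> x) \<le> e" if "e > 0" for x and e :: real
    using that order_trans[OF \<pi>_nonexpansive less_imp_le]
    by (intro exI[of _ e]) (auto simp: dist_norm)
qed

text \<open>Iterate n depends on the observations up to n only, so the observation n + 1 used in the
  next step is fresh. Allowing every m >= n lets earlier iterates be used relative to a later
  past.\<close>

lemma \<theta>h_measurable_F: "n \<ge> 1 \<Longrightarrow> n \<le> m \<Longrightarrow> \<theta>h n \<in> borel_measurable (F m)"
proof (induction n rule: nat_induct_at_least)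
  case base
  then show ?case using init by (subst measurable_cong[where g="\<lambda>_. \<theta>\<^sub>1"]) auto
next
  case (Suc n)
  have [measurable]: "\<theta>h n \<in> borel_measurable (F m)" "X (n + 1) \<in> borel_measurable (F m)"
    using Suc X_measurable_F[of "n + 1" m] by auto
  have "(\<lambda>\<omega>. \<pi> (\<theta>h n \<omega> - \<gamma> n *\<^sub>R \<xi> n \<omega>)) \<in> borel_measurable (F m)"
    by measurable
  then show ?case using rec[OF Suc.hyps]
    by (subst measurable_cong[where g="\<lambda>\<omega>. \<pi> (\<theta>h n \<omega> - \<gamma> n *\<^sub>R \<xi> n \<omega>)"]) auto
qed

lemma \<theta>h_measurable [measurable]: "n \<ge> 1 \<Longrightarrow> \<theta>h n \<in> borel_measurable M"
  using \<theta>h_measurable_F[of n n] by (auto intro: F_measurable_M)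

lemma theta_in_K: "\<theta> \<in> K"
  using K_ball d_pos by auto

lemma B_nonneg: "B \<ge> 0"
  by (rule order_trans[OF integral_nonneg_AE G_square_bound[OF theta_in_K]]) simp

lemma G_integrable: "y \<in> K \<Longrightarrow> integrable Q (\<lambda>x. G x y)"
proof -
  assume "y \<in> K"
  then have "integrable Q (\<lambda>x. 1 + (norm (G x y))\<^sup>2)" using G_square_integrable by simp
  then show ?thesis
  proof (rule Bochner_Integration.integrable_bound)
    show "AE x in Q. norm (G x y) \<le> norm (1 + (norm (G x y))\<^sup>2)"
      using le_one_plus_square[of "norm (G x y)" for x] by (intro AE_I2) simp
  qed measurable
qed

lemma G_norm_bound: "y \<in> K \<Longrightarrow> (\<integral>x. norm (G x y) \<partial>Q) \<le> 1 + B"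
proof -
  assume y: "y \<in> K"
  have "(\<integral>x. norm (G x y) \<partial>Q) \<le> (\<integral>x. 1 + (norm (G x y))\<^sup>2 \<partial>Q)"
  proof (rule integral_mono)
    show "norm (G x y) \<le> 1 + (norm (G x y))\<^sup>2" for x
      by (rule le_one_plus_square)
  qed (use y G_integrable G_square_integrable in auto)
  also have "\<dots> \<le> 1 + B" using G_square_integrable[OF y] G_square_bound[OF y] by (simp add: Q.prob_space)
  finally show ?thesis .
qed

lemma \<Phi>_measurable [measurable]: "\<Phi> \<in> borel_measurable borel"
  unfolding \<Phi>_def[abs_def] by measurable

lemma deviation_bounded: obtains R where "R \<ge> 0" "\<And>y. y \<in> K \<Longrightarrow> norm (y - \<theta>) \<le> R"
proof -
  obtain R where R: "\<And>y. y \<in> K \<Longrightarrow> norm y \<le> R" using K_bounded by (auto simp: bounded_iff)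
  show ?thesis
  proof (rule that[of "2 * R"])
    show "2 * R \<ge> 0" using R[OF theta_in_K] norm_ge_zero[of \<theta>] by linarith
    show "norm (y - \<theta>) \<le> 2 * R" if "y \<in> K" for y
      using norm_triangle_ineq4[of y \<theta>] R[OF that] R[OF theta_in_K] by simp
  qed
qed

lemma deviation_integrable: "n \<ge> 1 \<Longrightarrow> integrable M (\<lambda>\<omega>. norm (\<Delta> n \<omega>) ^ k)"
proof -
  assume n: "n \<ge> 1"
  obtain R where "R \<ge> 0" "\<And>y. y \<in> K \<Longrightarrow> norm (y - \<theta>) \<le> R" using deviation_bounded by blast
  then show ?thesis using n \<theta>h_in_K[OF n]
    by (intro integrable_const_bound[where B="R ^ k"] AE_I2) (auto intro: power_mono)
qed

definition v :: "nat \<Rightarrow> real" where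
  "v n = (\<integral>\<omega>. (norm (\<Delta> n \<omega>))\<^sup>2 \<partial>M)"

lemma G_fresh_integrable:
  assumes n: "n \<ge> 1"
  shows "integrable M (\<lambda>\<omega>. (norm (\<xi> n \<omega>))\<^sup>2)"
    and "(\<integral>\<omega>. (norm (\<xi> n \<omega>))\<^sup>2 \<partial>M) \<le> B"
proof -
  have [measurable]: "\<theta>h n \<in> borel_measurable (F n)" using n by (intro \<theta>h_measurable_F) auto
  show int: "integrable M (\<lambda>\<omega>. (norm (\<xi> n \<omega>))\<^sup>2)"
    using G_square_integrable G_square_bound \<theta>h_in_K[OF n]
    by (intro fresh_integrable[where \<psi>="\<lambda>\<omega> x. (norm (G x (\<theta>h n \<omega>)))\<^sup>2" and b=B]) auto
  have "(\<integral>\<omega>. (norm (\<xi> n \<omega>))\<^sup>2 \<partial>M) = (\<integral>\<omega>. (\<integral>x. (norm (G x (\<theta>h n \<omega>)))\<^sup>2 \<partial>Q) \<partial>M)"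
    by (intro fresh_integral[where \<psi>="\<lambda>\<omega> x. (norm (G x (\<theta>h n \<omega>)))\<^sup>2"] int) measurable
  also have "\<dots> \<le> B"
    using G_square_bound \<theta>h_in_K[OF n] fresh_integral(2)[where \<psi>="\<lambda>\<omega> x. (norm (G x (\<theta>h n \<omega>)))\<^sup>2", OF _ int]
    by (intro integral_le_const AE_I2) auto
  finally show "(\<integral>\<omega>. (norm (\<xi> n \<omega>))\<^sup>2 \<partial>M) \<le> B" .
qed

text \<open>The projection fixes \<theta> and is nonexpansive, so it can only reduce the error. In
  the expanded square the cross term is averaged over the fresh observation, and monotonicity of the
  mean field turns it into the contraction.\<close>

lemma v_step:
  assumes n: "n \<ge> 1"
  shows "v (n + 1) \<le> (1 - 2 * \<kappa> * \<gamma> n) * v n + B * (\<gamma> n)\<^sup>2"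
proof -
  have [measurable]: "\<theta>h n \<in> borel_measurable (F n)" using n by (intro \<theta>h_measurable_F) auto
  obtain R where R: "R \<ge> 0" "\<And>y. y \<in> K \<Longrightarrow> norm (y - \<theta>) \<le> R" using deviation_bounded by blast
  have K: "\<theta>h n \<omega> \<in> K" if "\<omega> \<in> space M" for \<omega> using \<theta>h_in_K[OF n that] .
  define \<psi> where "\<psi> = (\<lambda>\<omega> x. G x (\<theta>h n \<omega>) \<bullet> (\<Delta> n \<omega>))"
  have [measurable]: "(\<lambda>(\<omega>, x). \<psi> \<omega> x) \<in> borel_measurable (F n \<Otimes>\<^sub>M borel)" unfolding \<psi>_def by measurable
  have int1: "integrable M (\<lambda>\<omega>. \<psi> \<omega> (X (n + 1) \<omega>))"
  proof (rule fresh_integrable)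
    fix \<omega> assume \<omega>: "\<omega> \<in> space M"
    show "integrable Q (\<psi> \<omega>)" unfolding \<psi>_def using G_integrable[OF K[OF \<omega>]] by simp
    have "(\<integral>x. norm (\<psi> \<omega> x) \<partial>Q) \<le> (\<integral>x. norm (G x (\<theta>h n \<omega>)) * R \<partial>Q)"
    proof (rule integral_mono)
      fix x
      have "norm (\<psi> \<omega> x) \<le> norm (G x (\<theta>h n \<omega>)) * norm (\<Delta> n \<omega>)"
        unfolding \<psi>_def by (simp add: Cauchy_Schwarz_ineq2)
      also have "\<dots> \<le> norm (G x (\<theta>h n \<omega>)) * R" using R K[OF \<omega>] by (intro mult_left_mono) auto
      finally show "norm (\<psi> \<omega> x) \<le> norm (G x (\<theta>h n \<omega>)) * R" .
    qed (use G_integrable[OF K[OF \<omega>]] in \<open>auto simp: \<psi>_def\<close>)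
    also have "\<dots> \<le> (1 + B) * R" using G_norm_bound[OF K[OF \<omega>]] R by (simp add: mult_right_mono)
    finally show "(\<integral>x. norm (\<psi> \<omega> x) \<partial>Q) \<le> (1 + B) * R" .
  qed measurable
  have inner: "(\<integral>x. \<psi> \<omega> x \<partial>Q) = \<Phi> (\<theta>h n \<omega>) \<bullet> (\<Delta> n \<omega>)" if "\<omega> \<in> space M" for \<omega>
    unfolding \<psi>_def \<Phi>_def using G_integrable[OF K[OF that]] by simp
  have "\<kappa> * v n \<le> (\<integral>\<omega>. (\<integral>x. \<psi> \<omega> x \<partial>Q) \<partial>M)"
    unfolding v_def using mean_monotone[OF K] inner deviation_integrable[OF n, of 2] fresh_integral(2)[where k=n and \<psi>=\<psi>, OF _ int1]
    by (subst Bochner_Integration.integral_mult_right_zero[symmetric], intro integral_mono) (auto simp: \<Phi>_def)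
  then have E1: "\<kappa> * v n \<le> (\<integral>\<omega>. \<psi> \<omega> (X (n + 1) \<omega>) \<partial>M)" using fresh_integral(1)[where k=n and \<psi>=\<psi>, OF _ int1] by simp
  have "v (n + 1) \<le> (\<integral>\<omega>. (norm (\<Delta> n \<omega>))\<^sup>2 - 2 * \<gamma> n * \<psi> \<omega> (X (n + 1) \<omega>)
      + (\<gamma> n)\<^sup>2 * (norm (\<xi> n \<omega>))\<^sup>2 \<partial>M)"
    unfolding v_def
  proof (rule integral_mono)
    show "integrable M (\<lambda>\<omega>. (norm (\<Delta> n \<omega>))\<^sup>2 - 2 * \<gamma> n * \<psi> \<omega> (X (n + 1) \<omega>)
      + (\<gamma> n)\<^sup>2 * (norm (\<xi> n \<omega>))\<^sup>2)"
      using deviation_integrable[OF n, of 2] int1 G_fresh_integrable(1)[OF n] by simp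
    fix \<omega> assume \<omega>: "\<omega> \<in> space M"
    let ?D = "\<Delta> n \<omega>" and ?g = "\<xi> n \<omega>"
    have "norm (\<Delta> (n + 1) \<omega>) = norm (\<pi> (\<theta>h n \<omega> - \<gamma> n *\<^sub>R ?g) - \<pi> \<theta>)"
      using rec[OF n \<omega>] \<pi>_fix[OF theta_in_K] by simp
    also have "\<dots> \<le> norm (?D - \<gamma> n *\<^sub>R ?g)"
      using \<pi>_nonexpansive[of "\<theta>h n \<omega> - \<gamma> n *\<^sub>R ?g" \<theta>] by (simp add: algebra_simps)
    finally have "(norm (\<Delta> (n + 1) \<omega>))\<^sup>2 \<le> (norm (?D - \<gamma> n *\<^sub>R ?g))\<^sup>2" by (rule power_mono) simp
    also have "\<dots> = (norm ?D)\<^sup>2 - 2 * \<gamma> n * \<psi> \<omega> (X (n + 1) \<omega>) + (\<gamma> n)\<^sup>2 * (norm ?g)\<^sup>2"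
      unfolding \<psi>_def power2_norm_eq_inner
      by (simp add: inner_diff_left inner_diff_right inner_commute algebra_simps power2_eq_square)
    finally show "(norm (\<Delta> (n + 1) \<omega>))\<^sup>2 \<le> (norm ?D)\<^sup>2 - 2 * \<gamma> n * \<psi> \<omega> (X (n + 1) \<omega>) + (\<gamma> n)\<^sup>2 * (norm ?g)\<^sup>2" .
  qed (use deviation_integrable[of "n + 1" 2] in auto)
  also have "\<dots> = v n - 2 * \<gamma> n * (\<integral>\<omega>. \<psi> \<omega> (X (n + 1) \<omega>) \<partial>M)
      + (\<gamma> n)\<^sup>2 * (\<integral>\<omega>. (norm (\<xi> n \<omega>))\<^sup>2 \<partial>M)"
    using deviation_integrable[OF n, of 2] int1 G_fresh_integrable(1)[OF n] by (simp add: v_def)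
  also have "\<dots> \<le> v n - 2 * \<gamma> n * (\<kappa> * v n) + (\<gamma> n)\<^sup>2 * B"
    using \<gamma>_pos[OF n] E1 G_fresh_integrable(2)[OF n]
    by (intro add_mono diff_mono mult_left_mono order_refl) auto
  finally show ?thesis by (simp add: algebra_simps)
qed

lemma v_rate: "\<exists>D\<ge>0. \<forall>n\<ge>1. v n \<le> D * real n powr (- \<alpha>)"
proof (rule robbins_monro_recursion)
  show "v (n + 1) \<le> (1 - (2 * \<kappa> * c) * real n powr (- \<alpha>)) * v n + (B * c\<^sup>2) * real n powr (- (2 * \<alpha>))"
    if "n \<ge> 1" for n
  proof -
    have "real n powr (- (2 * \<alpha>)) = (real n powr (- \<alpha>))\<^sup>2"
      by (simp add: power2_eq_square flip: powr_add)
    then show ?thesis using v_step[OF that] \<gamma>_eq[OF that]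
      by (simp add: power_mult_distrib mult_ac)
  qed
qed (use \<alpha> \<kappa>_pos c_pos B_nonneg in auto)

section \<open>Projection error and martingale differences\<close>

definition r :: "nat \<Rightarrow> 's \<Rightarrow> 'y" where
  "r n \<omega> = \<theta>h (n + 1) \<omega> - (\<theta>h n \<omega> - \<gamma> n *\<^sub>R \<xi> n \<omega>)"

text \<open>The noise of the gradient at the current iterate minus its noise at the target. It is
  centred given the past, and its conditional second moment is of the order of the squared error, so
  it is negligible against the i.i.d. part that carries the limit law.\<close>

definition \<epsilon> :: "nat \<Rightarrow> 's \<Rightarrow> 'y" where
  "\<epsilon> n \<omega> = \<xi> n \<omega> - G (X (n + 1) \<omega>) \<theta> - \<Phi> (\<theta>h n \<omega>)"

lemma r_measurable [measurable]: "n \<ge> 1 \<Longrightarrow> r n \<in> borel_measurable M"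
  unfolding r_def[abs_def] by measurable

text \<open>The projection acts only if either the current error or the current step exceeds half the
  distance from the target to the boundary, which is controlled by Markov's inequality.\<close>

lemma projection_error_pointwise:
  assumes n: "n \<ge> 1" and \<omega>: "\<omega> \<in> space M"
  defines "q \<equiv> norm (\<xi> n \<omega>)" and "D \<equiv> norm (\<Delta> n \<omega>)"
  shows "norm (r n \<omega>) \<le> \<gamma> n * (8 / d\<^sup>2 * (D\<^sup>2 * q) + 4 / d * \<gamma> n * q\<^sup>2)"
proof -
  define y where "y = \<theta>h n \<omega> - \<gamma> n *\<^sub>R \<xi> n \<omega>"
  have r: "r n \<omega> = \<pi> y - y" using rec[OF n \<omega>] by (simp add: r_def y_def)
  have \<gamma>: "\<gamma> n > 0" by (rule \<gamma>_pos[OF n])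
  have q: "q \<ge> 0" "D \<ge> 0" by (simp_all add: q_def D_def)
  have step: "norm (\<theta>h n \<omega> - y) = \<gamma> n * q" using \<gamma> by (simp add: y_def q_def)
  show ?thesis
  proof (cases "y \<in> K")
    case True
    then have "r n \<omega> = 0" using r \<pi>_fix by simp
    then show ?thesis using \<gamma> q d_pos by simp
  next
    case False
    have "norm (r n \<omega>) \<le> norm (\<pi> y - \<theta>h n \<omega>) + norm (\<theta>h n \<omega> - y)"
      using norm_triangle_ineq[of "\<pi> y - \<theta>h n \<omega>" "\<theta>h n \<omega> - y"] r by simp
    \<comment> \<open>The current iterate is its own projection, so the projected point is no
      farther from it than y; hence the correction is at most twice the step.\<close>
    also have "norm (\<pi> y - \<theta>h n \<omega>) \<le> norm (\<theta>h n \<omega> - y)"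
      using \<pi>_nonexpansive[of y "\<theta>h n \<omega>"] \<pi>_fix[OF \<theta>h_in_K[OF n \<omega>]] by (simp add: norm_minus_commute)
    finally have r2: "norm (r n \<omega>) \<le> \<gamma> n * (2 * q)" using step by (simp add: mult_ac)
    have "y \<notin> ball \<theta> d" using False K_ball by auto
    then have "d \<le> norm (\<theta> - y)" by (simp add: dist_norm)
    also have "\<dots> \<le> D + \<gamma> n * q"
      using norm_triangle_ineq[of "\<theta> - \<theta>h n \<omega>" "\<theta>h n \<omega> - y"] step by (simp add: D_def norm_minus_commute)
    finally have *: "d / 2 \<le> D \<or> d / 2 \<le> \<gamma> n * q" by linarith
    \<comment> \<open>One of the ratios 2 D / d and 2 \<gamma> q / d is at least 1. The first is
      squared to match the mean square error; the second stays linear since it already contains a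
      step size.\<close>
    have "1 \<le> 4 / d\<^sup>2 * D\<^sup>2 + 2 / d * (\<gamma> n * q)"
    proof (cases "d / 2 \<le> D")
      case True
      then have "(d / 2)\<^sup>2 \<le> D\<^sup>2" using d_pos by (intro power_mono) auto
      then have "1 \<le> 4 / d\<^sup>2 * D\<^sup>2" using d_pos by (simp add: field_simps power2_eq_square)
      moreover have "0 \<le> 2 / d * (\<gamma> n * q)" using d_pos \<gamma> q by simp
      ultimately show ?thesis by linarith
    next
      case False
      then have "1 \<le> 2 / d * (\<gamma> n * q)" using * d_pos by (simp add: field_simps)
      moreover have "0 \<le> 4 / d\<^sup>2 * D\<^sup>2" by simp
      ultimately show ?thesis by linarith
    qed
    then have "2 * q * 1 \<le> 2 * q * (4 / d\<^sup>2 * D\<^sup>2 + 2 / d * (\<gamma> n * q))"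
      using q by (intro mult_left_mono) auto
    also have "\<dots> = 8 / d\<^sup>2 * (D\<^sup>2 * q) + 4 / d * \<gamma> n * q\<^sup>2"
      by (simp add: distrib_left power2_eq_square mult_ac)
    finally have "\<gamma> n * (2 * q) \<le> \<gamma> n * (8 / d\<^sup>2 * (D\<^sup>2 * q) + 4 / d * \<gamma> n * q\<^sup>2)"
      using \<gamma> by (intro mult_left_mono) auto
    with r2 show ?thesis by linarith
  qed
qed

text \<open>The squared error belongs to the past, so averaging over the fresh observation replaces
  the gradient norm by its mean, at most 1 + B. After division by the step size the bound is of
  order v n + \<gamma> n, hence n powr -\<alpha>.\<close>

lemma projection_error_bound:
  assumes n: "n \<ge> 1"
  shows "integrable M (\<lambda>\<omega>. norm (r n \<omega>))"
    and "(\<integral>\<omega>. norm (r n \<omega>) \<partial>M) \<le> \<gamma> n * (8 / d\<^sup>2 * (1 + B) * v n + 4 / d * B * \<gamma> n)"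
proof -
  have [measurable]: "\<theta>h n \<in> borel_measurable (F n)" using n by (intro \<theta>h_measurable_F) auto
  have [measurable]: "\<theta>h n \<in> borel_measurable M" "r n \<in> borel_measurable M" using n by auto
  obtain R where R: "R \<ge> 0" "\<And>y. y \<in> K \<Longrightarrow> norm (y - \<theta>) \<le> R" using deviation_bounded by blast
  have K: "\<theta>h n \<omega> \<in> K" if "\<omega> \<in> space M" for \<omega> using \<theta>h_in_K[OF n that] .
  define \<psi> where "\<psi> = (\<lambda>\<omega> x. (norm (\<Delta> n \<omega>))\<^sup>2 * norm (G x (\<theta>h n \<omega>)))"
  have [measurable]: "(\<lambda>(\<omega>, x). \<psi> \<omega> x) \<in> borel_measurable (F n \<Otimes>\<^sub>M borel)" unfolding \<psi>_def by measurable
  have inner: "(\<integral>x. \<psi> \<omega> x \<partial>Q) \<le> (1 + B) * (norm (\<Delta> n \<omega>))\<^sup>2" if "\<omega> \<in> space M" for \<omega>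
    unfolding \<psi>_def using G_norm_bound[OF K[OF that]] by (simp add: mult.commute mult_right_mono)
  have int1: "integrable M (\<lambda>\<omega>. \<psi> \<omega> (X (n + 1) \<omega>))"
  proof (rule fresh_integrable)
    fix \<omega> assume \<omega>: "\<omega> \<in> space M"
    show "integrable Q (\<psi> \<omega>)" unfolding \<psi>_def using G_integrable[OF K[OF \<omega>]] by simp
    have "(\<integral>x. norm (\<psi> \<omega> x) \<partial>Q) = (\<integral>x. \<psi> \<omega> x \<partial>Q)" by (simp add: \<psi>_def)
    also have "\<dots> \<le> (1 + B) * R\<^sup>2"
      using B_nonneg by (intro order_trans[OF inner[OF \<omega>] mult_left_mono] power_mono R(2) K \<omega>) auto
    finally show "(\<integral>x. norm (\<psi> \<omega> x) \<partial>Q) \<le> (1 + B) * R\<^sup>2" .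
  qed measurable
  have "(\<integral>\<omega>. \<psi> \<omega> (X (n + 1) \<omega>) \<partial>M) = (\<integral>\<omega>. (\<integral>x. \<psi> \<omega> x \<partial>Q) \<partial>M)"
    by (rule fresh_integral(1)[where k=n and \<psi>=\<psi>, OF _ int1]) measurable
  also have "\<dots> \<le> (\<integral>\<omega>. (1 + B) * (norm (\<Delta> n \<omega>))\<^sup>2 \<partial>M)"
    using inner deviation_integrable[OF n, of 2] fresh_integral(2)[where k=n and \<psi>=\<psi>, OF _ int1] by (intro integral_mono) auto
  also have "\<dots> = (1 + B) * v n" by (simp add: v_def)
  finally have E1: "(\<integral>\<omega>. \<psi> \<omega> (X (n + 1) \<omega>) \<partial>M) \<le> (1 + B) * v n" .
  define h where "h \<omega> = \<gamma> n * (8 / d\<^sup>2 * \<psi> \<omega> (X (n + 1) \<omega>)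
      + 4 / d * \<gamma> n * (norm (\<xi> n \<omega>))\<^sup>2)" for \<omega>
  have h_int: "integrable M h" unfolding h_def using int1 G_fresh_integrable(1)[OF n] by simp
  have rh: "norm (r n \<omega>) \<le> h \<omega>" if "\<omega> \<in> space M" for \<omega>
    using projection_error_pointwise[OF n that] by (simp add: h_def \<psi>_def)
  show int: "integrable M (\<lambda>\<omega>. norm (r n \<omega>))"
    using rh by (intro Bochner_Integration.integrable_bound[OF h_int] AE_I2) (auto intro: order_trans abs_ge_self)
  have "(\<integral>\<omega>. norm (r n \<omega>) \<partial>M) \<le> (\<integral>\<omega>. h \<omega> \<partial>M)" using rh by (intro integral_mono int h_int)
  also have "\<dots> = \<gamma> n * (8 / d\<^sup>2 * (\<integral>\<omega>. \<psi> \<omega> (X (n + 1) \<omega>) \<partial>M)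
      + 4 / d * \<gamma> n * (\<integral>\<omega>. (norm (\<xi> n \<omega>))\<^sup>2 \<partial>M))"
    unfolding h_def using int1 G_fresh_integrable(1)[OF n] by simp
  also have "\<dots> \<le> \<gamma> n * (8 / d\<^sup>2 * ((1 + B) * v n) + 4 / d * \<gamma> n * B)"
    using E1 G_fresh_integrable(2)[OF n] \<gamma>_pos[OF n] d_pos
    by (intro mult_left_mono add_mono) auto
  finally show "(\<integral>\<omega>. norm (r n \<omega>) \<partial>M) \<le> \<gamma> n * (8 / d\<^sup>2 * (1 + B) * v n + 4 / d * B * \<gamma> n)"
    by (simp only: mult_ac)
qed

lemma \<epsilon>_measurable_F:
  assumes "k \<ge> 1" "k < m"
  shows "\<epsilon> k \<in> borel_measurable (F m)"
proof -
  have [measurable]: "\<theta>h k \<in> borel_measurable (F m)" "X (k + 1) \<in> borel_measurable (F m)"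
    using assms by (auto intro!: \<theta>h_measurable_F X_measurable_F)
  show ?thesis unfolding \<epsilon>_def[abs_def] by measurable
qed

text \<open>A bound on a Bochner integral is informative only together with integrability, and
  \<open>G_lipschitz\<close> states the bound alone.\<close>

lemma increment_square_integrable:
  assumes "y \<in> K" shows "integrable Q (\<lambda>x. (norm (G x y - G x \<theta>))\<^sup>2)"
proof (rule Bochner_Integration.integrable_bound)
  show "integrable Q (\<lambda>x. 2 * (norm (G x y))\<^sup>2 + 2 * (norm (G x \<theta>))\<^sup>2)"
    using G_square_integrable assms theta_in_K by simp
  have "(norm (a - b))\<^sup>2 \<le> 2 * (norm a)\<^sup>2 + 2 * (norm b)\<^sup>2" for a b :: 'y
    using power_mono[OF norm_triangle_ineq4[of a b], of 2] sum_squares_bound[of "norm a" "norm b"]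
    by (simp add: power2_sum)
  then show "AE x in Q. norm ((norm (G x y - G x \<theta>))\<^sup>2) \<le> norm (2 * (norm (G x y))\<^sup>2 + 2 * (norm (G x \<theta>))\<^sup>2)"
    by (intro AE_I2) simp
qed measurable

text \<open>By \<open>mean_root\<close> the increment has mean \<Phi> y, so subtracting \<Phi> y
  centers it, and a variance is at most the second moment.\<close>

lemma centered_increment:
  assumes y: "y \<in> K"
  defines "\<psi> \<equiv> \<lambda>x. G x y - G x \<theta> - \<Phi> y"
  shows "integrable Q \<psi>" "(\<integral>x. \<psi> x \<partial>Q) = 0"
    "integrable Q (\<lambda>x. (norm (\<psi> x))\<^sup>2)" "(\<integral>x. (norm (\<psi> x))\<^sup>2 \<partial>Q) \<le> B * (norm (y - \<theta>))\<^sup>2"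
proof -
  have Gi: "integrable Q (\<lambda>x. G x y)" "integrable Q (\<lambda>x. G x \<theta>)" using y theta_in_K G_integrable by auto
  then show "integrable Q \<psi>" "(\<integral>x. \<psi> x \<partial>Q) = 0"
    by (simp_all add: \<psi>_def mean_root \<Phi>_def Q.prob_space)
  have sq: "(norm (\<psi> x))\<^sup>2 = (norm (G x y - G x \<theta>))\<^sup>2 - 2 * ((G x y - G x \<theta>) \<bullet> \<Phi> y) + (norm (\<Phi> y))\<^sup>2" for x
    unfolding \<psi>_def power2_norm_eq_inner
    by (simp add: inner_diff_left inner_diff_right inner_commute algebra_simps)
  show "integrable Q (\<lambda>x. (norm (\<psi> x))\<^sup>2)"
    unfolding sq using increment_square_integrable[OF y] Gi by simp
  have "(\<integral>x. (norm (\<psi> x))\<^sup>2 \<partial>Q) = (\<integral>x. (norm (G x y - G x \<theta>))\<^sup>2 \<partial>Q) - 2 * (\<Phi> y \<bullet> \<Phi> y) + (norm (\<Phi> y))\<^sup>2"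
    unfolding sq using increment_square_integrable[OF y] Gi by (simp add: \<Phi>_def mean_root Q.prob_space)
  also have "\<dots> \<le> (\<integral>x. (norm (G x y - G x \<theta>))\<^sup>2 \<partial>Q)" by (simp add: power2_norm_eq_inner)
  finally show "(\<integral>x. (norm (\<psi> x))\<^sup>2 \<partial>Q) \<le> B * (norm (y - \<theta>))\<^sup>2" using G_lipschitz[OF y] by linarith
qed

lemma \<epsilon>_square:
  assumes n: "n \<ge> 1"
  shows "integrable M (\<lambda>\<omega>. (norm (\<epsilon> n \<omega>))\<^sup>2)" "(\<integral>\<omega>. (norm (\<epsilon> n \<omega>))\<^sup>2 \<partial>M) \<le> B * v n"
proof -
  have [measurable]: "\<theta>h n \<in> borel_measurable (F n)" using n by (intro \<theta>h_measurable_F) auto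
  obtain R where R: "R \<ge> 0" "\<And>y. y \<in> K \<Longrightarrow> norm (y - \<theta>) \<le> R" using deviation_bounded by blast
  have K: "\<theta>h n \<omega> \<in> K" if "\<omega> \<in> space M" for \<omega> using \<theta>h_in_K[OF n that] .
  define \<psi> where "\<psi> = (\<lambda>\<omega> x. (norm (G x (\<theta>h n \<omega>) - G x \<theta> - \<Phi> (\<theta>h n \<omega>)))\<^sup>2)"
  have [measurable]: "(\<lambda>(\<omega>, x). \<psi> \<omega> x) \<in> borel_measurable (F n \<Otimes>\<^sub>M borel)" unfolding \<psi>_def by measurable
  have eq: "(norm (\<epsilon> n \<omega>))\<^sup>2 = \<psi> \<omega> (X (n + 1) \<omega>)" for \<omega> by (simp add: \<psi>_def \<epsilon>_def)
  have inner: "(\<integral>x. \<psi> \<omega> x \<partial>Q) \<le> B * (norm (\<Delta> n \<omega>))\<^sup>2" if "\<omega> \<in> space M" for \<omega>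
    unfolding \<psi>_def by (rule centered_increment(4)[OF K[OF that]])
  show int: "integrable M (\<lambda>\<omega>. (norm (\<epsilon> n \<omega>))\<^sup>2)" unfolding eq
  proof (rule fresh_integrable)
    fix \<omega> assume \<omega>: "\<omega> \<in> space M"
    show "integrable Q (\<psi> \<omega>)" unfolding \<psi>_def by (rule centered_increment(3)[OF K[OF \<omega>]])
    have "(\<integral>x. norm (\<psi> \<omega> x) \<partial>Q) = (\<integral>x. \<psi> \<omega> x \<partial>Q)" by (simp add: \<psi>_def)
    also have "\<dots> \<le> B * R\<^sup>2"
      using inner[OF \<omega>] mult_left_mono[OF power_mono[OF R(2)[OF K[OF \<omega>]]], of B 2] B_nonneg by simp
    finally show "(\<integral>x. norm (\<psi> \<omega> x) \<partial>Q) \<le> B * R\<^sup>2" .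
  qed measurable
  have int1: "integrable M (\<lambda>\<omega>. \<psi> \<omega> (X (n + 1) \<omega>))" using int by (simp only: eq)
  have "(\<integral>\<omega>. (norm (\<epsilon> n \<omega>))\<^sup>2 \<partial>M) = (\<integral>\<omega>. (\<integral>x. \<psi> \<omega> x \<partial>Q) \<partial>M)"
    unfolding eq by (rule fresh_integral(1)[where k=n and \<psi>=\<psi>, OF _ int1]) measurable
  also have "\<dots> \<le> (\<integral>\<omega>. B * (norm (\<Delta> n \<omega>))\<^sup>2 \<partial>M)"
    using inner deviation_integrable[OF n, of 2] fresh_integral(2)[where k=n and \<psi>=\<psi>, OF _ int1] by (intro integral_mono) auto
  also have "\<dots> = B * v n" by (simp add: v_def)
  finally show "(\<integral>\<omega>. (norm (\<epsilon> n \<omega>))\<^sup>2 \<partial>M) \<le> B * v n" .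
qed

lemma \<epsilon>_measurable [measurable]: "n \<ge> 1 \<Longrightarrow> \<epsilon> n \<in> borel_measurable M"
  using \<epsilon>_measurable_F[of n "n + 1"] by (auto intro: F_measurable_M)

text \<open>S is fixed once the past is, while the martingale difference averages to zero over the
  fresh observation.\<close>

lemma \<epsilon>_orthogonal:
  assumes n: "n \<ge> 1" and S [measurable]: "S \<in> borel_measurable (F n)"
    and S2: "integrable M (\<lambda>\<omega>. (norm (S \<omega>))\<^sup>2)"
  shows "integrable M (\<lambda>\<omega>. S \<omega> \<bullet> \<epsilon> n \<omega>)" "(\<integral>\<omega>. S \<omega> \<bullet> \<epsilon> n \<omega> \<partial>M) = 0"
proof -
  have [measurable]: "\<theta>h n \<in> borel_measurable (F n)" using n by (intro \<theta>h_measurable_F) auto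
  have [measurable]: "S \<in> borel_measurable M" "\<epsilon> n \<in> borel_measurable M" using n by (auto intro: F_measurable_M)
  have K: "\<theta>h n \<omega> \<in> K" if "\<omega> \<in> space M" for \<omega> using \<theta>h_in_K[OF n that] .
  define \<psi> where "\<psi> = (\<lambda>\<omega> x. S \<omega> \<bullet> (G x (\<theta>h n \<omega>) - G x \<theta> - \<Phi> (\<theta>h n \<omega>)))"
  have [measurable]: "(\<lambda>(\<omega>, x). \<psi> \<omega> x) \<in> borel_measurable (F n \<Otimes>\<^sub>M borel)" unfolding \<psi>_def by measurable
  have eq: "S \<omega> \<bullet> \<epsilon> n \<omega> = \<psi> \<omega> (X (n + 1) \<omega>)" for \<omega> by (simp add: \<psi>_def \<epsilon>_def)
  show int: "integrable M (\<lambda>\<omega>. S \<omega> \<bullet> \<epsilon> n \<omega>)"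
  proof (rule Bochner_Integration.integrable_bound)
    show "integrable M (\<lambda>\<omega>. (norm (S \<omega>))\<^sup>2 + (norm (\<epsilon> n \<omega>))\<^sup>2)" using S2 \<epsilon>_square(1)[OF n] by simp
    have "\<bar>a \<bullet> b\<bar> \<le> (norm a)\<^sup>2 + (norm b)\<^sup>2" for a b :: 'y
      using Cauchy_Schwarz_ineq2[of a b] sum_squares_bound[of "norm a" "norm b"]
        mult_nonneg_nonneg[OF norm_ge_zero[of a] norm_ge_zero[of b]] by linarith
    then show "AE \<omega> in M. norm (S \<omega> \<bullet> \<epsilon> n \<omega>) \<le> norm ((norm (S \<omega>))\<^sup>2 + (norm (\<epsilon> n \<omega>))\<^sup>2)"
      by (intro AE_I2) simp
  qed measurable
  have int1: "integrable M (\<lambda>\<omega>. \<psi> \<omega> (X (n + 1) \<omega>))" using int by (simp only: eq)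
  have "(\<integral>\<omega>. S \<omega> \<bullet> \<epsilon> n \<omega> \<partial>M) = (\<integral>\<omega>. (\<integral>x. \<psi> \<omega> x \<partial>Q) \<partial>M)"
    unfolding eq by (rule fresh_integral(1)[where k=n and \<psi>=\<psi>, OF _ int1]) measurable
  also have "\<dots> = (\<integral>\<omega>. 0 \<partial>M)"
    unfolding \<psi>_def using centered_increment(1,2)[OF K]
    by (intro Bochner_Integration.integral_cong refl) simp
  finally show "(\<integral>\<omega>. S \<omega> \<bullet> \<epsilon> n \<omega> \<partial>M) = 0" by simp
qed

lemma sum_\<epsilon>_measurable_F: "(\<lambda>\<omega>. \<Sum>k=1..n. \<epsilon> k \<omega>) \<in> borel_measurable (F (n + 1))"
  by (intro borel_measurable_sum \<epsilon>_measurable_F) auto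

text \<open>Orthogonality removes the cross terms, so second moments add. The triangle inequality
  would give only the sum of k powr (-\<alpha>/2), which is not o(sqrt n).\<close>

lemma sum_\<epsilon>_square:
  "integrable M (\<lambda>\<omega>. (norm (\<Sum>k=1..n. \<epsilon> k \<omega>))\<^sup>2) \<and> (\<integral>\<omega>. (norm (\<Sum>k=1..n. \<epsilon> k \<omega>))\<^sup>2 \<partial>M) \<le> B * (\<Sum>k=1..n. v k)"
proof (induction n)
  case (Suc n)
  let ?S = "\<lambda>\<omega>. \<Sum>k=1..n. \<epsilon> k \<omega>"
  have S: "?S \<in> borel_measurable (F (Suc n))" using sum_\<epsilon>_measurable_F[of n] by simp
  have n: "Suc n \<ge> 1" by simp
  note o = \<epsilon>_orthogonal[OF n S conjunct1[OF Suc]]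
  have eq: "(norm (\<Sum>k=1..Suc n. \<epsilon> k \<omega>))\<^sup>2 = (norm (?S \<omega>))\<^sup>2 + 2 * (?S \<omega> \<bullet> \<epsilon> (Suc n) \<omega>) + (norm (\<epsilon> (Suc n) \<omega>))\<^sup>2" for \<omega>
  proof -
    have "(\<Sum>k=1..Suc n. \<epsilon> k \<omega>) = ?S \<omega> + \<epsilon> (Suc n) \<omega>" by simp
    moreover have "(norm (a + b))\<^sup>2 = (norm a)\<^sup>2 + 2 * (a \<bullet> b) + (norm b)\<^sup>2" for a b :: 'y
      unfolding power2_norm_eq_inner by (simp add: inner_simps inner_commute)
    ultimately show ?thesis by simp
  qed
  have "(\<integral>\<omega>. (norm (\<Sum>k=1..Suc n. \<epsilon> k \<omega>))\<^sup>2 \<partial>M)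
      = (\<integral>\<omega>. (norm (?S \<omega>))\<^sup>2 \<partial>M) + (\<integral>\<omega>. (norm (\<epsilon> (Suc n) \<omega>))\<^sup>2 \<partial>M)"
    unfolding eq using Suc o \<epsilon>_square(1)[OF n] by simp
  also have "\<dots> \<le> B * (\<Sum>k=1..n. v k) + B * v (Suc n)" using Suc \<epsilon>_square(2)[OF n] by (intro add_mono) auto
  finally have "(\<integral>\<omega>. (norm (\<Sum>k=1..Suc n. \<epsilon> k \<omega>))\<^sup>2 \<partial>M) \<le> B * (\<Sum>k=1..Suc n. v k)" by (simp add: distrib_left)
  moreover have "integrable M (\<lambda>\<omega>. (norm (\<Sum>k=1..Suc n. \<epsilon> k \<omega>))\<^sup>2)"
    unfolding eq using Suc o \<epsilon>_square(1)[OF n] by simp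
  ultimately show ?case by blast
qed simp

section \<open>The linearization remainder in mean\<close>

lemma expectation_le_sqrt:
  fixes f :: "'s \<Rightarrow> real"
  assumes [measurable]: "f \<in> borel_measurable M" and f2: "integrable M (\<lambda>\<omega>. (f \<omega>)\<^sup>2)"
  shows "integrable M f" "(\<integral>\<omega>. f \<omega> \<partial>M) \<le> sqrt (\<integral>\<omega>. (f \<omega>)\<^sup>2 \<partial>M)"
proof -
  show f1: "integrable M f" using assms by (rule square_integrable_imp_integrable)
  have "(\<integral>\<omega>. f \<omega> \<partial>M)\<^sup>2 \<le> (\<integral>\<omega>. (f \<omega>)\<^sup>2 \<partial>M)"
    using variance_positive[of f] variance_eq[OF f1 f2] by simp
  then show "(\<integral>\<omega>. f \<omega> \<partial>M) \<le> sqrt (\<integral>\<omega>. (f \<omega>)\<^sup>2 \<partial>M)" by (rule real_le_rsqrt)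
qed

lemma linearization_integrable:
  "integrable M (\<lambda>\<omega>. norm (\<tau> n \<omega>))"
proof (intro integrable_norm Bochner_Integration.integrable_sum Bochner_Integration.integrable_add)
  fix k assume "k \<in> {1..n}"
  then have k: "k \<ge> 1" by simp
  then have [measurable]: "\<theta>h k \<in> borel_measurable M" by (rule \<theta>h_measurable)
  have "integrable M (\<lambda>\<omega>. \<Delta> k \<omega>)"
    using deviation_integrable[OF k, of 1] by (subst integrable_norm_iff[symmetric]) auto
  then show "integrable M (\<lambda>\<omega>. L (\<Delta> k \<omega>))"
    using L_linear by (intro integrable_bounded_linear[of L]) (simp_all add: linear_conv_bounded_linear)
  have "integrable (distr M borel (X (k + 1))) (\<lambda>x. G x \<theta>)" using G_integrable[OF theta_in_K] by (simp add: X_law)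
  then show "integrable M (\<lambda>\<omega>. G (X (k + 1) \<omega>) \<theta>)" by (subst (asm) integrable_distr_eq) auto
qed

text \<open>The inverse step size. Writing it as a power fixes its value at 0, whereas \<gamma> is
  unspecified there.\<close>

definition w :: "nat \<Rightarrow> real" where
  "w n = real n powr \<alpha> / c"

lemma w_\<gamma>: "n \<ge> 1 \<Longrightarrow> w n * \<gamma> n = 1"
  using c_pos by (simp add: w_def \<gamma>_eq flip: powr_add)

lemma w_mono: "w n \<le> w (Suc n)"
  using c_pos \<alpha> by (simp add: w_def divide_right_mono powr_mono2)

text \<open>Summation by parts; since \<open>w 0 = 0\<close>, there is no boundary term at the lower end.\<close>

lemma decomposition:
  assumes \<omega>: "\<omega> \<in> space M"
  shows "(\<tau> n \<omega>)
    = (\<Sum>k=1..n. (w k - w (k - 1)) *\<^sub>R (\<Delta> k \<omega>)) - w n *\<^sub>R (\<Delta> (n + 1) \<omega>)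
      + (\<Sum>k=1..n. w k *\<^sub>R r k \<omega>) - (\<Sum>k=1..n. \<epsilon> k \<omega>)
      - (\<Sum>k=1..n. \<Phi> (\<theta>h k \<omega>) - L (\<Delta> k \<omega>))"
proof (induction n)
  case 0
  then show ?case using \<alpha> by (simp add: w_def)
next
  case (Suc n)
  let ?k = "Suc n"
  have "w ?k *\<^sub>R r ?k \<omega> = w ?k *\<^sub>R (\<theta>h (Suc ?k) \<omega> - \<theta>h ?k \<omega>) + G (X (Suc ?k) \<omega>) (\<theta>h ?k \<omega>)"
    using w_\<gamma>[of ?k] by (simp add: r_def scaleR_add_right scaleR_diff_right)
  \<comment> \<open>Splitting w ?k into (w ?k - w n) + w n lets the second part cancel against the
    boundary term of the induction hypothesis.\<close>
  then have step: "L (\<Delta> ?k \<omega>) + G (X (?k + 1) \<omega>) \<theta> = (w ?k - w n) *\<^sub>R (\<Delta> ?k \<omega>)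
     + w n *\<^sub>R (\<Delta> ?k \<omega>) - w ?k *\<^sub>R (\<Delta> (?k + 1) \<omega>) + w ?k *\<^sub>R r ?k \<omega> - \<epsilon> ?k \<omega>
     - (\<Phi> (\<theta>h ?k \<omega>) - L (\<Delta> ?k \<omega>))"
    by (simp add: \<epsilon>_def algebra_simps)
  have gen: "(a - b + e - f - q) + (a' + b - b' + e' - f' - q')
    = (a + a') - b' + (e + e') - (f + f') - (q + q')" for a a' b b' e e' f f' q q' :: 'y
    by simp
  have expand: "(\<Sum>k=1..Suc n. h k) = (\<Sum>k=1..n. h k) + h (Suc n)" for h :: "nat \<Rightarrow> 'y" by simp
  show ?case
    unfolding expand Suc step unfolding Suc_eq_plus1[symmetric] diff_Suc_1 by (rule gen)
qed

text \<open>The three terms have separate origins: the power of n comes from the summation by parts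
  with its boundary term, the sum from the projection and the quadratic error, and its square root
  from the orthogonal noise.\<close>

lemma linearization_error_bound:
  "\<exists>C. \<forall>n\<ge>1. (\<integral>\<omega>. norm (\<tau> n \<omega>) \<partial>M)
    \<le> C * (real n powr (\<alpha> / 2) + (\<Sum>k=1..n. real k powr (- \<alpha>)) + sqrt (\<Sum>k=1..n. real k powr (- \<alpha>)))"
proof -
  obtain D where D: "D \<ge> 0" "\<And>n. n \<ge> 1 \<Longrightarrow> v n \<le> D * real n powr (- \<alpha>)" using v_rate by blast
  have dev: "(\<integral>\<omega>. norm (\<Delta> n \<omega>) \<partial>M) \<le> sqrt D * real n powr (- \<alpha> / 2)" if n: "n \<ge> 1" for n
  proof -
    have "(\<integral>\<omega>. norm (\<Delta> n \<omega>) \<partial>M) \<le> sqrt (v n)"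
      unfolding v_def by (rule expectation_le_sqrt(2)) (use n deviation_integrable[OF n, of 2] in auto)
    also have "\<dots> \<le> sqrt (D * real n powr (- \<alpha>))" using D(2)[OF n] by simp
    also have "\<dots> = sqrt D * real n powr (- \<alpha> / 2)"
      using powr_half_sqrt_powr[of "real n" "- \<alpha>"] by (simp add: real_sqrt_mult)
    finally show ?thesis .
  qed
  have dev_int: "integrable M (\<lambda>\<omega>. norm (\<Delta> n \<omega>))" if "n \<ge> 1" for n
    using deviation_integrable[OF that, of 1] by simp
  define E where "E = 8 / d\<^sup>2 * (1 + B) * D + 4 / d * B * c"
  have E: "E \<ge> 0" unfolding E_def using D B_nonneg d_pos c_pos by simp
  have proj: "w n * (\<integral>\<omega>. norm (r n \<omega>) \<partial>M) \<le> E * real n powr (- \<alpha>)" if n: "n \<ge> 1" for n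
  proof -
    have "w n * (\<integral>\<omega>. norm (r n \<omega>) \<partial>M) \<le> w n * (\<gamma> n * (8 / d\<^sup>2 * (1 + B) * v n + 4 / d * B * \<gamma> n))"
      using projection_error_bound(2)[OF n] c_pos by (intro mult_left_mono) (auto simp: w_def)
    also have "\<dots> = 8 / d\<^sup>2 * (1 + B) * v n + 4 / d * B * \<gamma> n" using w_\<gamma>[OF n] by (simp flip: mult.assoc)
    also have "\<dots> \<le> 8 / d\<^sup>2 * (1 + B) * (D * real n powr (- \<alpha>)) + 4 / d * B * (c * real n powr (- \<alpha>))"
      using D(2)[OF n] B_nonneg d_pos by (intro add_mono mult_left_mono) (auto simp: \<gamma>_eq[OF n])
    also have "\<dots> = E * real n powr (- \<alpha>)" by (simp add: E_def algebra_simps)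
    finally show ?thesis .
  qed
  \<comment> \<open>The 3 is 2 for the telescoped sum plus 1 for the boundary term.\<close>
  define C where "C = 3 * sqrt D / c + E + sqrt (B * D) + B * D"
  show ?thesis
  proof (intro exI allI impI)
    fix n :: nat assume n: "n \<ge> 1"
    let ?\<sigma> = "\<Sum>k=1..n. real k powr (- \<alpha>)"
    have \<sigma>: "?\<sigma> \<ge> 0" by (intro sum_nonneg) auto
    define h where "h \<omega> = (\<Sum>k=1..n. (w k - w (k - 1)) * norm (\<Delta> k \<omega>)) + w n * norm (\<Delta> (n + 1) \<omega>)
      + (\<Sum>k=1..n. w k * norm (r k \<omega>)) + norm (\<Sum>k=1..n. \<epsilon> k \<omega>) + (\<Sum>k=1..n. B * (norm (\<Delta> k \<omega>))\<^sup>2)" for \<omega>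
    have eps: "integrable M (\<lambda>\<omega>. norm (\<Sum>k=1..n. \<epsilon> k \<omega>))"
      "(\<integral>\<omega>. norm (\<Sum>k=1..n. \<epsilon> k \<omega>) \<partial>M) \<le> sqrt (B * D * ?\<sigma>)"
    proof -
      have [measurable]: "(\<lambda>\<omega>. \<Sum>k=1..n. \<epsilon> k \<omega>) \<in> borel_measurable M"
        using sum_\<epsilon>_measurable_F by (rule F_measurable_M)
      note * = sum_\<epsilon>_square[of n]
      show "integrable M (\<lambda>\<omega>. norm (\<Sum>k=1..n. \<epsilon> k \<omega>))" 
        by (rule expectation_le_sqrt(1)) (use * in simp_all)
      have "(\<integral>\<omega>. norm (\<Sum>k=1..n. \<epsilon> k \<omega>) \<partial>M) \<le> sqrt (\<integral>\<omega>. (norm (\<Sum>k=1..n. \<epsilon> k \<omega>))\<^sup>2 \<partial>M)"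
        by (rule expectation_le_sqrt(2)) (use * in simp_all)
      also have "\<dots> \<le> sqrt (B * (\<Sum>k=1..n. v k))" using * by simp
      also have "\<dots> \<le> sqrt (B * (\<Sum>k=1..n. D * real k powr (- \<alpha>)))"
        using B_nonneg D(2) by (intro real_sqrt_le_mono mult_left_mono sum_mono) auto
      finally show "(\<integral>\<omega>. norm (\<Sum>k=1..n. \<epsilon> k \<omega>) \<partial>M) \<le> sqrt (B * D * ?\<sigma>)"
        by (simp add: mult.assoc sum_distrib_left)
    qed
    have ints: "integrable M (\<lambda>\<omega>. \<Sum>k=1..n. (w k - w (k - 1)) * norm (\<Delta> k \<omega>))"
      "integrable M (\<lambda>\<omega>. w n * norm (\<Delta> (n + 1) \<omega>))"
      "integrable M (\<lambda>\<omega>. \<Sum>k=1..n. w k * norm (r k \<omega>))"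
      "integrable M (\<lambda>\<omega>. \<Sum>k=1..n. B * (norm (\<Delta> k \<omega>))\<^sup>2)"
      using dev_int projection_error_bound(1) deviation_integrable[where k=2]
      by (auto intro!: Bochner_Integration.integrable_sum integrable_mult_right)
    have h_int: "integrable M h" unfolding h_def using ints eps(1) by (intro Bochner_Integration.integrable_add)
    have wn: "w k \<ge> 0" for k using c_pos by (simp add: w_def)
    have wd: "w k - w (k - 1) \<ge> 0" for k using w_mono[of "k - 1"] by (cases k) auto
    have bound: "norm (\<tau> n \<omega>) \<le> h \<omega>" if \<omega>: "\<omega> \<in> space M" for \<omega>
    proof -
      have n5: "norm (a - b + e - f - g) \<le> norm a + norm b + norm e + norm f + norm g" for a b e f g :: 'y
        using norm_triangle_ineq4[of "a - b + e - f" g] norm_triangle_ineq4[of "a - b + e" f]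
          norm_triangle_ineq[of "a - b" e] norm_triangle_ineq4[of a b] by linarith
      show ?thesis unfolding decomposition[OF \<omega>] h_def
      proof (intro order_trans[OF n5] add_mono)
        show "norm (\<Sum>k=1..n. (w k - w (k - 1)) *\<^sub>R (\<Delta> k \<omega>)) \<le> (\<Sum>k=1..n. (w k - w (k - 1)) * norm (\<Delta> k \<omega>))"
          using wd by (intro sum_norm_le) simp
        show "norm (w n *\<^sub>R (\<Delta> (n + 1) \<omega>)) \<le> w n * norm (\<Delta> (n + 1) \<omega>)" using wn by simp
        show "norm (\<Sum>k=1..n. w k *\<^sub>R r k \<omega>) \<le> (\<Sum>k=1..n. w k * norm (r k \<omega>))"
          using wn by (intro sum_norm_le) simp
        show "norm (\<Sum>k=1..n. \<Phi> (\<theta>h k \<omega>) - L (\<Delta> k \<omega>)) \<le> (\<Sum>k=1..n. B * (norm (\<Delta> k \<omega>))\<^sup>2)"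
          using mean_expansion \<theta>h_in_K[OF _ \<omega>] unfolding \<Phi>_def by (intro sum_norm_le) auto
      qed simp
    qed
    have "(\<integral>\<omega>. norm (\<tau> n \<omega>) \<partial>M) \<le> (\<integral>\<omega>. h \<omega> \<partial>M)"
      by (intro integral_mono linearization_integrable h_int bound)
    also have "\<dots> = (\<Sum>k=1..n. (w k - w (k - 1)) * (\<integral>\<omega>. norm (\<Delta> k \<omega>) \<partial>M))
        + w n * (\<integral>\<omega>. norm (\<Delta> (n + 1) \<omega>) \<partial>M) + (\<Sum>k=1..n. w k * (\<integral>\<omega>. norm (r k \<omega>) \<partial>M))
        + (\<integral>\<omega>. norm (\<Sum>k=1..n. \<epsilon> k \<omega>) \<partial>M) + (\<Sum>k=1..n. B * v k)"
      unfolding h_def using ints eps(1) dev_int projection_error_bound(1) deviation_integrable[where k=2]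
      by (simp add: Bochner_Integration.integral_sum v_def)
    also have "\<dots> \<le> 2 * sqrt D / c * real n powr (\<alpha> / 2) + sqrt D / c * real n powr (\<alpha> / 2)
        + E * ?\<sigma> + sqrt (B * D) * sqrt ?\<sigma> + B * D * ?\<sigma>"
    proof (intro add_mono)
      \<comment> \<open>With x and y the \<alpha>/2-th powers of m + 1 and m, the weight is (x^2 -
        y^2) / c and the mean error at most sqrt D / x. As (x + y) / x <= 2, the product is at most
        2 sqrt D (x - y) / c, which telescopes.\<close>
      have "(\<Sum>k=1..m. (w k - w (k - 1)) * (\<integral>\<omega>. norm (\<Delta> k \<omega>) \<partial>M)) \<le> 2 * sqrt D / c * real m powr (\<alpha> / 2)" for m
      proof (induction m)
        case (Suc m)
        define x y where "x = real (Suc m) powr (\<alpha> / 2)" and "y = real m powr (\<alpha> / 2)"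
        have x: "x > 0" and y: "0 \<le> y" "y \<le> x" using \<alpha> by (auto simp: x_def y_def intro!: powr_mono2)
        have w: "w (Suc m) - w m = (x * x - y * y) / c"
          by (simp add: w_def x_def y_def diff_divide_distrib flip: powr_add)
        have "real (Suc m) powr (- \<alpha> / 2) = 1 / x" by (simp add: x_def powr_minus_divide)
        then have "(w (Suc m) - w m) * (\<integral>\<omega>. norm (\<Delta> (Suc m) \<omega>) \<partial>M) \<le> (x * x - y * y) / c * (sqrt D * (1 / x))"
          using dev[of "Suc m"] wd[of "Suc m"] unfolding w[symmetric] by (intro mult_left_mono) auto
        also have "\<dots> = sqrt D / c * ((x - y) * ((x + y) / x))" by (simp add: algebra_simps diff_divide_distrib)
        also have "\<dots> \<le> sqrt D / c * ((x - y) * 2)"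
          using D x y c_pos by (intro mult_left_mono) (auto simp: field_simps)
        finally show ?case using Suc by (simp add: x_def y_def algebra_simps diff_divide_distrib)
      qed simp
      then show "(\<Sum>k=1..n. (w k - w (k - 1)) * (\<integral>\<omega>. norm (\<Delta> k \<omega>) \<partial>M)) \<le> 2 * sqrt D / c * real n powr (\<alpha> / 2)" .
      have "(\<integral>\<omega>. norm (\<Delta> (n + 1) \<omega>) \<partial>M) \<le> sqrt D * real n powr (- \<alpha> / 2)"
      proof -
        have "real (n + 1) powr (- \<alpha> / 2) \<le> real n powr (- \<alpha> / 2)" using n \<alpha> by (intro powr_mono2') auto
        then show ?thesis using dev[of "n + 1"] mult_left_mono[of _ _ "sqrt D"] D by (meson order_trans real_sqrt_ge_zero le_add2)
      qed
      then have "w n * (\<integral>\<omega>. norm (\<Delta> (n + 1) \<omega>) \<partial>M) \<le> w n * (sqrt D * real n powr (- \<alpha> / 2))"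
        using wn by (intro mult_left_mono)
      also have "\<dots> = sqrt D / c * (real n powr \<alpha> * real n powr (- \<alpha> / 2))" by (simp add: w_def)
      also have "real n powr \<alpha> * real n powr (- \<alpha> / 2) = real n powr (\<alpha> / 2)"
        by (simp flip: powr_add)
      finally show "w n * (\<integral>\<omega>. norm (\<Delta> (n + 1) \<omega>) \<partial>M) \<le> sqrt D / c * real n powr (\<alpha> / 2)" .
      show "(\<Sum>k=1..n. w k * (\<integral>\<omega>. norm (r k \<omega>) \<partial>M)) \<le> E * ?\<sigma>"
        unfolding sum_distrib_left using proj by (intro sum_mono) auto
      show "(\<integral>\<omega>. norm (\<Sum>k=1..n. \<epsilon> k \<omega>) \<partial>M) \<le> sqrt (B * D) * sqrt ?\<sigma>"
        using eps(2) by (simp add: real_sqrt_mult)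
      show "(\<Sum>k=1..n. B * v k) \<le> B * D * ?\<sigma>"
        unfolding sum_distrib_left using D B_nonneg by (intro sum_mono) (simp add: mult.assoc mult_left_mono)
    qed
    also have "\<dots> = (3 * sqrt D / c) * real n powr (\<alpha> / 2) + (E + B * D) * ?\<sigma> + sqrt (B * D) * sqrt ?\<sigma>"
      by (simp add: algebra_simps)
    also have "\<dots> \<le> C * real n powr (\<alpha> / 2) + C * ?\<sigma> + C * sqrt ?\<sigma>"
    proof -
      have "0 \<le> 3 * sqrt D / c" "0 \<le> sqrt (B * D)" "0 \<le> B * D" using D B_nonneg c_pos by auto
      then have "3 * sqrt D / c \<le> C" "E + B * D \<le> C" "sqrt (B * D) \<le> C"
        unfolding C_def using E by linarith+
      then show ?thesis using \<sigma> by (intro add_mono mult_right_mono) auto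
    qed
    finally show "(\<integral>\<omega>. norm (\<tau> n \<omega>) \<partial>M)
        \<le> C * (real n powr (\<alpha> / 2) + ?\<sigma> + sqrt ?\<sigma>)" by (simp add: distrib_left)
  qed
qed

theorem linearization_tendsto_0:
  "(\<lambda>n. (\<integral>\<omega>. norm (\<tau> n \<omega>) \<partial>M) / sqrt (real n)) \<longlonglongrightarrow> 0"
proof -
  obtain C where C: "\<And>n. n \<ge> 1 \<Longrightarrow> (\<integral>\<omega>. norm (\<tau> n \<omega>) \<partial>M)
    \<le> C * (real n powr (\<alpha> / 2) + (\<Sum>k=1..n. real k powr (- \<alpha>)) + sqrt (\<Sum>k=1..n. real k powr (- \<alpha>)))"
    using linearization_error_bound by blast
  define s where "s n = (\<Sum>k=1..n. real k powr (- \<alpha>)) / sqrt (real n)" for n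
  have s: "s \<longlonglongrightarrow> 0" unfolding s_def using \<alpha> by (rule mean_powr_tendsto_0)
  have 1: "(\<lambda>n. real n powr (- ((1 - \<alpha>) / 2))) \<longlonglongrightarrow> 0"
    using \<alpha> by (intro tendsto_neg_powr filterlim_real_sequentially) auto
  have 2: "(\<lambda>n. real n powr (- (1 / 4))) \<longlonglongrightarrow> 0"
    by (intro tendsto_neg_powr filterlim_real_sequentially) auto
  have "(\<lambda>n. C * (real n powr (- ((1 - \<alpha>) / 2)) + s n + sqrt (s n) * real n powr (- (1 / 4)))) \<longlonglongrightarrow> C * (0 + 0 + sqrt 0 * 0)"
    by (intro tendsto_intros s 1 2)
  then have lim: "(\<lambda>n. C * (real n powr (- ((1 - \<alpha>) / 2)) + s n + sqrt (s n) * real n powr (- (1 / 4)))) \<longlonglongrightarrow> 0" by simp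
  show ?thesis
  proof (rule tendsto_sandwich[OF _ _ tendsto_const lim])
    show "\<forall>\<^sub>F n in sequentially. 0 \<le> (\<integral>\<omega>. norm (\<tau> n \<omega>) \<partial>M) / sqrt (real n)"
      by (intro always_eventually allI divide_nonneg_nonneg integral_nonneg_AE) auto
    show "\<forall>\<^sub>F n in sequentially. (\<integral>\<omega>. norm (\<tau> n \<omega>) \<partial>M) / sqrt (real n)
        \<le> C * (real n powr (- ((1 - \<alpha>) / 2)) + s n + sqrt (s n) * real n powr (- (1 / 4)))"
    proof (rule eventually_sequentiallyI[of 1])
      fix n :: nat assume n: "n \<ge> 1"
      have sq: "sqrt (real n) = real n powr (1 / 2)" using n by (simp add: powr_half_sqrt)
      have a: "real n powr (\<alpha> / 2) / sqrt (real n) = real n powr (- ((1 - \<alpha>) / 2))"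
        unfolding sq by (simp add: diff_divide_distrib flip: powr_diff)
      have q: "sqrt (sqrt (real n)) = real n powr (1 / 4)" using n by (simp add: powr_half_sqrt[symmetric] powr_powr)
      \<comment> \<open>Expressed through \<open>s\<close>, the square root keeps a spare factor n
        powr (-1/4) after division by sqrt n.\<close>
      have "sqrt (\<Sum>k=1..n. real k powr (- \<alpha>)) = sqrt (s n) * real n powr (1 / 4)"
        using n by (simp add: s_def q real_sqrt_divide)
      moreover have q2: "real n powr (1 / 4) / real n powr (1 / 2) = real n powr (- (1 / 4))"
        by (simp flip: powr_diff)
      ultimately have b: "sqrt (\<Sum>k=1..n. real k powr (- \<alpha>)) / sqrt (real n) = sqrt (s n) * real n powr (- (1 / 4))"
        unfolding sq using q2 by (simp flip: times_divide_eq_right)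
      have "(\<integral>\<omega>. norm (\<tau> n \<omega>) \<partial>M) / sqrt (real n)
         \<le> (C * (real n powr (\<alpha> / 2) + (\<Sum>k=1..n. real k powr (- \<alpha>)) + sqrt (\<Sum>k=1..n. real k powr (- \<alpha>)))) / sqrt (real n)"
        using C[OF n] by (intro divide_right_mono) auto
      also have "\<dots> = C * (real n powr (- ((1 - \<alpha>) / 2)) + s n + sqrt (s n) * real n powr (- (1 / 4)))"
        unfolding a[symmetric] b[symmetric] unfolding s_def by (simp add: add_divide_distrib distrib_left)
      finally show "(\<integral>\<omega>. norm (\<tau> n \<omega>) \<partial>M) / sqrt (real n)
        \<le> C * (real n powr (- ((1 - \<alpha>) / 2)) + s n + sqrt (s n) * real n powr (- (1 / 4)))" .
    qed
  qed
qed

end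

section \<open>Integrability of inverse distances\<close>

lemma sets_ball [measurable]: "ball x r \<in> sets (borel :: 'a::metric_space measure)"
  by simp

text \<open>Dyadic shells: where norm z lies between 2^-(k+1) and 2^-k the integrand is at most
  2^(k+1), and in dimension at least 2 the ball of radius 2^-k has volume at most a constant times
  4^-k, so the series is geometric.\<close>

lemma nn_integral_inverse_norm_unit_ball:
  assumes "DIM('a::euclidean_space) \<ge> 2"
  shows "(\<integral>\<^sup>+z. ennreal (1 / norm z) * indicator (ball 0 1) z \<partial>(lborel :: 'a measure)) < \<infinity>"
proof -
  define V where "V = unit_ball_vol (real DIM('a))"
  have V: "V \<ge> 0" by (simp add: V_def)
  define f :: "nat \<Rightarrow> 'a \<Rightarrow> ennreal" where
    "f k z = ennreal (2 ^ (k + 1)) * indicator (ball 0 ((1 / 2) ^ k)) z" for k z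
  have "ennreal (1 / norm z) * indicator (ball 0 1) z \<le> (\<Sum>k. f k z)" for z :: 'a
  proof (cases "z = 0 \<or> z \<notin> ball 0 1")
    case True
    then show ?thesis by (auto simp: indicator_def)
  next
    case False
    then have z: "0 < norm z" "norm z < 1" by auto
    then obtain n where "(1 / 2) ^ n < norm z" using real_arch_pow_inv[of "norm z" "1 / 2"] by auto
    then have ex: "\<exists>n. (1 / 2) ^ n \<le> norm z" by (intro exI[of _ n]) simp
    define k where "k = (LEAST n. (1 / 2) ^ n \<le> norm z)"
    have k: "(1 / 2) ^ k \<le> norm z" unfolding k_def using ex by (rule LeastI_ex)
    then have "k \<noteq> 0" using z by (auto intro: ccontr)
    then obtain j where j: "k = Suc j" using not0_implies_Suc by blast
    have nj: "norm z < (1 / 2) ^ j"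
      using not_less_Least[of j "\<lambda>n. (1 / 2) ^ n \<le> norm z"] j by (simp add: k_def not_le)
    have "1 / norm z \<le> 2 ^ (j + 1)" using k z unfolding j by (simp add: field_simps)
    then have "ennreal (1 / norm z) * indicator (ball 0 1) z \<le> f j z"
      using z nj by (simp add: f_def ennreal_leI)
    also have "\<dots> \<le> (\<Sum>k. f k z)"
      using sum_le_suminf[of "\<lambda>k. f k z" "{j}"] by (simp add: summableI)
    finally show ?thesis .
  qed
  then have "(\<integral>\<^sup>+z. ennreal (1 / norm z) * indicator (ball 0 1) z \<partial>(lborel :: 'a measure))
      \<le> (\<integral>\<^sup>+z. (\<Sum>k. f k z) \<partial>lborel)"
    by (intro nn_integral_mono)
  also have "\<dots> = (\<Sum>k. \<integral>\<^sup>+z. f k z \<partial>lborel)"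
    by (intro nn_integral_suminf) (simp add: f_def)
  also have "\<dots> \<le> (\<Sum>k. ennreal (2 * V * (1 / 2) ^ k))"
  proof (intro suminf_le summableI)
    fix k
    have "(\<integral>\<^sup>+z. f k z \<partial>lborel) = ennreal (2 ^ (k + 1)) * emeasure lborel (ball (0::'a) ((1 / 2) ^ k))"
      unfolding f_def by (subst nn_integral_cmult_indicator) auto
    also have "\<dots> = ennreal (2 ^ (k + 1) * (V * ((1 / 2) ^ k) ^ DIM('a)))"
      using V by (simp add: emeasure_ball V_def ennreal_mult)
    also have "\<dots> \<le> ennreal (2 ^ (k + 1) * (V * ((1 / 2) ^ k) ^ 2))"
      using V assms by (intro ennreal_leI mult_left_mono power_decreasing) (auto simp: power_le_one)
    also have "2 ^ (k + 1) * (V * ((1 / 2) ^ k) ^ 2) = 2 * V * (1 / 2) ^ k"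
      by (simp add: power2_eq_square power_one_over field_simps)
    finally show "(\<integral>\<^sup>+z. f k z \<partial>lborel) \<le> ennreal (2 * V * (1 / 2) ^ k)" .
  qed
  also have "\<dots> < \<infinity>"
    using V by (subst suminf_ennreal2) (auto intro!: summable_mult summable_geometric)
  finally show ?thesis .
qed

text \<open>Uniformity in x comes from splitting at distance 1: near x, translation invariance
  reduces to the unit ball at the origin; elsewhere the integrand is at most 1 on a ball of finite
  volume.\<close>

lemma nn_integral_inverse_dist_ball:
  assumes "DIM('a::euclidean_space) \<ge> 2"
  shows "\<exists>C<\<infinity>. \<forall>x. (\<integral>\<^sup>+z. ennreal (1 / norm (x - z)) * indicator (ball 0 R) z \<partial>(lborel :: 'a measure)) \<le> C"
proof -
  define C where "C = (\<integral>\<^sup>+z. ennreal (1 / norm z) * indicator (ball 0 1) z \<partial>(lborel :: 'a measure))"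
  have Cfin: "C < \<infinity>" unfolding C_def using assms by (rule nn_integral_inverse_norm_unit_ball)
  show ?thesis
  proof (intro exI[of _ "C + emeasure lborel (ball (0::'a) R)"] conjI allI)
    show "C + emeasure lborel (ball (0::'a) R) < \<infinity>"
      using Cfin emeasure_lborel_ball_finite[of "0::'a" R] by (simp add: ennreal_add_eq_top less_top)
    fix x :: 'a
    have "(\<integral>\<^sup>+z. ennreal (1 / norm (x - z)) * indicator (ball 0 R) z \<partial>(lborel :: 'a measure))
      \<le> (\<integral>\<^sup>+z. ennreal (1 / norm (x - z)) * indicator (ball 0 1) (x - z) + indicator (ball 0 R) z \<partial>lborel)"
    proof (intro nn_integral_mono)
      fix z
      have "ennreal (1 / norm (x - z)) \<le> 1" if "\<not> norm (x - z) < 1"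
        using that by (simp add: ennreal_le_1 divide_le_eq_1)
      then show "ennreal (1 / norm (x - z)) * indicator (ball 0 R) z
          \<le> ennreal (1 / norm (x - z)) * indicator (ball 0 1) (x - z) + indicator (ball 0 R) z"
        by (auto simp: indicator_def add_increasing2)
    qed
    also have "\<dots> = (\<integral>\<^sup>+z. ennreal (1 / norm (x - z)) * indicator (ball 0 1) (x - z) \<partial>lborel) + emeasure lborel (ball (0::'a) R)"
      by (subst nn_integral_add) auto
    also have "(\<integral>\<^sup>+z. ennreal (1 / norm (x - z)) * indicator (ball 0 1) (x - z) \<partial>lborel)
        = (\<integral>\<^sup>+z. ennreal (1 / norm (x - z)) * indicator (ball 0 1) (x - z) \<partial>distr lborel borel ((+) x))"
      by (simp add: lborel_distr_plus)
    also have "\<dots> = C"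
      unfolding C_def by (subst nn_integral_distr) (auto simp: indicator_def)
    finally show "(\<integral>\<^sup>+z. ennreal (1 / norm (x - z)) * indicator (ball 0 R) z \<partial>(lborel :: 'a measure))
        \<le> C + emeasure lborel (ball (0::'a) R)" .
  qed
qed

text \<open>Whatever the law of X, Tonelli's theorem makes the integral over z in any ball finite,
  so the exceptional z in that ball form a null set; countably many balls cover the space.\<close>

lemma (in prob_space) AE_inverse_dist_integrable:
  fixes X :: "'a \<Rightarrow> 'b::euclidean_space"
  assumes "DIM('b) \<ge> 2" and [measurable]: "X \<in> borel_measurable M"
  shows "AE z in lborel. (\<integral>\<^sup>+\<omega>. ennreal (1 / norm (X \<omega> - z)) \<partial>M) < \<infinity>"
proof -
  interpret MB: pair_sigma_finite M "lborel :: 'b measure" ..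
  have "AE z in lborel. z \<in> ball 0 (real n) \<longrightarrow> (\<integral>\<^sup>+\<omega>. ennreal (1 / norm (X \<omega> - z)) \<partial>M) < \<infinity>" for n
  proof -
    obtain C where C: "C < \<infinity>"
      "\<And>x. (\<integral>\<^sup>+z. ennreal (1 / norm (x - z)) * indicator (ball 0 (real n)) z \<partial>(lborel :: 'b measure)) \<le> C"
      using nn_integral_inverse_dist_ball[OF assms(1), of "real n"] by blast
    have "(\<integral>\<^sup>+z. (\<integral>\<^sup>+\<omega>. ennreal (1 / norm (X \<omega> - z)) * indicator (ball 0 (real n)) z \<partial>M) \<partial>lborel)
        = (\<integral>\<^sup>+\<omega>. (\<integral>\<^sup>+z. ennreal (1 / norm (X \<omega> - z)) * indicator (ball 0 (real n)) z \<partial>lborel) \<partial>M)"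
      by (intro MB.Fubini') measurable
    also have "\<dots> \<le> (\<integral>\<^sup>+\<omega>. C \<partial>M)" by (intro nn_integral_mono C)
    also have "\<dots> = C" by (simp add: emeasure_space_1)
    finally have "(\<integral>\<^sup>+z. (\<integral>\<^sup>+\<omega>. ennreal (1 / norm (X \<omega> - z)) * indicator (ball 0 (real n)) z \<partial>M) \<partial>lborel) \<noteq> \<infinity>"
      using C(1) by auto
    then have "AE z in lborel. (\<integral>\<^sup>+\<omega>. ennreal (1 / norm (X \<omega> - z)) * indicator (ball 0 (real n)) z \<partial>M) \<noteq> \<infinity>"
      by (intro nn_integral_PInf_AE) measurable
    then show ?thesis by eventually_elim (auto simp: less_top)
  qed
  then have "AE z in lborel. \<forall>n. z \<in> ball 0 (real n) \<longrightarrow> (\<integral>\<^sup>+\<omega>. ennreal (1 / norm (X \<omega> - z)) \<partial>M) < \<infinity>"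
    unfolding AE_all_countable by blast
  then show ?thesis
  proof eventually_elim
    case (elim z)
    obtain n where "norm z < real n" using reals_Archimedean2 by blast
    then show ?case using elim by auto
  qed
qed

lemma AE_lborel_scaleR:
  fixes Q :: "'a::euclidean_space \<Rightarrow> bool"
  assumes "AE x in lborel. Q x" and [measurable]: "Measurable.pred borel Q" and "c \<noteq> 0"
  shows "AE x in lborel. Q (c *\<^sub>R x)"
proof -
  have eq: "lborel = density (distr lborel borel (\<lambda>x::'a. c *\<^sub>R x)) (\<lambda>_. ennreal (\<bar>c\<bar> ^ DIM('a)))"
    using lborel_affine[OF assms(3), of 0] by simp
  have "AE x in density (distr lborel borel (\<lambda>x::'a. c *\<^sub>R x)) (\<lambda>_. ennreal (\<bar>c\<bar> ^ DIM('a))). Q x"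
    using assms(1) by (subst (asm) eq)
  then show ?thesis using assms(3) by (simp add: AE_density AE_distr_iff)
qed

text \<open>Where the inverse distance to \<open>X\<close> is not integrable, \<open>Gamma_mat\<close> is the junk value \<open>0\<close> and [A3] says
  nothing. Hence [A3] is used on almost every segment from \<open>\<mu>\<close> only, and the resulting inequalities
  are extended to all segments by continuity.\<close>

lemma (in prob_space) AE_segment_inverse_dist_integrable:
  fixes V :: "'a \<Rightarrow> 'b::euclidean_space"
  assumes "DIM('b) \<ge> 2" and [measurable]: "V \<in> borel_measurable M"
  shows "AE h in lborel. AE s in (lborel :: real measure). (\<integral>\<^sup>+\<omega>. ennreal (1 / norm (V \<omega> - s *\<^sub>R h)) \<partial>M) < \<infinity>"
proof -
  \<comment> \<open>For fixed s \<noteq> 0 the exceptional h form a rescaled null set, and the two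
    quantifiers are then exchanged. At s = 0 the rescaling degenerates.\<close>
  have "AE s in (lborel :: real measure). s \<noteq> 0" by (rule AE_lborel_singleton)
  then have "AE s in (lborel :: real measure). AE h in lborel. (\<integral>\<^sup>+\<omega>. ennreal (1 / norm (V \<omega> - s *\<^sub>R h)) \<partial>M) < \<infinity>"
  proof eventually_elim
    case (elim s)
    show ?case
      by (rule AE_lborel_scaleR[OF AE_inverse_dist_integrable[OF assms] _ elim]) measurable
  qed
  then show ?thesis by (subst lborel_pair.AE_commute) measurable
qed

text \<open>The second derivative of the norm at v along h, that is, the quadratic form of the
  integrand of \<Gamma>. At v = 0 it is 0, as a quotient by 0.\<close>

definition dir_hess :: "'a::real_inner \<Rightarrow> 'a \<Rightarrow> real" where
  "dir_hess v h = ((norm h)\<^sup>2 - (sgn v \<bullet> h)\<^sup>2) / norm v"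

lemma dir_hess_nonneg: "0 \<le> dir_hess v h"
proof -
  have "\<bar>sgn v \<bullet> h\<bar> \<le> norm (sgn v) * norm h" by (rule Cauchy_Schwarz_ineq2)
  also have "\<dots> \<le> 1 * norm h" by (intro mult_right_mono norm_sgn_le) simp
  finally have "(sgn v \<bullet> h)\<^sup>2 \<le> (norm h)\<^sup>2" by (simp add: abs_le_square_iff[symmetric])
  then show ?thesis by (simp add: dir_hess_def)
qed

lemma has_derivative_norm_line:
  fixes v h :: "'a::real_inner"
  assumes "v \<noteq> s *\<^sub>R h"
  shows "((\<lambda>s. norm (v - s *\<^sub>R h)) has_real_derivative - (sgn (v - s *\<^sub>R h) \<bullet> h)) (at s)"
proof -
  have ne: "v - s *\<^sub>R h \<noteq> 0" using assms by simp
  have "((\<lambda>s. v - s *\<^sub>R h) has_derivative (\<lambda>t. - (t *\<^sub>R h))) (at s)"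
    by (auto intro!: derivative_eq_intros)
  moreover have "(norm has_derivative (\<lambda>x. x \<bullet> sgn (v - s *\<^sub>R h))) (at (v - s *\<^sub>R h))"
    using GDERIV_norm[OF ne] by (simp add: gderiv_def)
  ultimately have "((\<lambda>s. norm (v - s *\<^sub>R h)) has_derivative (\<lambda>t. - (t *\<^sub>R h) \<bullet> sgn (v - s *\<^sub>R h))) (at s)"
    by (rule has_derivative_compose)
  moreover have "(\<lambda>t. - (t *\<^sub>R h) \<bullet> sgn (v - s *\<^sub>R h)) = (*) (- (sgn (v - s *\<^sub>R h) \<bullet> h))"
    by (simp add: fun_eq_iff inner_commute)
  ultimately show ?thesis
    by (simp add: has_field_derivative_def)
qed

lemma has_derivative_sgn_line:
  fixes v h :: "'a::real_inner"
  assumes "v \<noteq> s *\<^sub>R h"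
  shows "((\<lambda>s. sgn (v - s *\<^sub>R h) \<bullet> h) has_real_derivative - dir_hess (v - s *\<^sub>R h) h) (at s)"
proof -
  define w where "w = v - s *\<^sub>R h"
  have ne: "norm w \<noteq> 0" using assms by (simp add: w_def)
  have "((\<lambda>s. (v - s *\<^sub>R h) \<bullet> h) has_real_derivative - (norm h)\<^sup>2) (at s)"
    unfolding inner_diff_left inner_scaleR_left power2_norm_eq_inner
    by (auto intro!: derivative_eq_intros)
  from DERIV_divide[OF this has_derivative_norm_line[OF assms]] ne
  have "((\<lambda>s. (v - s *\<^sub>R h) \<bullet> h / norm (v - s *\<^sub>R h)) has_real_derivative
      (- (norm h)\<^sup>2 * norm w - (w \<bullet> h) * - (sgn w \<bullet> h)) / (norm w * norm w)) (at s)"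
    by (simp add: w_def)
  also have "(\<lambda>s. (v - s *\<^sub>R h) \<bullet> h / norm (v - s *\<^sub>R h)) = (\<lambda>s. sgn (v - s *\<^sub>R h) \<bullet> h)"
    by (simp add: sgn_div_norm divide_inverse mult.commute)
  also have "(- (norm h)\<^sup>2 * norm w - (w \<bullet> h) * - (sgn w \<bullet> h)) / (norm w * norm w) = - dir_hess w h"
    using ne by (simp add: dir_hess_def sgn_div_norm field_simps power2_eq_square)
  finally show ?thesis by (simp add: w_def)
qed

text \<open>For phi(s) = norm (v - s h) the right-hand sides are phi'(1) - phi'(0) and the Taylor
  remainder phi(1) - phi(0) - phi'(0); they integrate phi'' against the kernels 1 and 1 - s. The
  segment has to miss v for phi to be smooth.\<close>

lemma nn_integral_dir_hess:
  fixes v h :: "'a::euclidean_space"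
  assumes "\<And>s. s \<in> {0..1} \<Longrightarrow> v \<noteq> s *\<^sub>R h"
  shows "(\<integral>\<^sup>+s. ennreal (dir_hess (v - s *\<^sub>R h) h) * indicator {0..1} s \<partial>lborel)
      = ennreal ((sgn v - sgn (v - h)) \<bullet> h)"
    and "(\<integral>\<^sup>+s. ennreal ((1 - s) * dir_hess (v - s *\<^sub>R h) h) * indicator {0..1} s \<partial>lborel)
      = ennreal (norm (v - h) - norm v + sgn v \<bullet> h)"
proof -
  have [measurable]: "(\<lambda>s. dir_hess (v - s *\<^sub>R h) h) \<in> borel_measurable borel"
    unfolding dir_hess_def by measurable
  have "(\<integral>\<^sup>+s. ennreal (dir_hess (v - s *\<^sub>R h) h) * indicator {0..1} s \<partial>lborel)
      = ennreal (- (sgn (v - 1 *\<^sub>R h) \<bullet> h) - (- (sgn (v - 0 *\<^sub>R h) \<bullet> h)))"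
  proof (rule nn_integral_FTC_Icc[where F="\<lambda>s. - (sgn (v - s *\<^sub>R h) \<bullet> h)"])
    fix s :: real assume "s \<in> {0..1}"
    then show "((\<lambda>s. - (sgn (v - s *\<^sub>R h) \<bullet> h)) has_real_derivative dir_hess (v - s *\<^sub>R h) h) (at s)"
      using DERIV_minus[OF has_derivative_sgn_line[OF assms]] by simp
  qed (simp_all add: dir_hess_nonneg)
  then show "(\<integral>\<^sup>+s. ennreal (dir_hess (v - s *\<^sub>R h) h) * indicator {0..1} s \<partial>lborel)
      = ennreal ((sgn v - sgn (v - h)) \<bullet> h)" by (simp add: inner_diff_left)
  define F where "F s = norm (v - s *\<^sub>R h) - (1 - s) * (sgn (v - s *\<^sub>R h) \<bullet> h)" for s
  have "(\<integral>\<^sup>+s. ennreal ((1 - s) * dir_hess (v - s *\<^sub>R h) h) * indicator {0..1} s \<partial>lborel) = ennreal (F 1 - F 0)"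
  proof (rule nn_integral_FTC_Icc)
    fix s :: real assume "s \<in> {0..1}"
    then have s: "v \<noteq> s *\<^sub>R h" "s \<le> 1" using assms by auto
    show "(F has_real_derivative (1 - s) * dir_hess (v - s *\<^sub>R h) h) (at s)" unfolding F_def
      by (rule derivative_eq_intros has_derivative_norm_line[OF s(1)] has_derivative_sgn_line[OF s(1)] refl)+ simp
    show "0 \<le> (1 - s) * dir_hess (v - s *\<^sub>R h) h" using s dir_hess_nonneg[of "v - s *\<^sub>R h" h] by simp
  qed simp_all
  then show "(\<integral>\<^sup>+s. ennreal ((1 - s) * dir_hess (v - s *\<^sub>R h) h) * indicator {0..1} s \<partial>lborel)
      = ennreal (norm (v - h) - norm v + sgn v \<bullet> h)" by (simp add: F_def algebra_simps)
qed

section \<open>The mean field of the model\<close>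

lemma Gamma_mat_quadratic:
  "((1 / norm v) *\<^sub>R (mat 1 - (1 / (norm v)\<^sup>2) *\<^sub>R outer v v)) *v h
    = (h - (sgn v \<bullet> h) *\<^sub>R sgn v) /\<^sub>R norm v"
proof -
  have "((1 / norm v) *\<^sub>R (mat 1 - (1 / (norm v)\<^sup>2) *\<^sub>R outer v v)) *v h
      = (1 / norm v) *\<^sub>R (h - (1 / (norm v)\<^sup>2) *\<^sub>R ((v \<bullet> h) *\<^sub>R v))"
    by (simp add: matrix_vector_mult_diff_rdistrib outer_vec_mult flip: scaleR_matrix_vector_assoc)
  also have "(1 / (norm v)\<^sup>2) *\<^sub>R ((v \<bullet> h) *\<^sub>R v) = (sgn v \<bullet> h) *\<^sub>R sgn v"
    by (simp add: sgn_div_norm power2_eq_square divide_inverse)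
  finally show ?thesis by (simp add: divide_inverse)
qed

lemma inner_dir_hess: "h \<bullet> ((h - (sgn v \<bullet> h) *\<^sub>R sgn v) /\<^sub>R norm v) = dir_hess v h"
  by (simp add: dir_hess_def inner_diff_right dot_square_norm power2_eq_square inner_commute divide_inverse mult.commute)

lemma bounded_linear_matrix_vector_mult_left: "bounded_linear (\<lambda>A :: real^'n^'m. A *v h)"
  by (intro linear_conv_bounded_linear[THEN iffD1] linearI)
    (simp_all add: matrix_vector_mult_add_rdistrib scaleR_matrix_vector_assoc)

lemma norm_matrix_le_sum: "norm A \<le> (\<Sum>i\<in>UNIV. \<Sum>j\<in>UNIV. \<bar>A $ i $ j\<bar>)" for A :: "real^'n^'m"
proof -
  have "norm A \<le> (\<Sum>i\<in>UNIV. norm (A $ i))" unfolding norm_vec_def[of A] by (rule L2_set_le_sum) simp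
  also have "\<dots> \<le> (\<Sum>i\<in>UNIV. \<Sum>j\<in>UNIV. \<bar>A $ i $ j\<bar>)" by (intro sum_mono norm_le_l1_cart)
  finally show ?thesis .
qed

lemma integrable_integral_Pair:
  fixes f :: "'a \<Rightarrow> 'b::{banach, second_countable_topology}" and k :: "'a \<Rightarrow> 'c::{banach, second_countable_topology}"
  assumes "integrable M f" "integrable M k"
  shows "integrable M (\<lambda>x. (f x, k x))" "(\<integral>x. (f x, k x) \<partial>M) = (\<integral>x. f x \<partial>M, \<integral>x. k x \<partial>M)"
proof -
  have "integrable M (\<lambda>x. (f x, 0 :: 'c) + (0 :: 'b, k x))"
    using assms by (intro Bochner_Integration.integrable_add
      integrable_bounded_linear[OF bounded_linear_Pair[OF bounded_linear_ident bounded_linear_zero]]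
      integrable_bounded_linear[OF bounded_linear_Pair[OF bounded_linear_zero bounded_linear_ident]])
  then show int: "integrable M (\<lambda>x. (f x, k x))" by simp
  show "(\<integral>x. (f x, k x) \<partial>M) = (\<integral>x. f x \<partial>M, \<integral>x. k x \<partial>M)"
    using integral_bounded_linear[OF bounded_linear_fst int] integral_bounded_linear[OF bounded_linear_snd int]
    by (simp add: prod_eq_iff)
qed

lemma borel_measurable_outer_self [measurable]: "(\<lambda>v. outer v v) \<in> borel_measurable borel"
  unfolding outer_def by (intro borel_measurable_continuous_onI continuous_on_vec_lambda continuous_intros)

text \<open>What the analysis uses of the model. \<open>mean_dir\<close>, for which independence of
  radius and direction is responsible, and \<open>mean_norm\<close> make (\<mu>, rs) a zero of the
  mean field. \<open>no_ray\<close> says that the direction has no atoms; it keeps X off any given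
  segment from \<mu>, along which norms can then be differentiated.\<close>

locale spherical_law = prob_space P for P :: "'p measure" +
  fixes X :: "'p \<Rightarrow> real^'n" and \<mu> :: "real^'n" and rs :: real
  assumes dim: "CARD('n) \<ge> 2"
    and X_measurable [measurable]: "X \<in> borel_measurable P"
    and inverse_square_integrable: "integrable P (\<lambda>w. 1 / (norm (X w - \<mu>))\<^sup>2)"
    and square_integrable: "integrable P (\<lambda>w. (norm (X w - \<mu>))\<^sup>2)"
    and not_center: "AE w in P. X w \<noteq> \<mu>"
    and no_ray: "\<And>e. AE w in P. sgn (X w - \<mu>) = e \<longrightarrow> X w = \<mu>"
    and mean_dir: "(\<integral>w. X w \<partial>P) = \<mu> + rs *\<^sub>R (\<integral>w. sgn (X w - \<mu>) \<partial>P)"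
    and mean_norm: "(\<integral>w. norm (X w - \<mu>) \<partial>P) = rs"
begin

abbreviation V :: "'p \<Rightarrow> real^'n" where "V w \<equiv> X w - \<mu>"

definition m :: "real^'n" where "m = (\<integral>w. sgn (V w) \<partial>P)"

definition I2 :: real where "I2 = (\<integral>w. 1 / (norm (V w))\<^sup>2 \<partial>P)"

lemma inverse_square_affine:
  "integrable P (\<lambda>w. (a + b * (1 / (norm (V w))\<^sup>2)) * c)"
  "(\<integral>w. (a + b * (1 / (norm (V w))\<^sup>2)) * c \<partial>P) = (a + b * I2) * c"
proof -
  define J where "J w = 1 / (norm (V w))\<^sup>2" for w
  have "integrable P J" "I2 = (\<integral>w. J w \<partial>P)" using inverse_square_integrable by (simp_all add: J_def[abs_def] I2_def)
  then show "integrable P (\<lambda>w. (a + b * (1 / (norm (V w))\<^sup>2)) * c)"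
    "(\<integral>w. (a + b * (1 / (norm (V w))\<^sup>2)) * c \<partial>P) = (a + b * I2) * c"
    unfolding J_def[symmetric] by (simp_all add: prob_space)
qed

lemma rs_nonneg: "rs \<ge> 0"
  unfolding mean_norm[symmetric] by (intro integral_nonneg_AE) simp

lemma I2_nonneg: "I2 \<ge> 0"
  unfolding I2_def by (intro integral_nonneg_AE) simp

lemma integrable_sgn: "integrable P (\<lambda>w. sgn (X w - z))"
  by (intro integrable_const_bound[where B=1] AE_I2 norm_sgn_le) measurable

lemma integrable_norm_V: "integrable P (\<lambda>w. norm (V w))"
  by (rule square_integrable_imp_integrable) (use square_integrable in auto)

lemma integrable_V: "integrable P V"
  using integrable_norm_V by (subst integrable_norm_iff[symmetric]) auto

lemma integrable_X: "integrable P X"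
  using Bochner_Integration.integrable_add[OF integrable_V, of "\<lambda>_. \<mu>"] by simp

lemma integrable_norm_diff: "integrable P (\<lambda>w. norm (V w - h))"
  using integrable_V by simp

lemma integrable_inverse_norm: "integrable P (\<lambda>w. 1 / norm (V w))"
proof (rule Bochner_Integration.integrable_bound)
  show "integrable P (\<lambda>w. 1 + 1 / (norm (V w))\<^sup>2)" using inverse_square_integrable by simp
  show "AE w in P. norm (1 / norm (V w)) \<le> norm (1 + 1 / (norm (V w))\<^sup>2)"
    using le_one_plus_square[of "1 / norm (V w)" for w] by (intro AE_I2) (simp add: power_one_over)
qed measurable

section \<open>The stochastic gradient near the target\<close>

lemma grad_g_shift:
  "grad_g x (\<mu> + h, rs + b) = (h - (x - \<mu>) + (rs + b) *\<^sub>R sgn (x - \<mu> - h), rs + b - norm (x - \<mu> - h))"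
proof -
  have "\<mu> + h - x = - (x - \<mu> - h)" by simp
  then show ?thesis unfolding grad_g_def by (simp add: sgn_div_norm norm_minus_commute algebra_simps)
qed

lemma grad_g_measurable [measurable]: "(\<lambda>(x, y). grad_g x y) \<in> borel_measurable (borel \<Otimes>\<^sub>M borel :: ((real^'n) \<times> ((real^'n) \<times> real)) measure)"
  unfolding grad_g_def case_prod_beta' by (simp add: borel_prod[symmetric])

text \<open>The gradient is Lipschitz at the target with a random modulus: moving the center by h
  turns the unit vector by at most 2 norm h / norm (x - \<mu>), which enters with weight rs. The
  constants come from squaring (4 + 2 rs / norm (x - \<mu>)) N with (p + q)^2 <= 2 p^2 + 2
  q^2.\<close>

lemma grad_g_increment_bound:
  fixes h :: "real^'n"
  assumes "x \<noteq> \<mu>"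
  shows "(norm (grad_g x (\<mu> + h, rs + b) - grad_g x (\<mu>, rs)))\<^sup>2
    \<le> (32 + 8 * rs\<^sup>2 * (1 / (norm (x - \<mu>))\<^sup>2)) * (norm (h, b))\<^sup>2"
proof -
  define v N where "v = x - \<mu>" and "N = norm (h, b)"
  have hb: "norm h \<le> N" "\<bar>b\<bar> \<le> N"
    using norm_fst_le[of h b] norm_snd_le[of b h] by (auto simp: N_def)
  have v: "v \<noteq> 0" using assms by (simp add: v_def)
  have N: "N \<ge> 0" by (simp add: N_def)
  have eq: "grad_g x (\<mu> + h, rs + b) - grad_g x (\<mu>, rs)
      = (h + b *\<^sub>R sgn (v - h) + rs *\<^sub>R (sgn (v - h) - sgn v), b - (norm (v - h) - norm v))"
    using grad_g_shift[of x h b] grad_g_shift[of x 0 0] by (simp add: v_def algebra_simps)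
  have "norm (h + b *\<^sub>R sgn (v - h) + rs *\<^sub>R (sgn (v - h) - sgn v)) \<le> norm h + \<bar>b\<bar> * 1 + rs * (2 * norm h / norm v)"
  proof (intro order_trans[OF norm_triangle_ineq] add_mono)
    show "norm (b *\<^sub>R sgn (v - h)) \<le> \<bar>b\<bar> * 1" using norm_sgn_le[of "v - h"] by (simp add: mult_left_le)
    show "norm (rs *\<^sub>R (sgn (v - h) - sgn v)) \<le> rs * (2 * norm h / norm v)"
      unfolding norm_scaleR abs_of_nonneg[OF rs_nonneg] by (intro mult_left_mono norm_sgn_diff_le v rs_nonneg)
  qed simp
  also have "\<dots> \<le> N + N + rs * (2 * N / norm v)"
    using hb rs_nonneg by (intro add_mono mult_left_mono divide_right_mono) auto
  finally have 1: "norm (h + b *\<^sub>R sgn (v - h) + rs *\<^sub>R (sgn (v - h) - sgn v)) \<le> N + N + rs * (2 * N / norm v)" .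
  have 2: "norm (b - (norm (v - h) - norm v)) \<le> N + N"
    using hb norm_triangle_ineq3[of "v - h" v] by (simp add: abs_real_def split: if_splits)
  have "norm (grad_g x (\<mu> + h, rs + b) - grad_g x (\<mu>, rs)) \<le> (N + N + rs * (2 * N / norm v)) + (N + N)"
    unfolding eq using 1 2 norm_Pair_le by (meson add_mono order_trans)
  also have "\<dots> = 4 * N + 2 * rs / norm v * N" by simp
  finally have "(norm (grad_g x (\<mu> + h, rs + b) - grad_g x (\<mu>, rs)))\<^sup>2 \<le> (4 * N + 2 * rs / norm v * N)\<^sup>2"
    by (rule power_mono) simp
  also have "\<dots> \<le> 2 * (4 * N)\<^sup>2 + 2 * (2 * rs / norm v * N)\<^sup>2"
    using sum_squares_bound[of "4 * N" "2 * rs / norm v * N"] by (simp add: power2_sum)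
  also have "\<dots> = (32 + 8 * rs\<^sup>2 * (1 / (norm v)\<^sup>2)) * N\<^sup>2"
    by (simp add: power_mult_distrib power_divide algebra_simps)
  finally show ?thesis by (simp add: v_def N_def)
qed

lemma grad_g_lipschitz:
  "(\<integral>w. (norm (grad_g (X w) (\<mu> + h, rs + b) - grad_g (X w) (\<mu>, rs)))\<^sup>2 \<partial>P)
    \<le> (32 + 8 * rs\<^sup>2 * I2) * (norm (h, b))\<^sup>2"
proof -
  let ?r = "\<lambda>w. (32 + 8 * rs\<^sup>2 * (1 / (norm (V w))\<^sup>2)) * (norm (h, b))\<^sup>2"
  have r: "integrable P ?r" by (rule inverse_square_affine)
  have "(\<integral>w. (norm (grad_g (X w) (\<mu> + h, rs + b) - grad_g (X w) (\<mu>, rs)))\<^sup>2 \<partial>P) \<le> (\<integral>w. ?r w \<partial>P)"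
  proof (cases "integrable P (\<lambda>w. (norm (grad_g (X w) (\<mu> + h, rs + b) - grad_g (X w) (\<mu>, rs)))\<^sup>2)")
    case True
    then show ?thesis using not_center grad_g_increment_bound r by (intro integral_mono_AE) auto
  next
    case False
    \<comment> \<open>The left-hand side is then the default value 0 of the integral.\<close>
    then show ?thesis by (simp add: not_integrable_integral_eq integral_nonneg_AE)
  qed
  also have "\<dots> = (32 + 8 * rs\<^sup>2 * I2) * (norm (h, b))\<^sup>2" by (rule inverse_square_affine)
  finally show ?thesis .
qed

lemma grad_g_square:
  assumes "norm h \<le> R" "\<bar>rs + b\<bar> \<le> R"
  shows "integrable P (\<lambda>w. (norm (grad_g (X w) (\<mu> + h, rs + b)))\<^sup>2)"
    and "(\<integral>w. (norm (grad_g (X w) (\<mu> + h, rs + b)))\<^sup>2 \<partial>P) \<le> 8 * (\<integral>w. (norm (V w))\<^sup>2 \<partial>P) + 32 * R\<^sup>2"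
proof -
  have bound: "(norm (grad_g x (\<mu> + h, rs + b)))\<^sup>2 \<le> 8 * (norm (x - \<mu>))\<^sup>2 + 32 * R\<^sup>2" for x
  proof -
    define v where "v = x - \<mu>"
    have R: "R \<ge> 0" using assms(1) norm_ge_zero[of h] by linarith
    have "norm (h - v + (rs + b) *\<^sub>R sgn (v - h)) \<le> (R + norm v) + R * 1"
    proof (intro order_trans[OF norm_triangle_ineq] add_mono)
      show "norm (h - v) \<le> R + norm v" using norm_triangle_ineq4[of h v] assms by simp
      show "norm ((rs + b) *\<^sub>R sgn (v - h)) \<le> R * 1"
        unfolding norm_scaleR using norm_sgn_le[of "v - h"] assms R by (intro mult_mono) auto
    qed
    moreover have "norm (rs + b - norm (v - h)) \<le> R + (norm v + R)"
      using norm_triangle_ineq4[of v h] abs_triangle_ineq4[of "rs + b" "norm (v - h)"] assms by simp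
    ultimately have "norm (grad_g x (\<mu> + h, rs + b)) \<le> 2 * norm v + 4 * R"
      unfolding grad_g_shift v_def[symmetric]
      using norm_Pair_le[of "h - v + (rs + b) *\<^sub>R sgn (v - h)" "rs + b - norm (v - h)"] by linarith
    then have "(norm (grad_g x (\<mu> + h, rs + b)))\<^sup>2 \<le> (2 * norm v + 4 * R)\<^sup>2" by (rule power_mono) simp
    also have "\<dots> \<le> 8 * (norm v)\<^sup>2 + 32 * R\<^sup>2"
      using sum_squares_bound[of "2 * norm v" "4 * R"] by (simp add: power2_sum power_mult_distrib)
    finally show ?thesis by (simp add: v_def)
  qed
  have int: "integrable P (\<lambda>w. 8 * (norm (V w))\<^sup>2 + 32 * R\<^sup>2)" using square_integrable by simp
  show 1: "integrable P (\<lambda>w. (norm (grad_g (X w) (\<mu> + h, rs + b)))\<^sup>2)"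
    using bound by (intro Bochner_Integration.integrable_bound[OF int] AE_I2) auto
  have "(\<integral>w. (norm (grad_g (X w) (\<mu> + h, rs + b)))\<^sup>2 \<partial>P) \<le> (\<integral>w. 8 * (norm (V w))\<^sup>2 + 32 * R\<^sup>2 \<partial>P)"
    using bound by (intro integral_mono 1 int)
  then show "(\<integral>w. (norm (grad_g (X w) (\<mu> + h, rs + b)))\<^sup>2 \<partial>P) \<le> 8 * (\<integral>w. (norm (V w))\<^sup>2 \<partial>P) + 32 * R\<^sup>2"
    using square_integrable by (simp add: prob_space)
qed

lemma mean_grad_g:
  "(\<integral>w. grad_g (X w) (\<mu> + h, rs + b) \<partial>P)
    = (h - rs *\<^sub>R m + (rs + b) *\<^sub>R (\<integral>w. sgn (V w - h) \<partial>P), rs + b - (\<integral>w. norm (V w - h) \<partial>P))"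
proof -
  have V: "(\<integral>w. V w \<partial>P) = rs *\<^sub>R m" using mean_dir integrable_X by (simp add: m_def prob_space)
  have "integrable P (\<lambda>w. sgn (V w - h))" using integrable_sgn[of "\<mu> + h"] by (simp add: diff_diff_eq)
  then show ?thesis
    unfolding grad_g_shift using integrable_V integrable_norm_diff[of h] V
    by (subst integrable_integral_Pair(2)) (simp_all add: prob_space)
qed

lemma mean_grad_g_root: "(\<integral>w. grad_g (X w) (\<mu>, rs) \<partial>P) = 0"
  using mean_grad_g[of 0 0] mean_norm by (simp add: m_def zero_prod_def)

section \<open>The Hessian and the expansion of the mean field\<close>

definition L :: "(real^'n) \<times> real \<Rightarrow> (real^'n) \<times> real" where
  "L = (\<lambda>(h, b). (h + b *\<^sub>R m - rs *\<^sub>R (Gamma_mat P X \<mu> *v h), b + m \<bullet> h))"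

lemma linear_L: "linear L"
  by (rule linearI) (auto simp: L_def algebra_simps inner_simps matrix_vector_right_distrib matrix_vector_mult_scaleR)

text \<open>\<open>L\<close> is the Hessian acting on pairs: the analysis runs on the product type,
  and the block matrix is needed only for its inverse.\<close>

lemma Gamma_theta_L: "Gamma_theta P X \<mu> rs *v join_vec y = join_vec (L y)"
proof (cases y)
  case (Pair h b)
  have "(\<integral>w. V w /\<^sub>R norm (V w) \<partial>P) = m" by (simp add: m_def sgn_div_norm)
  then show ?thesis
    unfolding Gamma_theta_def Pair block_mat_mult_join_vec L_def
    by (simp add: matrix_vector_mult_diff_rdistrib algebra_simps flip: scaleR_matrix_vector_assoc)
qed

text \<open>The entries of the identity minus a rank one projection are bounded by 2, so the inverse
  distance dominates the integrand up to a constant.\<close>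

lemma Gamma_mat_integrable:
  assumes "integrable P (\<lambda>w. 1 / norm (X w - z))"
  shows "integrable P (\<lambda>w. (1 / norm (X w - z)) *\<^sub>R
     (mat 1 - (1 / (norm (X w - z))\<^sup>2) *\<^sub>R outer (X w - z) (X w - z)) :: real^'n^'n)" (is "integrable P ?F")
proof (rule Bochner_Integration.integrable_bound)
  let ?c = "2 * real (CARD('n)) * real (CARD('n))"
  show "integrable P (\<lambda>w. ?c * (1 / norm (X w - z)))" using assms by (rule integrable_mult_right)
  have entry: "\<bar>(mat 1 - (1 / (norm v)\<^sup>2) *\<^sub>R outer v v :: real^'n^'n) $ i $ j\<bar> \<le> 2" for v :: "real^'n" and i j
  proof -
    have "\<bar>v $ i * v $ j\<bar> \<le> norm v * norm v"
      unfolding abs_mult by (intro mult_mono component_le_norm_cart) auto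
    then have "\<bar>(1 / (norm v)\<^sup>2) * (v $ i * v $ j)\<bar> \<le> 1"
      by (cases "v = 0") (simp_all add: abs_mult power2_eq_square divide_le_eq_1)
    moreover have "\<bar>(mat 1 :: real^'n^'n) $ i $ j\<bar> \<le> 1" by (simp add: mat_def)
    ultimately show ?thesis
      using abs_triangle_ineq4[of "(mat 1 :: real^'n^'n) $ i $ j" "(1 / (norm v)\<^sup>2) * (v $ i * v $ j)"]
      by (simp add: outer_def)
  qed
  have "norm (?F w) \<le> ?c * (1 / norm (X w - z))" for w
  proof -
    let ?A = "mat 1 - (1 / (norm (X w - z))\<^sup>2) *\<^sub>R outer (X w - z) (X w - z) :: real^'n^'n"
    have "norm ?A \<le> (\<Sum>i\<in>(UNIV::'n set). \<Sum>j\<in>(UNIV::'n set). 2)"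
      by (intro order_trans[OF norm_matrix_le_sum] sum_mono entry)
    then have "norm ?A \<le> ?c" by (simp add: mult_ac)
    then show ?thesis by (simp add: divide_right_mono)
  qed
  then show "AE w in P. norm (?F w) \<le> norm (?c * (1 / norm (X w - z)))"
    by (intro AE_I2) (auto intro: order_trans abs_ge_self)
  show "?F \<in> borel_measurable P"
    by measurable
qed

lemma Gamma_mat_mult:
  assumes "integrable P (\<lambda>w. 1 / norm (X w - z))"
  shows "integrable P (\<lambda>w. (h - (sgn (X w - z) \<bullet> h) *\<^sub>R sgn (X w - z)) /\<^sub>R norm (X w - z))"
    and "Gamma_mat P X z *v h = (\<integral>w. (h - (sgn (X w - z) \<bullet> h) *\<^sub>R sgn (X w - z)) /\<^sub>R norm (X w - z) \<partial>P)"
  using integrable_bounded_linear[OF bounded_linear_matrix_vector_mult_left Gamma_mat_integrable[OF assms], of h]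
    integral_bounded_linear[OF bounded_linear_matrix_vector_mult_left Gamma_mat_integrable[OF assms], of h]
  unfolding Gamma_mat_quadratic Gamma_mat_def by simp_all

text \<open>Symmetry is what \<open>lambda_max_bound\<close> asks for. It holds also where the
  integrand is not integrable: transposition is an involution, so neither side is integrable and
  both integrals have the default value 0.\<close>

lemma transpose_Gamma_mat: "transpose (Gamma_mat P X z) = Gamma_mat P X z"
proof -
  have sym: "transpose ((1 / norm v) *\<^sub>R (mat 1 - (1 / (norm v)\<^sup>2) *\<^sub>R outer v v))
      = (1 / norm v) *\<^sub>R (mat 1 - (1 / (norm v)\<^sup>2) *\<^sub>R outer v v)" for v :: "real^'n"
    by (simp add: transpose_scalar transpose_diff_matrix)
  have bl: "bounded_linear (transpose :: real^'n^'n \<Rightarrow> real^'n^'n)"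
    by (intro linear_conv_bounded_linear[THEN iffD1] linearI) (simp_all add: transpose_def vec_eq_iff)
  have inj: "transpose (transpose A) = A" for A :: "real^'n^'n" by simp
  have "transpose (\<integral>w. f w \<partial>P) = (\<integral>w. transpose (f w) \<partial>P)" for f :: "'p \<Rightarrow> real^'n^'n"
  proof (cases "integrable P f")
    case True
    then show ?thesis by (rule integral_bounded_linear[OF bl, symmetric])
  next
    case False
    have "\<not> integrable P (\<lambda>w. transpose (f w))"
      using False integrable_bounded_linear[OF bl, of P "\<lambda>w. transpose (f w)"] inj by auto
    moreover have "transpose (0 :: real^'n^'n) = 0" by (simp add: transpose_def vec_eq_iff)
    ultimately show ?thesis using False by (simp add: not_integrable_integral_eq)
  qed
  then show ?thesis unfolding Gamma_mat_def by (simp only: sym)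
qed

lemma mean_grad_g_expansion:
  "norm ((\<integral>w. grad_g (X w) (\<mu> + h, rs + b) \<partial>P) - L (h, b)) \<le> (4 + (4 * rs + 4) * I2) * (norm (h, b))\<^sup>2"
proof -
  define N where "N = norm (h, b)"
  have hb: "norm h \<le> N" "\<bar>b\<bar> \<le> N"
    using norm_fst_le[of h b] norm_snd_le[of b h] by (auto simp: N_def)
  have N: "N \<ge> 0" by (simp add: N_def)
  let ?D = "\<lambda>w. (h - (sgn (V w) \<bullet> h) *\<^sub>R sgn (V w)) /\<^sub>R norm (V w)"
  note Gm = Gamma_mat_mult[OF integrable_inverse_norm, of h]
  have sV: "integrable P (\<lambda>w. sgn (V w))" "integrable P (\<lambda>w. sgn (V w - h))"
    using integrable_sgn[of \<mu>] integrable_sgn[of "\<mu> + h"] by (simp_all add: diff_diff_eq)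
  \<comment> \<open>The part of the gradient that is linear in X has been integrated exactly in
    \<open>mean_grad_g\<close>. What is left consists of three second-order quantities: the
    remainder of the unit vector with weight rs, b times the increment of the unit vector, and the
    remainder of the norm.\<close>
  define \<delta> where "\<delta> w = (rs *\<^sub>R (sgn (V w - h) - sgn (V w) + ?D w) + b *\<^sub>R (sgn (V w - h) - sgn (V w)),
      - (norm (V w - h) - norm (V w) + sgn (V w) \<bullet> h))" for w
  have \<delta>_int: "integrable P \<delta>"
    unfolding \<delta>_def using sV Gm(1) integrable_norm_V integrable_norm_diff[of h]
    by (intro integrable_integral_Pair(1)) simp_all
  have "(\<integral>w. \<delta> w \<partial>P) = (rs *\<^sub>R ((\<integral>w. sgn (V w - h) \<partial>P) - m + Gamma_mat P X \<mu> *v h) + b *\<^sub>R ((\<integral>w. sgn (V w - h) \<partial>P) - m),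
      - ((\<integral>w. norm (V w - h) \<partial>P) - rs + m \<bullet> h))"
    unfolding \<delta>_def using sV Gm integrable_norm_V integrable_norm_diff[of h]
    by (subst integrable_integral_Pair(2)) (simp_all add: m_def mean_norm)
  also have "\<dots> = (\<integral>w. grad_g (X w) (\<mu> + h, rs + b) \<partial>P) - L (h, b)"
    unfolding mean_grad_g L_def by (simp add: algebra_simps)
  finally have eq: "(\<integral>w. grad_g (X w) (\<mu> + h, rs + b) \<partial>P) - L (h, b) = (\<integral>w. \<delta> w \<partial>P)" by simp
  have bound: "norm (\<delta> w) \<le> (4 + (4 * rs + 4) * (1 / (norm (V w))\<^sup>2)) * N\<^sup>2" if "X w \<noteq> \<mu>" for w
  proof -
    have v: "V w \<noteq> 0" using that by simp
    define i where "i = 1 / norm (V w)"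
    have i: "i \<ge> 0" "i \<le> 1 + i\<^sup>2" using le_one_plus_square[of i] by (auto simp: i_def)
    have "norm (\<delta> w) \<le> (rs * (4 * (norm h)\<^sup>2 / (norm (V w))\<^sup>2) + \<bar>b\<bar> * (2 * norm h / norm (V w))) + 2 * (norm h)\<^sup>2 / norm (V w)"
      unfolding \<delta>_def
    proof (intro order_trans[OF norm_Pair_le] add_mono)
      show "norm (- (norm (V w - h) - norm (V w) + sgn (V w) \<bullet> h)) \<le> 2 * (norm h)\<^sup>2 / norm (V w)"
        using norm_diff_expansion[OF v, of h] by (simp only: real_norm_def abs_minus_cancel)
      show "norm (rs *\<^sub>R (sgn (V w - h) - sgn (V w) + ?D w) + b *\<^sub>R (sgn (V w - h) - sgn (V w)))
          \<le> rs * (4 * (norm h)\<^sup>2 / (norm (V w))\<^sup>2) + \<bar>b\<bar> * (2 * norm h / norm (V w))"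
        using mult_left_mono[OF sgn_diff_expansion[OF v, of h] rs_nonneg]
          mult_left_mono[OF norm_sgn_diff_le[OF v, of h] abs_ge_zero[of b]] rs_nonneg
        by (intro order_trans[OF norm_triangle_ineq] add_mono) (simp_all only: norm_scaleR abs_of_nonneg)
    qed
    also have "\<dots> = 4 * rs * i\<^sup>2 * (norm h)\<^sup>2 + 2 * i * (\<bar>b\<bar> * norm h) + 2 * i * (norm h)\<^sup>2"
      by (simp add: i_def power_one_over mult_ac)
    also have "\<dots> \<le> 4 * rs * i\<^sup>2 * N\<^sup>2 + 2 * i * (N * N) + 2 * i * N\<^sup>2"
      using hb i N rs_nonneg by (intro add_mono mult_left_mono mult_mono power_mono) auto
    also have "\<dots> = (4 * rs * i\<^sup>2 + 4 * i) * N\<^sup>2" by (simp add: algebra_simps power2_eq_square)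
    also have "\<dots> \<le> (4 * rs * i\<^sup>2 + 4 * (1 + i\<^sup>2)) * N\<^sup>2"
      using i by (intro mult_right_mono add_left_mono mult_left_mono) auto
    also have "\<dots> = (4 + (4 * rs + 4) * (1 / (norm (V w))\<^sup>2)) * N\<^sup>2"
      by (simp add: i_def power_one_over algebra_simps add_divide_distrib)
    finally show ?thesis .
  qed
  have "norm (\<integral>w. \<delta> w \<partial>P) \<le> (\<integral>w. norm (\<delta> w) \<partial>P)" by (rule integral_norm_bound)
  also have "\<dots> \<le> (\<integral>w. (4 + (4 * rs + 4) * (1 / (norm (V w))\<^sup>2)) * N\<^sup>2 \<partial>P)"
    using not_center bound \<delta>_int by (intro integral_mono_AE inverse_square_affine) auto
  also have "\<dots> = (4 + (4 * rs + 4) * I2) * N\<^sup>2" by (rule inverse_square_affine)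
  finally show ?thesis unfolding eq N_def .
qed

section \<open>Strong monotonicity of the mean field\<close>

definition Q1 :: "real^'n \<Rightarrow> 'p \<Rightarrow> real" where
  "Q1 h w = (sgn (V w) - sgn (V w - h)) \<bullet> h"

text \<open>The Taylor remainder of the norm between V and V - h, while \<open>Q1\<close> is the
  increment of its derivative along h. Both average the second derivative over the segment, by
  \<open>nn_integral_dir_hess\<close>.\<close>

definition Q2 :: "real^'n \<Rightarrow> 'p \<Rightarrow> real" where
  "Q2 h w = norm (V w - h) - norm (V w) + sgn (V w) \<bullet> h"

lemma Q_measurable [measurable]: "Q1 h \<in> borel_measurable P" "Q2 h \<in> borel_measurable P"
  unfolding Q1_def[abs_def] Q2_def[abs_def] by measurable

lemma Q1_bound: "\<bar>Q1 h w\<bar> \<le> 2 * norm h"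
proof -
  have "\<bar>Q1 h w\<bar> \<le> norm (sgn (V w) - sgn (V w - h)) * norm h" unfolding Q1_def by (rule Cauchy_Schwarz_ineq2)
  also have "norm (sgn (V w) - sgn (V w - h)) \<le> 1 + 1"
    by (intro order_trans[OF norm_triangle_ineq4] add_mono norm_sgn_le)
  finally show ?thesis by (simp add: mult_right_mono)
qed

lemma Q2_bound: "\<bar>Q2 h w\<bar> \<le> 2 * norm h"
proof -
  have "\<bar>sgn (V w) \<bullet> h\<bar> \<le> 1 * norm h"
    by (intro order_trans[OF Cauchy_Schwarz_ineq2] mult_right_mono norm_sgn_le) simp
  then show ?thesis using norm_triangle_ineq3[of "V w - h" "V w"] by (simp add: Q2_def abs_real_def split: if_splits)
qed

lemma Q_integrable: "integrable P (Q1 h)" "integrable P (Q2 h)"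
  using Q1_bound Q2_bound by (intro integrable_const_bound[where B="2 * norm h"] AE_I2; simp)+

text \<open>A point of the segment other than 0 has direction sgn h, which \<open>no_ray\<close>
  excludes almost surely; 0 is excluded by \<open>not_center\<close>.\<close>

lemma AE_not_on_segment: "AE w in P. \<forall>s\<in>{0..1}. V w \<noteq> s *\<^sub>R h"
  using not_center no_ray[of "sgn h"]
proof eventually_elim
  case (elim w)
  show ?case
  proof (intro ballI notI)
    fix s :: real assume s: "s \<in> {0..1}" "V w = s *\<^sub>R h"
    then have "s \<noteq> 0" using elim by auto
    then have "sgn (V w) = sgn h" using s by (simp add: sgn_scaleR)
    then show False using elim by simp
  qed
qed

text \<open>Tonelli's theorem in the extended nonnegative reals: nothing has to be known about
  integrability of the second derivative at individual points of the segment.\<close>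

lemma Q_nn_integral:
  "(\<integral>\<^sup>+w. ennreal (Q1 h w) \<partial>P)
    = (\<integral>\<^sup>+s. (\<integral>\<^sup>+w. ennreal (dir_hess (V w - s *\<^sub>R h) h) \<partial>P) * indicator {0..1} s \<partial>lborel)"
  "(\<integral>\<^sup>+w. ennreal (Q2 h w) \<partial>P)
    = (\<integral>\<^sup>+s. ennreal (1 - s) * (\<integral>\<^sup>+w. ennreal (dir_hess (V w - s *\<^sub>R h) h) \<partial>P) * indicator {0..1} s \<partial>lborel)"
proof -
  interpret PB: pair_sigma_finite P "lborel :: real measure" ..
  have [measurable]: "(\<lambda>(w, s). dir_hess (V w - s *\<^sub>R h) h) \<in> borel_measurable (P \<Otimes>\<^sub>M borel)"
    unfolding dir_hess_def by measurable
  have [measurable]: "(\<lambda>w. dir_hess (V w - s *\<^sub>R h) h) \<in> borel_measurable P" for s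
    unfolding dir_hess_def by measurable
  have "(\<integral>\<^sup>+w. ennreal (Q1 h w) \<partial>P)
      = (\<integral>\<^sup>+w. (\<integral>\<^sup>+s. ennreal (dir_hess (V w - s *\<^sub>R h) h) * indicator {0..1} s \<partial>lborel) \<partial>P)"
  proof (intro nn_integral_cong_AE, use AE_not_on_segment[of h] in eventually_elim)
    case (elim w)
    then show ?case unfolding Q1_def by (subst nn_integral_dir_hess(1)) auto
  qed
  also have "\<dots> = (\<integral>\<^sup>+s. (\<integral>\<^sup>+w. ennreal (dir_hess (V w - s *\<^sub>R h) h) * indicator {0..1} s \<partial>P) \<partial>lborel)"
    by (intro PB.Fubini'[symmetric]) measurable
  finally show "(\<integral>\<^sup>+w. ennreal (Q1 h w) \<partial>P)
    = (\<integral>\<^sup>+s. (\<integral>\<^sup>+w. ennreal (dir_hess (V w - s *\<^sub>R h) h) \<partial>P) * indicator {0..1} s \<partial>lborel)"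
    by (simp add: nn_integral_multc)
  have "(\<integral>\<^sup>+w. ennreal (Q2 h w) \<partial>P)
      = (\<integral>\<^sup>+w. (\<integral>\<^sup>+s. ennreal ((1 - s) * dir_hess (V w - s *\<^sub>R h) h) * indicator {0..1} s \<partial>lborel) \<partial>P)"
  proof (intro nn_integral_cong_AE, use AE_not_on_segment[of h] in eventually_elim)
    case (elim w)
    then show ?case unfolding Q2_def by (subst nn_integral_dir_hess(2)) auto
  qed
  also have "\<dots> = (\<integral>\<^sup>+s. (\<integral>\<^sup>+w. ennreal ((1 - s) * dir_hess (V w - s *\<^sub>R h) h) * indicator {0..1} s \<partial>P) \<partial>lborel)"
    by (intro PB.Fubini'[symmetric]) measurable
  also have "\<dots> = (\<integral>\<^sup>+s. ennreal (1 - s) * (\<integral>\<^sup>+w. ennreal (dir_hess (V w - s *\<^sub>R h) h) \<partial>P) * indicator {0..1} s \<partial>lborel)"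
  proof (intro nn_integral_cong)
    fix s :: real
    show "(\<integral>\<^sup>+w. ennreal ((1 - s) * dir_hess (V w - s *\<^sub>R h) h) * indicator {0..1} s \<partial>P)
        = ennreal (1 - s) * (\<integral>\<^sup>+w. ennreal (dir_hess (V w - s *\<^sub>R h) h) \<partial>P) * indicator {0..1} s"
      by (cases "s \<in> {0..1}") (simp_all add: ennreal_mult dir_hess_nonneg nn_integral_cmult)
  qed
  finally show "(\<integral>\<^sup>+w. ennreal (Q2 h w) \<partial>P)
    = (\<integral>\<^sup>+s. ennreal (1 - s) * (\<integral>\<^sup>+w. ennreal (dir_hess (V w - s *\<^sub>R h) h) \<partial>P) * indicator {0..1} s \<partial>lborel)" .
qed

text \<open>Convexity of the norm: sgn u \<bullet> x is at most norm x, with equality for u =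
  x.\<close>

lemma Q_nonneg: "AE w in P. 0 \<le> Q1 h w" "AE w in P. 0 \<le> Q2 h w"
proof -
  have sgn_le: "sgn u \<bullet> x \<le> norm x" for u x :: "real^'n"
    using order_trans[OF Cauchy_Schwarz_ineq2[of "sgn u" x] mult_right_mono[OF norm_sgn_le[of u] norm_ge_zero[of x]]]
    by simp
  have sgn_self: "sgn x \<bullet> x = norm x" for x :: "real^'n"
    by (cases "x = 0") (simp_all add: sgn_div_norm dot_square_norm power2_eq_square)
  have "0 \<le> Q2 h w" for w
    using sgn_le[of "V w" "V w - h"] sgn_self[of "V w"] by (simp add: Q2_def inner_diff_right)
  then show "AE w in P. 0 \<le> Q2 h w" by simp
  have "0 \<le> Q1 h w" for w
    using sgn_le[of "V w" "V w - h"] sgn_self[of "V w"] sgn_le[of "V w - h" "V w"] sgn_self[of "V w - h"]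
    by (simp add: Q1_def inner_diff_right inner_diff_left)
  then show "AE w in P. 0 \<le> Q1 h w" by simp
qed

text \<open>Finiteness of the inverse moment makes \<open>Gamma_mat\<close> a genuine integral at
  this point, so that its largest eigenvalue bounds the mean second derivative of the norm.\<close>

lemma dir_hess_nn_integral_le:
  assumes lam: "lambda_max (Gamma_mat P X (\<mu> + z)) \<le> \<Lambda>"
    and fin: "(\<integral>\<^sup>+w. ennreal (1 / norm (V w - z)) \<partial>P) < \<infinity>"
  shows "(\<integral>\<^sup>+w. ennreal (dir_hess (V w - z) h) \<partial>P) \<le> ennreal (\<Lambda> * (norm h)\<^sup>2)"
proof -
  have Vz: "V w - z = X w - (\<mu> + z)" for w by simp
  have int: "integrable P (\<lambda>w. 1 / norm (X w - (\<mu> + z)))"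
    using fin unfolding Vz by (simp add: integrable_iff_bounded)
  note G = Gamma_mat_mult[OF int, of h]
  have "h \<bullet> (Gamma_mat P X (\<mu> + z) *v h) = (\<integral>w. dir_hess (X w - (\<mu> + z)) h \<partial>P)"
    unfolding G(2) integral_inner_right[OF G(1), symmetric] by (simp only: inner_dir_hess)
  moreover have "integrable P (\<lambda>w. dir_hess (X w - (\<mu> + z)) h)"
    using integrable_inner_right[OF G(1), of h] by (simp only: inner_dir_hess)
  ultimately have "(\<integral>\<^sup>+w. ennreal (dir_hess (V w - z) h) \<partial>P) = ennreal (h \<bullet> (Gamma_mat P X (\<mu> + z) *v h))"
    unfolding Vz by (simp add: nn_integral_eq_integral dir_hess_nonneg)
  also have "\<dots> \<le> ennreal (\<Lambda> * (norm h)\<^sup>2)"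
    using lambda_max_bound[OF transpose_Gamma_mat] lam
    by (intro ennreal_leI) (meson mult_right_mono order_trans zero_le_power2)
  finally show ?thesis .
qed

text \<open>The segment stays in the ball where the eigenvalue bound holds; integrating that bound
  with the weights 1 and 1 - s gives the factors 1 and 1/2.\<close>

lemma Q_expectation_generic:
  assumes lam: "\<And>z. norm z \<le> R \<Longrightarrow> lambda_max (Gamma_mat P X (\<mu> + z)) \<le> \<Lambda>" and \<Lambda>: "\<Lambda> \<ge> 0"
    and h: "norm h \<le> R" and good: "AE s in lborel. (\<integral>\<^sup>+w. ennreal (1 / norm (V w - s *\<^sub>R h)) \<partial>P) < \<infinity>"
  shows "(\<integral>w. Q1 h w \<partial>P) \<le> \<Lambda> * (norm h)\<^sup>2" "(\<integral>w. Q2 h w \<partial>P) \<le> \<Lambda> * (norm h)\<^sup>2 / 2"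
proof -
  let ?l = "\<Lambda> * (norm h)\<^sup>2"
  have l: "?l \<ge> 0" using \<Lambda> by simp
  have bound: "AE s in lborel. s \<in> {0..1} \<longrightarrow> (\<integral>\<^sup>+w. ennreal (dir_hess (V w - s *\<^sub>R h) h) \<partial>P) \<le> ennreal ?l"
    using good
  proof eventually_elim
    case (elim s)
    show ?case
    proof
      assume "s \<in> {0..1}"
      then have "\<bar>s\<bar> * norm h \<le> 1 * norm h" by (intro mult_right_mono) auto
      then have "norm (s *\<^sub>R h) \<le> R" using h by simp
      then show "(\<integral>\<^sup>+w. ennreal (dir_hess (V w - s *\<^sub>R h) h) \<partial>P) \<le> ennreal ?l"
        by (intro dir_hess_nn_integral_le lam elim)
    qed
  qed
  have "ennreal (\<integral>w. Q1 h w \<partial>P) = (\<integral>\<^sup>+w. ennreal (Q1 h w) \<partial>P)"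
    by (intro nn_integral_eq_integral[symmetric] Q_integrable Q_nonneg)
  also have "\<dots> \<le> (\<integral>\<^sup>+s. ennreal ?l * indicator {0..1} s \<partial>(lborel :: real measure))"
    unfolding Q_nn_integral
  proof (intro nn_integral_mono_AE, use bound in eventually_elim)
    case (elim s)
    then show ?case by (auto simp: indicator_def)
  qed
  also have "\<dots> = ennreal ?l" by (subst nn_integral_cmult_indicator) auto
  finally show "(\<integral>w. Q1 h w \<partial>P) \<le> ?l" using l by (simp add: ennreal_le_iff)
  have "ennreal (\<integral>w. Q2 h w \<partial>P) = (\<integral>\<^sup>+w. ennreal (Q2 h w) \<partial>P)"
    by (intro nn_integral_eq_integral[symmetric] Q_integrable Q_nonneg)
  also have "\<dots> \<le> (\<integral>\<^sup>+s. ennreal ((1 - s) * ?l) * indicator {0..1} s \<partial>lborel)"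
    unfolding Q_nn_integral
  proof (intro nn_integral_mono_AE, use bound in eventually_elim)
    case (elim s)
    then show ?case using \<Lambda> by (auto simp: indicator_def ennreal_mult intro!: mult_left_mono)
  qed
  also have "\<dots> = ennreal ((1 - 1 / 2) * ?l - (0 - 0 / 2) * ?l)"
  proof (rule nn_integral_FTC_Icc[where F="\<lambda>s. (s - s\<^sup>2 / 2) * ?l", THEN trans])
    fix s :: real assume "s \<in> {0..1}"
    then show "0 \<le> (1 - s) * ?l" using l by simp
    show "((\<lambda>s. (s - s\<^sup>2 / 2) * ?l) has_real_derivative (1 - s) * ?l) (at s)"
      by (rule DERIV_cmult_right) (auto intro!: derivative_eq_intros)
  qed auto
  finally show "(\<integral>w. Q2 h w \<partial>P) \<le> ?l / 2" using l by (simp add: ennreal_le_iff)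
qed

text \<open>The displacements to which \<open>Q_expectation_generic\<close> applies have a null
  complement and are therefore dense. Every h is a limit of such displacements inside the ball, and
  both expectations pass to the limit by dominated convergence.\<close>

lemma Q_expectation:
  assumes lam: "\<And>z. norm z \<le> R \<Longrightarrow> lambda_max (Gamma_mat P X (\<mu> + z)) \<le> \<Lambda>" and \<Lambda>: "\<Lambda> \<ge> 0"
    and h: "norm h \<le> R" and R: "R > 0"
  shows "(\<integral>w. Q1 h w \<partial>P) \<le> \<Lambda> * (norm h)\<^sup>2" "(\<integral>w. Q2 h w \<partial>P) \<le> \<Lambda> * (norm h)\<^sup>2 / 2"
proof -
  have ae: "AE h in lborel. AE s in (lborel :: real measure). (\<integral>\<^sup>+w. ennreal (1 / norm (V w - s *\<^sub>R h)) \<partial>P) < \<infinity>"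
    by (rule AE_segment_inverse_dist_integrable) (use dim in auto)
  \<comment> \<open>A nonempty open set is not null, so it contains an admissible displacement; the
    two balls meet because h lies in the closed ball of radius R.\<close>
  have "\<exists>z. z \<in> ball 0 R \<inter> ball h (1 / real (Suc n)) \<and>
      (AE s in (lborel :: real measure). (\<integral>\<^sup>+w. ennreal (1 / norm (V w - s *\<^sub>R z)) \<partial>P) < \<infinity>)" for n
  proof (rule ccontr)
    let ?U = "ball 0 R \<inter> ball h (1 / real (Suc n))"
    assume "\<nexists>z. z \<in> ?U \<and> (AE s in (lborel :: real measure). (\<integral>\<^sup>+w. ennreal (1 / norm (V w - s *\<^sub>R z)) \<partial>P) < \<infinity>)"
    then have "AE z in lborel. z \<notin> ?U" using ae by (auto elim: eventually_mono)
    then have "?U \<in> null_sets lborel" by (subst AE_iff_null_sets) auto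
    then have "negligible ?U" unfolding negligible_iff_null_sets by (rule null_sets_completionI)
    moreover have "?U \<noteq> {}"
    proof -
      have "h \<in> closure (ball 0 R)" using h R by simp
      then show ?thesis unfolding closure_approachable
        by (metis IntI dist_commute empty_iff mem_ball of_nat_0_less_iff zero_less_Suc zero_less_divide_1_iff)
    qed
    ultimately show False using open_not_negligible[of ?U] by auto
  qed
  then obtain z where z: "\<And>n. z n \<in> ball 0 R" "\<And>n. z n \<in> ball h (1 / real (Suc n))"
      "\<And>n. AE s in (lborel :: real measure). (\<integral>\<^sup>+w. ennreal (1 / norm (V w - s *\<^sub>R z n)) \<partial>P) < \<infinity>"
    by (metis IntE)
  have lim: "z \<longlonglongrightarrow> h"
  proof (rule metric_LIMSEQ_I)
    fix e :: real assume "e > 0"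
    then obtain N where N: "inverse (real (Suc N)) < e" using reals_Archimedean by blast
    have "dist (z n) h < e" if "n \<ge> N" for n
    proof -
      have "dist (z n) h < 1 / real (Suc n)" using z(2)[of n] by (simp add: dist_commute)
      also have "\<dots> \<le> 1 / real (Suc N)" using that by (simp add: frac_le)
      finally show ?thesis using N by (simp add: inverse_eq_divide)
    qed
    then show "\<exists>N. \<forall>n\<ge>N. dist (z n) h < e" by blast
  qed
  have zR: "norm (z n) \<le> R" for n using z(1)[of n] by simp
  \<comment> \<open>Since \<open>sgn\<close> is discontinuous at 0, convergence of \<open>Q1\<close>
    requires V w to differ from h.\<close>
  have ne: "AE w in P. V w \<noteq> h" using AE_not_on_segment[of h] by eventually_elim (auto dest: bspec[of _ _ 1])
  have "(\<lambda>n. \<integral>w. Q1 (z n) w \<partial>P) \<longlonglongrightarrow> (\<integral>w. Q1 h w \<partial>P)"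
  proof (rule integral_dominated_convergence[where w="\<lambda>_. 2 * R"])
    show "AE w in P. (\<lambda>n. Q1 (z n) w) \<longlonglongrightarrow> Q1 h w" using ne
    proof eventually_elim
      case (elim w)
      then show ?case unfolding Q1_def by (intro tendsto_intros tendsto_sgn lim) simp
    qed
    show "AE w in P. norm (Q1 (z n) w) \<le> 2 * R" for n
      using Q1_bound[of "z n"] zR[of n] by (intro AE_I2) (smt (verit) real_norm_def)
  qed simp_all
  moreover have "(\<lambda>n. \<Lambda> * (norm (z n))\<^sup>2) \<longlonglongrightarrow> \<Lambda> * (norm h)\<^sup>2" by (intro tendsto_intros lim)
  ultimately show "(\<integral>w. Q1 h w \<partial>P) \<le> \<Lambda> * (norm h)\<^sup>2"
    by (rule LIMSEQ_le) (use Q_expectation_generic(1)[OF lam \<Lambda> zR z(3)] in blast)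
  have "(\<lambda>n. \<integral>w. Q2 (z n) w \<partial>P) \<longlonglongrightarrow> (\<integral>w. Q2 h w \<partial>P)"
  proof (rule integral_dominated_convergence[where w="\<lambda>_. 2 * R"])
    show "AE w in P. (\<lambda>n. Q2 (z n) w) \<longlonglongrightarrow> Q2 h w"
      unfolding Q2_def by (intro AE_I2 tendsto_intros lim)
    show "AE w in P. norm (Q2 (z n) w) \<le> 2 * R" for n
      using Q2_bound[of "z n"] zR[of n] by (intro AE_I2) (smt (verit) real_norm_def)
  qed simp_all
  moreover have "(\<lambda>n. \<Lambda> * (norm (z n))\<^sup>2 / 2) \<longlonglongrightarrow> \<Lambda> * (norm h)\<^sup>2 / 2" by (intro tendsto_intros lim) simp
  ultimately show "(\<integral>w. Q2 h w \<partial>P) \<le> \<Lambda> * (norm h)\<^sup>2 / 2"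
    by (rule LIMSEQ_le) (use Q_expectation_generic(2)[OF lam \<Lambda> zR z(3)] in blast)
qed

text \<open>An exact identity: paired with (h, b), the mean field is a quadratic form corrected by
  the two averaged second derivatives, so monotonicity needs no smallness of the
  displacement.\<close>

lemma mean_grad_g_inner:
  "(\<integral>w. grad_g (X w) (\<mu> + h, rs + b) \<partial>P) \<bullet> (h, b)
    = (norm h)\<^sup>2 + b\<^sup>2 + 2 * b * (m \<bullet> h) - (rs + b) * (\<integral>w. Q1 h w \<partial>P) - b * (\<integral>w. Q2 h w \<partial>P)"
proof -
  have sV: "integrable P (\<lambda>w. sgn (V w))" "integrable P (\<lambda>w. sgn (V w - h))"
    using integrable_sgn[of \<mu>] integrable_sgn[of "\<mu> + h"] by (simp_all add: diff_diff_eq)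
  have 1: "(\<integral>w. Q1 h w \<partial>P) = m \<bullet> h - (\<integral>w. sgn (V w - h) \<partial>P) \<bullet> h"
    unfolding Q1_def using sV by (simp add: m_def inner_diff_left)
  have 2: "(\<integral>w. Q2 h w \<partial>P) = (\<integral>w. norm (V w - h) \<partial>P) - rs + m \<bullet> h"
    unfolding Q2_def using sV integrable_norm_V integrable_norm_diff[of h] by (simp add: m_def mean_norm)
  show ?thesis unfolding mean_grad_g 1 2
    by (simp add: inner_diff_left inner_add_left dot_square_norm power2_eq_square algebra_simps)
qed

lemma mean_grad_g_monotone:
  assumes lam: "\<And>z. norm z \<le> R \<Longrightarrow> lambda_max (Gamma_mat P X (\<mu> + z)) \<le> \<Lambda>"
    and h: "norm h \<le> R" and R: "R > 0" and b: "b \<le> S" "rs + b \<ge> 0" "S \<ge> 0" and rs: "rs > 0"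
    and A: "(norm m)\<^sup>2 < A" "A < 1" and \<Lambda>: "\<Lambda> \<ge> 0"
    and \<Lambda>S: "\<kappa> + \<Lambda> * (rs + 3 / 2 * S) \<le> 1 - (norm m)\<^sup>2 / A" and \<kappa>: "\<kappa> \<le> 1 - A"
  shows "\<kappa> * (norm (h, b))\<^sup>2 \<le> (\<integral>w. grad_g (X w) (\<mu> + h, rs + b) \<partial>P) \<bullet> (h, b)"
proof -
  define E1 E2 where "E1 = (\<integral>w. Q1 h w \<partial>P)" and "E2 = (\<integral>w. Q2 h w \<partial>P)"
  have E: "E1 \<le> \<Lambda> * (norm h)\<^sup>2" "E2 \<le> \<Lambda> * (norm h)\<^sup>2 / 2"
    unfolding E1_def E2_def using Q_expectation[OF lam \<Lambda> h R] by auto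
  have E2: "E2 \<ge> 0" unfolding E2_def by (intro integral_nonneg_AE Q_nonneg)
  have l: "\<Lambda> * (norm h)\<^sup>2 \<ge> 0" using \<Lambda> by simp
  have "(rs + b) * E1 \<le> (rs + b) * (\<Lambda> * (norm h)\<^sup>2)" using E b by (intro mult_left_mono) auto
  moreover have "(rs + b) * (\<Lambda> * (norm h)\<^sup>2) + b * E2 \<le> (rs + 3 / 2 * S) * (\<Lambda> * (norm h)\<^sup>2)"
  \<comment> \<open>For b >= 0 the two contributions add up to rs + 3/2 b. For b < 0 the second is
    at most 0, because \<open>Q2\<close> has nonnegative mean, and the first only shrinks.\<close>
  proof (cases "b \<ge> 0")
    case True
    then have "b * E2 \<le> b * (\<Lambda> * (norm h)\<^sup>2 / 2)" using E by (intro mult_left_mono) auto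
    then have "(rs + b) * (\<Lambda> * (norm h)\<^sup>2) + b * E2 \<le> (rs + 3 / 2 * b) * (\<Lambda> * (norm h)\<^sup>2)"
      by (simp add: algebra_simps)
    also have "\<dots> \<le> (rs + 3 / 2 * S) * (\<Lambda> * (norm h)\<^sup>2)" using b l by (intro mult_right_mono) auto
    finally show ?thesis .
  next
    case False
    then have "b * E2 \<le> 0" using E2 by (simp add: mult_nonpos_nonneg)
    moreover have "(rs + b) * (\<Lambda> * (norm h)\<^sup>2) \<le> (rs + 3 / 2 * S) * (\<Lambda> * (norm h)\<^sup>2)"
      using False b l by (intro mult_right_mono) auto
    ultimately show ?thesis by linarith
  qed
  ultimately have EE: "(rs + b) * E1 + b * E2 \<le> \<Lambda> * (rs + 3 / 2 * S) * (norm h)\<^sup>2" by (simp add: algebra_simps)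
  have A0: "A > 0" using A(1) by (meson le_less_trans zero_le_power2)
  \<comment> \<open>The inequality of arithmetic and geometric means with the weights sqrt A and 1 /
    sqrt A.\<close>
  have cross: "- (2 * b * (m \<bullet> h)) \<le> A * b\<^sup>2 + (norm m)\<^sup>2 / A * (norm h)\<^sup>2"
  proof -
    have "\<bar>b * (m \<bullet> h)\<bar> \<le> \<bar>b\<bar> * (norm m * norm h)"
      unfolding abs_mult by (intro mult_left_mono Cauchy_Schwarz_ineq2) simp
    moreover have "2 * (sqrt A * \<bar>b\<bar>) * (norm m * norm h / sqrt A) \<le> (sqrt A * \<bar>b\<bar>)\<^sup>2 + (norm m * norm h / sqrt A)\<^sup>2"
      by (rule sum_squares_bound)
    then have "2 * (\<bar>b\<bar> * (norm m * norm h)) \<le> A * b\<^sup>2 + (norm m)\<^sup>2 / A * (norm h)\<^sup>2"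
      using A0 by (simp add: power_mult_distrib power_divide)
    ultimately show ?thesis by linarith
  qed
  have "\<kappa> * (norm (h, b))\<^sup>2 = \<kappa> * (norm h)\<^sup>2 + \<kappa> * b\<^sup>2" by (simp add: norm_prod_def distrib_left)
  also have "\<dots> \<le> (1 - (norm m)\<^sup>2 / A - \<Lambda> * (rs + 3 / 2 * S)) * (norm h)\<^sup>2 + (1 - A) * b\<^sup>2"
    using \<Lambda>S \<kappa> by (intro add_mono mult_right_mono) auto
  also have "\<dots> \<le> (norm h)\<^sup>2 + b\<^sup>2 + 2 * b * (m \<bullet> h) - (rs + b) * E1 - b * E2"
    using EE cross by (simp add: algebra_simps)
  finally show ?thesis unfolding mean_grad_g_inner E1_def E2_def .
qed

end

section \<open>Central limit theorem\<close>

lemma norm_cis_diff_le: "norm (cis a - cis b) \<le> \<bar>a - b\<bar>"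
proof -
  have "cis a - cis b = cis b * (cis (a - b) - 1)" by (simp add: right_diff_distrib cis_mult)
  then have "norm (cis a - cis b) = norm (cis (a - b) - 1)" by (simp add: norm_mult)
  also have "\<dots> \<le> \<bar>a - b\<bar>" using iexp_approx1[of "a - b" 0] by (simp add: cis_conv_exp)
  finally show ?thesis .
qed

lemma inner_transpose_mult: "x \<bullet> (A *v y) = (transpose A *v x) \<bullet> y" for A :: "real^'n^'m"
  by (simp add: dot_lmul_matrix)

lemma norm_outer_self_le: "norm (outer u u) \<le> real (CARD('m)) * real (CARD('m)) * (norm u)\<^sup>2" for u :: "real^'m"
proof -
  have "norm (outer u u) \<le> (\<Sum>i\<in>(UNIV::'m set). \<Sum>j\<in>(UNIV::'m set). norm u * norm u)"
  proof (intro order_trans[OF norm_matrix_le_sum] sum_mono)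
    show "\<bar>outer u u $ i $ j\<bar> \<le> norm u * norm u" for i j
      unfolding outer_def by (simp add: abs_mult mult_mono component_le_norm_cart)
  qed
  then show ?thesis by (simp add: power2_eq_square)
qed

lemma covariance_matrix:
  fixes \<zeta> :: "'x \<Rightarrow> real^'m"
  assumes [measurable]: "\<zeta> \<in> borel_measurable M" and sq: "integrable M (\<lambda>x. (norm (\<zeta> x))\<^sup>2)"
  defines "S \<equiv> (\<integral>x. outer (\<zeta> x) (\<zeta> x) \<partial>M)"
  shows "transpose S = S" "t \<bullet> (S *v t) = (\<integral>x. (t \<bullet> \<zeta> x)\<^sup>2 \<partial>M)" "integrable M (\<lambda>x. (t \<bullet> \<zeta> x)\<^sup>2)"
proof -
  have [measurable]: "(\<lambda>x. outer (\<zeta> x) (\<zeta> x)) \<in> borel_measurable M"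
    by (rule measurable_compose[OF _ borel_measurable_outer_self]) measurable
  have int: "integrable M (\<lambda>x. outer (\<zeta> x) (\<zeta> x))"
  proof (rule Bochner_Integration.integrable_bound)
    show "integrable M (\<lambda>x. real (CARD('m)) * real (CARD('m)) * (norm (\<zeta> x))\<^sup>2)"
      using sq by (rule integrable_mult_right)
    show "AE x in M. norm (outer (\<zeta> x) (\<zeta> x)) \<le> norm (real (CARD('m)) * real (CARD('m)) * (norm (\<zeta> x))\<^sup>2)"
      using norm_outer_self_le by (intro AE_I2) simp
  qed measurable
  have bl: "bounded_linear (transpose :: real^'m^'m \<Rightarrow> real^'m^'m)"
    by (intro linear_conv_bounded_linear[THEN iffD1] linearI) (simp_all add: transpose_def vec_eq_iff)
  show "transpose S = S" unfolding S_def using integral_bounded_linear[OF bl int] by simp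
  have "outer (\<zeta> x) (\<zeta> x) *v t = (t \<bullet> \<zeta> x) *\<^sub>R \<zeta> x" for x by (simp add: outer_vec_mult inner_commute)
  then have S: "S *v t = (\<integral>x. (t \<bullet> \<zeta> x) *\<^sub>R \<zeta> x \<partial>M)" "integrable M (\<lambda>x. (t \<bullet> \<zeta> x) *\<^sub>R \<zeta> x)"
    unfolding S_def using integral_bounded_linear[OF bounded_linear_matrix_vector_mult_left int, of t]
      integrable_bounded_linear[OF bounded_linear_matrix_vector_mult_left int, of t] by simp_all
  have sq_eq: "t \<bullet> ((t \<bullet> \<zeta> x) *\<^sub>R \<zeta> x) = (t \<bullet> \<zeta> x)\<^sup>2" for x by (simp add: power2_eq_square)
  show "t \<bullet> (S *v t) = (\<integral>x. (t \<bullet> \<zeta> x)\<^sup>2 \<partial>M)"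
    unfolding S(1) integral_inner_right[OF S(2), symmetric] sq_eq ..
  show "integrable M (\<lambda>x. (t \<bullet> \<zeta> x)\<^sup>2)" using integrable_inner_right[OF S(2), of t] by (simp only: sq_eq)
qed

text \<open>The central limit theorem asks for positive variance and normalizes by it; evaluating
  the characteristic function at \<sigma> undoes the normalization. Variance zero, as for directions
  in the kernel of the covariance, makes all summands vanish almost surely.\<close>

lemma (in prob_space) iid_char_tendsto:
  fixes Y :: "nat \<Rightarrow> 'a \<Rightarrow> real"
  assumes indep: "indep_vars (\<lambda>_. borel) Y UNIV" and law: "\<And>n. distr M borel (Y n) = N"
    and mean: "(\<integral>x. x \<partial>N) = 0" and sq: "integrable N (\<lambda>x. x\<^sup>2)"
  shows "(\<lambda>n. \<integral>\<omega>. cis ((\<Sum>i<n. Y i \<omega>) / sqrt (real n)) \<partial>M) \<longlonglongrightarrow> complex_of_real (exp (- (\<integral>x. x\<^sup>2 \<partial>N) / 2))"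
proof -
  have [measurable]: "Y n \<in> borel_measurable M" for n using indep by (simp add: indep_vars_def2)
  have sets_N [simp, measurable_cong]: "sets N = sets borel" using law[of 0] by (metis sets_distr)
  have tr: "(\<integral>\<omega>. f (Y n \<omega>) \<partial>M) = (\<integral>x. f x \<partial>N)" if [measurable]: "f \<in> borel_measurable borel" for f :: "real \<Rightarrow> real" and n
    unfolding law[of n, symmetric] by (subst integral_distr) auto
  have tri: "integrable M (\<lambda>\<omega>. (Y n \<omega>)\<^sup>2)" for n
    using sq unfolding law[of n, symmetric] by (subst (asm) integrable_distr_eq) auto
  define \<sigma> where "\<sigma> = sqrt (\<integral>x. x\<^sup>2 \<partial>N)"
  have \<sigma>2: "\<sigma>\<^sup>2 = (\<integral>x. x\<^sup>2 \<partial>N)" "\<sigma> \<ge> 0" by (simp_all add: \<sigma>_def integral_nonneg_AE)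
  show ?thesis
  proof (cases "\<sigma> = 0")
    case True
    have "AE \<omega> in M. Y n \<omega> = 0" for n
    proof -
      have "(\<integral>\<omega>. (Y n \<omega>)\<^sup>2 \<partial>M) = 0" using tr[of "\<lambda>x. x\<^sup>2" n] \<sigma>2 True by simp
      then have "AE \<omega> in M. (Y n \<omega>)\<^sup>2 = 0" using tri[of n] by (subst (asm) integral_nonneg_eq_0_iff_AE) auto
      then show ?thesis by simp
    qed
    then have ae: "AE \<omega> in M. \<forall>n. Y n \<omega> = 0" unfolding AE_all_countable by blast
    have "(\<integral>\<omega>. cis ((\<Sum>i<n. Y i \<omega>) / sqrt (real n)) \<partial>M) = (\<integral>\<omega>. 1 \<partial>M)" for n
    proof (rule integral_cong_AE)
      show "AE \<omega> in M. cis ((\<Sum>i<n. Y i \<omega>) / sqrt (real n)) = 1" using ae by eventually_elim simp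
    qed measurable
    then show ?thesis using True \<sigma>2 by (simp add: prob_space)
  next
    case False
    then have pos: "\<sigma> > 0" using \<sigma>2 by simp
    have "weak_conv_m (\<lambda>n. distr M borel (\<lambda>\<omega>. (\<Sum>i<n. Y i \<omega>) / sqrt (real n * \<sigma>\<^sup>2))) std_normal_distribution"
    proof (rule central_limit_theorem_zero_mean[OF indep _ pos tri])
      show "expectation (Y n) = 0" for n using tr[of "\<lambda>x. x" n] mean by simp
      then show "variance (Y n) = \<sigma>\<^sup>2" for n using tr[of "\<lambda>x. x\<^sup>2" n] \<sigma>2 by simp
    qed (rule law)
    from levy_continuity1[OF _ _ this, of \<sigma>]
    have "(\<lambda>n. char (distr M borel (\<lambda>\<omega>. (\<Sum>i<n. Y i \<omega>) / sqrt (real n * \<sigma>\<^sup>2))) \<sigma>) \<longlonglongrightarrow> char std_normal_distribution \<sigma>"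
      by (simp add: real_distribution_distr real_dist_normal_dist)
    moreover have "char (distr M borel (\<lambda>\<omega>. (\<Sum>i<n. Y i \<omega>) / sqrt (real n * \<sigma>\<^sup>2))) \<sigma>
        = (\<integral>\<omega>. cis ((\<Sum>i<n. Y i \<omega>) / sqrt (real n)) \<partial>M)" for n
      unfolding char_def using pos
      by (subst integral_distr) (auto simp: cis_conv_exp real_sqrt_mult intro!: Bochner_Integration.integral_cong)
    ultimately show ?thesis by (simp add: char_std_normal_distribution \<sigma>2)
  qed
qed

text \<open>The Cramer-Wold device: each projection on t is a scalar i.i.d. sum. Step k uses
  observation k + 1, so the sum starts at \<open>X 2\<close>, which explains the shift by 2 after
  reindexing from 0.\<close>

lemma (in prob_space) iid_char_tendsto_vec:
  fixes X :: "nat \<Rightarrow> 'a \<Rightarrow> 'x::euclidean_space" and \<zeta> :: "'x \<Rightarrow> real^'m"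
  assumes indep: "indep_vars (\<lambda>_. borel) X {1..}" and law: "\<And>n. n \<ge> 1 \<Longrightarrow> distr M borel (X n) = Q"
    and [measurable]: "\<zeta> \<in> borel_measurable borel"
    and mean: "(\<integral>x. \<zeta> x \<partial>Q) = 0" and sq: "integrable Q (\<lambda>x. (norm (\<zeta> x))\<^sup>2)"
  shows "(\<lambda>n. \<integral>\<omega>. cis (t \<bullet> ((\<Sum>k=1..n. \<zeta> (X (k + 1) \<omega>)) /\<^sub>R sqrt (real n))) \<partial>M)
    \<longlonglongrightarrow> complex_of_real (exp (- (t \<bullet> ((\<integral>x. outer (\<zeta> x) (\<zeta> x) \<partial>Q) *v t)) / 2))"
proof -
  have sets_Q [simp, measurable_cong]: "sets Q = sets borel" using law[of 1] by (metis order_refl sets_distr)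
  have X_meas: "X k \<in> borel_measurable M" if "k \<ge> 1" for k
    using indep that by (auto simp: indep_vars_def2)
  have [measurable]: "X (n + 2) \<in> borel_measurable M" "X (Suc (Suc n)) \<in> borel_measurable M" for n
    using X_meas by auto
  interpret Q: prob_space Q using prob_space_distr[of "X 2" borel] law[of 2] X_meas by simp
  define Y where "Y n \<omega> = t \<bullet> \<zeta> (X (n + 2) \<omega>)" for n \<omega>
  define N where "N = distr Q borel (\<lambda>x. t \<bullet> \<zeta> x)"
  have "indep_vars (\<lambda>j. \<Pi>\<^sub>M i\<in>{j + 2}. (borel :: 'x measure)) (\<lambda>j \<omega>. restrict (\<lambda>i. X i \<omega>) {j + 2}) UNIV"
    by (rule indep_vars_restrict[OF indep]) (auto simp: disjoint_family_on_def)
  from indep_vars_compose2[OF this, of "\<lambda>j f. t \<bullet> \<zeta> (f (j + 2))" "\<lambda>_. borel"]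
  have iY: "indep_vars (\<lambda>_. borel) Y UNIV" by (simp add: Y_def[abs_def])
  have lY: "distr M borel (Y n) = N" for n
    unfolding N_def law[of "n + 2", simplified, symmetric] Y_def[abs_def]
    by (subst distr_distr) (auto simp: comp_def)
  have Qsq: "integrable Q (\<lambda>x. (t \<bullet> \<zeta> x)\<^sup>2)" by (rule covariance_matrix(3)[OF _ sq]) measurable
  have "integrable Q (\<lambda>x. norm (\<zeta> x))" by (rule Q.square_integrable_imp_integrable[OF _ sq]) measurable
  then have "integrable Q \<zeta>" by (subst (asm) integrable_norm_iff) measurable
  then have mN: "(\<integral>x. x \<partial>N) = 0" using mean by (simp add: N_def integral_distr)
  have sN: "integrable N (\<lambda>x. x\<^sup>2)" using Qsq by (simp add: N_def integrable_distr_eq)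
  have vN: "(\<integral>x. x\<^sup>2 \<partial>N) = t \<bullet> ((\<integral>x. outer (\<zeta> x) (\<zeta> x) \<partial>Q) *v t)"
    by (subst covariance_matrix(2)[OF _ sq]) (simp_all add: N_def integral_distr)
  have "(\<Sum>k=1..n. \<zeta> (X (k + 1) \<omega>)) = (\<Sum>i<n. \<zeta> (X (i + 2) \<omega>))" for n \<omega>
    by (rule sum.reindex_bij_witness[of _ "\<lambda>i. i + 1" "\<lambda>k. k - 1"]) auto
  then have "t \<bullet> ((\<Sum>k=1..n. \<zeta> (X (k + 1) \<omega>)) /\<^sub>R sqrt (real n)) = (\<Sum>i<n. Y i \<omega>) / sqrt (real n)" for n \<omega>
    by (simp add: Y_def inner_sum_right divide_inverse mult.commute)
  then show ?thesis using iid_char_tendsto[OF iY lY mN sN] by (simp add: vN)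
qed

text \<open>\<open>psd_factorization\<close> justifies the choice hidden in
  \<open>normal_law\<close>; the characteristic function depends on the chosen square root only
  through its product with its transpose.\<close>

lemma normal_law_char:
  fixes S :: "real^'m^'m"
  assumes "transpose S = S" and "\<And>v. 0 \<le> v \<bullet> (S *v v)"
  shows "prob_space (normal_law 0 S)" "sets (normal_law 0 S) = sets borel"
    "(\<integral>x. cis (t \<bullet> x) \<partial>normal_law 0 S) = complex_of_real (exp (- (t \<bullet> (S *v t)) / 2))"
proof -
  define A :: "real^'m^'m" where "A = (SOME A. A ** transpose A = S)"
  have A: "A ** transpose A = S" unfolding A_def using someI_ex[OF psd_factorization[OF assms]] .
  have N: "normal_law 0 S = distr std_normal_vec borel (\<lambda>z. A *v z)" by (simp add: normal_law_def A_def)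
  have [measurable]: "(\<lambda>z. A *v z) \<in> borel_measurable borel"
    by (intro borel_measurable_continuous_onI continuous_intros)
  show "prob_space (normal_law 0 S)"
    unfolding N by (intro prob_space.prob_space_distr prob_space_std_normal_vec) measurable
  show "sets (normal_law 0 S) = sets borel" by (simp add: N)
  have "(\<integral>x. cis (t \<bullet> x) \<partial>normal_law 0 S) = (\<integral>z. cis ((transpose A *v t) \<bullet> z) \<partial>std_normal_vec)"
    unfolding N by (subst integral_distr) (auto simp only: inner_transpose_mult, measurable)
  also have "(norm (transpose A *v t))\<^sup>2 = t \<bullet> (S *v t)"
    unfolding A[symmetric] matrix_vector_mul_assoc[symmetric] power2_norm_eq_inner by (simp only: inner_transpose_mult)
  then have "(\<integral>z. cis ((transpose A *v t) \<bullet> z) \<partial>std_normal_vec) = complex_of_real (exp (- (t \<bullet> (S *v t)) / 2))"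
    by (simp add: char_std_normal_vec)
  finally show "(\<integral>x. cis (t \<bullet> x) \<partial>normal_law 0 S) = complex_of_real (exp (- (t \<bullet> (S *v t)) / 2))" .
qed

lemma (in prob_space) conv_in_distribution_char:
  fixes Y :: "nat \<Rightarrow> 'a \<Rightarrow> real^'m"
  assumes [measurable]: "\<And>n. Y n \<in> borel_measurable M" and N: "prob_space N" "sets N = sets borel"
    and char: "\<And>t. (\<lambda>n. \<integral>\<omega>. cis (t \<bullet> Y n \<omega>) \<partial>M) \<longlonglongrightarrow> (\<integral>x. cis (t \<bullet> x) \<partial>N)"
  shows "conv_in_distribution M Y N"
  unfolding conv_in_distribution_def
proof (intro conjI allI impI assms(1) N)
  fix f :: "real^'m \<Rightarrow> real" assume f: "continuous_on UNIV f" "bounded (range f)"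
  have [measurable]: "f \<in> borel_measurable borel" using f(1) by (rule borel_measurable_continuous_onI)
  have "(\<lambda>n. \<integral>x. f x \<partial>distr M borel (Y n)) \<longlonglongrightarrow> (\<integral>x. f x \<partial>N)"
    by (intro levy_continuity_vec N f prob_space_distr) (simp_all add: integral_distr char)
  then show "(\<lambda>n. \<integral>\<omega>. f (Y n \<omega>) \<partial>M) \<longlonglongrightarrow> (\<integral>x. f x \<partial>N)" by (simp add: integral_distr)
qed

text \<open>\<open>cis\<close> is 1-Lipschitz, so closeness in mean carries the limit of the
  characteristic functions over.\<close>

lemma (in prob_space) char_slutsky:
  fixes Y Z :: "nat \<Rightarrow> 'a \<Rightarrow> real^'m"
  assumes [measurable]: "\<And>n. Y n \<in> borel_measurable M" "\<And>n. Z n \<in> borel_measurable M"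
    and int: "\<And>n. n \<ge> 1 \<Longrightarrow> integrable M (\<lambda>\<omega>. norm (Y n \<omega> - Z n \<omega>))"
    and diff: "(\<lambda>n. \<integral>\<omega>. norm (Y n \<omega> - Z n \<omega>) \<partial>M) \<longlonglongrightarrow> 0"
    and Z: "(\<lambda>n. \<integral>\<omega>. cis (t \<bullet> Z n \<omega>) \<partial>M) \<longlonglongrightarrow> l"
  shows "(\<lambda>n. \<integral>\<omega>. cis (t \<bullet> Y n \<omega>) \<partial>M) \<longlonglongrightarrow> l"
proof -
  have cis_int: "integrable M (\<lambda>\<omega>. cis (t \<bullet> W \<omega>))" if [measurable]: "W \<in> borel_measurable M" for W :: "'a \<Rightarrow> real^'m"
    by (intro integrable_const_bound[where B=1]) auto
  have le: "norm ((\<integral>\<omega>. cis (t \<bullet> Y n \<omega>) \<partial>M) - (\<integral>\<omega>. cis (t \<bullet> Z n \<omega>) \<partial>M)) \<le> norm t * (\<integral>\<omega>. norm (Y n \<omega> - Z n \<omega>) \<partial>M)"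
    if n: "n \<ge> 1" for n
  proof -
    have "(\<integral>\<omega>. cis (t \<bullet> Y n \<omega>) \<partial>M) - (\<integral>\<omega>. cis (t \<bullet> Z n \<omega>) \<partial>M) = (\<integral>\<omega>. cis (t \<bullet> Y n \<omega>) - cis (t \<bullet> Z n \<omega>) \<partial>M)"
      by (intro Bochner_Integration.integral_diff[symmetric] cis_int assms(1,2))
    also have "norm \<dots> \<le> (\<integral>\<omega>. norm (cis (t \<bullet> Y n \<omega>) - cis (t \<bullet> Z n \<omega>)) \<partial>M)" by (rule integral_norm_bound)
    also have "\<dots> \<le> (\<integral>\<omega>. norm t * norm (Y n \<omega> - Z n \<omega>) \<partial>M)"
    proof (rule integral_mono)
      show "integrable M (\<lambda>\<omega>. norm (cis (t \<bullet> Y n \<omega>) - cis (t \<bullet> Z n \<omega>)))"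
        by (intro integrable_norm Bochner_Integration.integrable_diff cis_int assms(1,2))
      show "norm (cis (t \<bullet> Y n \<omega>) - cis (t \<bullet> Z n \<omega>)) \<le> norm t * norm (Y n \<omega> - Z n \<omega>)" for \<omega>
        using norm_cis_diff_le[of "t \<bullet> Y n \<omega>" "t \<bullet> Z n \<omega>"] Cauchy_Schwarz_ineq2[of t "Y n \<omega> - Z n \<omega>"]
        by (simp add: inner_diff_right)
    qed (use int[OF n] in simp)
    finally show ?thesis by simp
  qed
  have "(\<lambda>n. (\<integral>\<omega>. cis (t \<bullet> Y n \<omega>) \<partial>M) - (\<integral>\<omega>. cis (t \<bullet> Z n \<omega>) \<partial>M)) \<longlonglongrightarrow> 0"
  proof (rule Lim_null_comparison)
    show "\<forall>\<^sub>F n in sequentially. norm ((\<integral>\<omega>. cis (t \<bullet> Y n \<omega>) \<partial>M) - (\<integral>\<omega>. cis (t \<bullet> Z n \<omega>) \<partial>M))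
        \<le> norm t * (\<integral>\<omega>. norm (Y n \<omega> - Z n \<omega>) \<partial>M)"
      by (rule eventually_sequentiallyI[of 1]) (rule le)
    show "(\<lambda>n. norm t * (\<integral>\<omega>. norm (Y n \<omega> - Z n \<omega>) \<partial>M)) \<longlonglongrightarrow> 0"
      using tendsto_mult[OF tendsto_const[of "norm t"] diff] by simp
  qed
  from tendsto_add[OF this Z] show ?thesis by simp
qed

text \<open>Positive definiteness makes the kernel trivial. The transpose of the inverse is again a
  left inverse, hence equal to the inverse.\<close>

lemma pos_def_mat_inverse:
  fixes A :: "real^'m^'m"
  assumes "pos_def_mat A"
  shows "matrix_inv A ** A = mat 1" "transpose (matrix_inv A) = matrix_inv A"
proof -
  have "A *v x \<noteq> 0" if "x \<noteq> 0" for x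
    using assms that by (auto simp: pos_def_mat_def)
  then have "invertible A" unfolding invertible_left_inverse matrix_left_invertible_ker by blast
  then have inv: "A ** matrix_inv A = mat 1" "matrix_inv A ** A = mat 1"
    using someI_ex[of "\<lambda>A'. A ** A' = mat 1 \<and> A' ** A = mat 1"] unfolding invertible_def matrix_inv_def by auto
  have "transpose (matrix_inv A) ** A = mat 1"
    using arg_cong[OF inv(1), of transpose] assms by (simp add: matrix_transpose_mul pos_def_mat_def transpose_mat)
  then have "transpose (matrix_inv A) ** (A ** matrix_inv A) = matrix_inv A"
    by (simp add: matrix_mul_assoc)
  then show "transpose (matrix_inv A) = matrix_inv A" by (simp add: inv)
  show "matrix_inv A ** A = mat 1" by (rule inv)
qed

section \<open>Proof of the theorem\<close>

lemma sets_surface_measure [simp]: "sets surface_measure = sets borel"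
  by (simp add: surface_measure_def)

text \<open>The cone over a point lies in a line, which is Lebesgue null in dimension at least 2.
  This is the source of \<open>no_ray\<close>.\<close>

lemma surface_measure_singleton:
  assumes "DIM('a::euclidean_space) \<ge> 2"
  shows "emeasure (surface_measure :: 'a measure) {e} = 0"
proof -
  have [measurable]: "(sgn :: 'a \<Rightarrow> 'a) \<in> measurable (restrict_space lborel (ball 0 1 - {0})) borel"
    by (intro measurable_restrict_space1) simp
  have "dim (span {e}) \<le> 1" by (simp add: dim_singleton)
  then have "negligible (span {e})" using assms by (intro negligible_lowdim) simp
  then have null: "span {e} \<in> null_sets lebesgue" by (simp add: negligible_iff_null_sets)
  let ?A = "sgn -` {e} \<inter> (ball 0 1 - {0 :: 'a})"
  have A: "?A \<in> sets borel" using measurable_sets_borel[OF borel_measurable_sgn_vec, of "{e}"] by (intro sets.Int) auto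
  have "?A \<subseteq> span {e}"
  proof
    fix x assume "x \<in> ?A"
    then have "x = norm x *\<^sub>R e" using norm_scaleR_sgn[of x] by auto
    then show "x \<in> span {e}" by (metis insertI1 span_base span_mul)
  qed
  then have "?A \<in> null_sets lebesgue" using null A by (intro null_sets_subset[OF null]) auto
  then have "emeasure lborel ?A = 0" using A by (simp add: null_sets_def)
  then show ?thesis unfolding surface_measure_def
    by (subst emeasure_scale_measure, subst emeasure_distr)
      (auto simp: space_restrict_space emeasure_restrict_space)
qed

lemma uniform_surface_AE:
  fixes U :: "'p \<Rightarrow> 'a::euclidean_space"
  assumes U: "U \<in> borel_measurable P" and unif: "distr P borel U = uniform_measure surface_measure \<Omega>"
    and \<Omega>: "\<Omega> \<in> sets borel"
  shows "AE w in P. U w \<in> \<Omega>" and "DIM('a) \<ge> 2 \<Longrightarrow> AE w in P. U w \<noteq> e"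
proof -
  have ae: "AE w in P. U w \<notin> N" if N: "N \<in> sets borel" "emeasure surface_measure (\<Omega> \<inter> N) = 0" for N
  proof -
    have "emeasure (distr P borel U) N = 0" unfolding unif using N \<Omega> by (subst emeasure_uniform_measure) auto
    then have "N \<in> null_sets (distr P borel U)" using N by auto
    then have "AE x in distr P borel U. x \<notin> N" by (rule AE_not_in)
    then show ?thesis using U N by (subst (asm) AE_distr_iff) auto
  qed
  show "AE w in P. U w \<in> \<Omega>" using ae[of "- \<Omega>"] \<Omega> by auto
  show "AE w in P. U w \<noteq> e" if "DIM('a) \<ge> 2"
  proof -
    have "emeasure surface_measure (\<Omega> \<inter> {e}) \<le> emeasure surface_measure {e}" by (intro emeasure_mono) auto
    then show ?thesis using ae[of "{e}"] surface_measure_singleton[OF that, of e] by auto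
  qed
qed

text \<open>The product rule for independent real variables is applied to W and each coordinate of
  U, whose sigma-algebra is contained in that of U.\<close>

lemma (in prob_space) indep_scaleR_expectation:
  fixes W :: "'a \<Rightarrow> real" and U :: "'a \<Rightarrow> real^'n"
  assumes W [measurable]: "W \<in> borel_measurable M" and U [measurable]: "U \<in> borel_measurable M"
    and indep: "indep_set (sets (vimage_algebra (space M) W borel)) (sets (vimage_algebra (space M) U borel))"
    and int: "integrable M W" "integrable M U" "integrable M (\<lambda>w. W w *\<^sub>R U w)"
  shows "(\<integral>w. W w *\<^sub>R U w \<partial>M) = (\<integral>w. W w \<partial>M) *\<^sub>R (\<integral>w. U w \<partial>M)"
proof -
  have comp: "(\<integral>w. f w \<partial>M) $ i = (\<integral>w. f w $ i \<partial>M)" "integrable M (\<lambda>w. f w $ i)" if "integrable M f" for f :: "'a \<Rightarrow> real^'n" and i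
    using integral_bounded_linear[OF bounded_linear_vec_nth that] integrable_bounded_linear[OF bounded_linear_vec_nth that]
    by simp_all
  have [measurable]: "(\<lambda>w. U w $ i) \<in> borel_measurable M" for i
    by (rule borel_measurable_integrable[OF comp(2)[OF int(2)]])
  have "indep_var borel W borel (\<lambda>w. U w $ i)" for i
    unfolding indep_var_eq
  proof (intro conjI)
    have sub: "sigma_sets (space M) {(\<lambda>w. U w $ i) -` A \<inter> space M | A. A \<in> sets borel} \<subseteq> sets (vimage_algebra (space M) U borel)"
      unfolding sets_vimage_algebra
    proof (rule sigma_sets_mono', safe)
      fix A :: "real set" assume "A \<in> sets borel"
      then have "(\<lambda>x :: real^'n. x $ i) -` A \<in> sets borel"
        using measurable_sets_borel[of "\<lambda>x :: real^'n. x $ i" borel A] by simp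
      then show "\<exists>B. (\<lambda>w. U w $ i) -` A \<inter> space M = U -` B \<inter> space M \<and> B \<in> sets borel"
        by (intro exI[of _ "(\<lambda>x. x $ i) -` A"]) auto
    qed
    then show "indep_set (sigma_sets (space M) {W -` A \<inter> space M | A. A \<in> sets borel})
        (sigma_sets (space M) {(\<lambda>w. U w $ i) -` A \<inter> space M | A. A \<in> sets borel})"
      using indep unfolding indep_sets2_eq sets_vimage_algebra[of _ W] by blast
  qed measurable
  then have "(\<integral>w. W w * (U w $ i) \<partial>M) = (\<integral>w. W w \<partial>M) * (\<integral>w. U w $ i \<partial>M)" for i
    using int(1) comp(2)[OF int(2)] by (rule indep_var_lebesgue_integral)
  then show ?thesis by (simp add: vec_eq_iff comp(1)[OF int(3)] comp(1)[OF int(2)])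
qed

text \<open>Almost surely U has norm 1 and r W > 0, so U and r W are the direction and the norm of X
  - \<mu>. The locale assumptions are read off this polar form, with independence giving the mean of
  X.\<close>

lemma spherical_law_of_model:
  fixes P :: "'p measure" and \<mu> :: "real^'n" and r :: real
    and W :: "'p \<Rightarrow> real" and U X :: "'p \<Rightarrow> real^'n" and \<Omega> :: "(real^'n) set"
  assumes dim: "CARD('n) \<ge> 2" and "prob_space P" and r: "r > 0"
    and W [measurable]: "W \<in> borel_measurable P" and W_pos: "AE w in P. W w > 0"
    and \<Omega>: "\<Omega> \<in> sets borel" "\<Omega> \<subseteq> sphere 0 1"
    and U [measurable]: "U \<in> borel_measurable P" and unif: "distr P borel U = uniform_measure surface_measure \<Omega>"
    and indep: "prob_space.indep_set P (sets (vimage_algebra (space P) W borel))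
          (sets (vimage_algebra (space P) U borel))"
    and X: "X = (\<lambda>w. \<mu> + (r * W w) *\<^sub>R U w)"
    and A1: "integrable P (\<lambda>w. 1 / norm (X w - \<mu>) ^ 2)"
    and A2: "integrable P (\<lambda>w. norm (X w - \<mu>) ^ 2)"
  shows "spherical_law P X \<mu> (r * (\<integral>w. W w \<partial>P))" and "spherical_law.m P X \<mu> = (\<integral>w. U w \<partial>P)"
proof -
  interpret prob_space P by fact
  have X_meas [measurable]: "X \<in> borel_measurable P" unfolding X by measurable
  have ae: "AE w in P. norm (U w) = 1 \<and> W w > 0"
    using uniform_surface_AE(1)[OF U unif \<Omega>(1)] W_pos by eventually_elim (use \<Omega>(2) in auto)
  have sgn_eq: "AE w in P. sgn (X w - \<mu>) = U w"
    using ae by eventually_elim (use r in \<open>auto simp: X sgn_scaleR sgn_div_norm[of "U _"]\<close>)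
  have norm_eq: "AE w in P. norm (X w - \<mu>) = r * W w"
    using ae by eventually_elim (use r in \<open>auto simp: X abs_mult\<close>)
  have EU: "(\<integral>w. sgn (X w - \<mu>) \<partial>P) = (\<integral>w. U w \<partial>P)" using sgn_eq by (intro integral_cong_AE) auto
  have iN: "integrable P (\<lambda>w. norm (X w - \<mu>))" by (rule square_integrable_imp_integrable[OF _ A2]) measurable
  then have "integrable P (\<lambda>w. r * W w)" using norm_eq by (subst integrable_cong_AE[symmetric]) auto
  then have iW: "integrable P W" using r by simp
  have iU: "integrable P U" using ae by (intro integrable_const_bound[where B=1]) auto
  have "integrable P (\<lambda>w. X w - \<mu>)" using iN by (subst (asm) integrable_norm_iff) auto
  then have "integrable P (\<lambda>w. r *\<^sub>R (W w *\<^sub>R U w))" by (simp add: X scaleR_scaleR)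
  from integrable_scaleR_right[OF this, of "inverse r"] have iWU: "integrable P (\<lambda>w. W w *\<^sub>R U w)"
    using r by (simp flip: mult.assoc)
  have EX: "(\<integral>w. X w \<partial>P) = \<mu> + (r * (\<integral>w. W w \<partial>P)) *\<^sub>R (\<integral>w. sgn (X w - \<mu>) \<partial>P)"
  proof -
    have "(\<integral>w. X w \<partial>P) = (\<integral>w. \<mu> + r *\<^sub>R (W w *\<^sub>R U w) \<partial>P)" by (simp add: X)
    also have "\<dots> = \<mu> + r *\<^sub>R (\<integral>w. W w *\<^sub>R U w \<partial>P)" using iWU by (simp add: prob_space del: scaleR_scaleR)
    finally show ?thesis by (simp add: indep_scaleR_expectation[OF W U indep iW iU iWU] EU)
  qed
  have dim': "DIM(real^'n) \<ge> 2" using dim by simp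
  show law: "spherical_law P X \<mu> (r * (\<integral>w. W w \<partial>P))"
  proof unfold_locales
    show "AE w in P. X w \<noteq> \<mu>" using ae by eventually_elim (use r in \<open>auto simp: X\<close>)
    show "AE w in P. sgn (X w - \<mu>) = e \<longrightarrow> X w = \<mu>" for e
      using uniform_surface_AE(2)[OF U unif \<Omega>(1) dim', of e] sgn_eq by eventually_elim auto
    show "(\<integral>w. norm (X w - \<mu>) \<partial>P) = r * (\<integral>w. W w \<partial>P)"
      using norm_eq by (subst integral_cong_AE[where g="\<lambda>w. r * W w"]) auto
  qed (use dim A1 A2 EX in auto)
  show "spherical_law.m P X \<mu> = (\<integral>w. U w \<partial>P)"
    unfolding spherical_law.m_def[OF law] by (rule EU)
qed

theorem theorem4p4:
  fixes P :: "'p measure" and M :: "'s measure"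
    and \<mu> :: "real^'n" and r rs R\<^sub>\<mu> R\<^sub>r c \<alpha> :: real
    and W :: "'p \<Rightarrow> real" and U X :: "'p \<Rightarrow> real^'n" and \<Omega> :: "(real^'n) set"
    and K :: "((real^'n) \<times> real) set" and \<pi> :: "(real^'n) \<times> real \<Rightarrow> (real^'n) \<times> real"
    and Xs :: "nat \<Rightarrow> 's \<Rightarrow> real^'n"
    and \<theta> \<theta>\<^sub>1 :: "(real^'n) \<times> real" and \<gamma> :: "nat \<Rightarrow> real"
    and \<theta>h \<theta>bar :: "nat \<Rightarrow> 's \<Rightarrow> (real^'n) \<times> real"
  assumes dim: "CARD('n) \<ge> 2"
    and prob_P: "prob_space P" and prob_M: "prob_space M"
    \<comment> \<open>the model\<close>
    and r_pos: "r > 0"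
    and W_measurable: "W \<in> borel_measurable P"
    and W_pos: "AE w in P. W w > 0"
    and W_cont: "\<forall>t. measure P {w \<in> space P. W w = t} = 0"
    and W_dens: "CARD('n) = 2 \<Longrightarrow>
          \<exists>f B. distributed P lborel W f \<and> (\<forall>t. f t \<le> ennreal B)"
    and \<Omega>: "\<Omega> \<in> sets borel" "\<Omega> \<subseteq> sphere 0 1" "emeasure surface_measure \<Omega> > 0"
    and U_unif: "U \<in> borel_measurable P" "distr P borel U = uniform_measure surface_measure \<Omega>"
    and indep: "prob_space.indep_set P (sets (vimage_algebra (space P) W borel))
          (sets (vimage_algebra (space P) U borel))"
    and X_eq: "X = (\<lambda>w. \<mu> + (r * W w) *\<^sub>R U w)"
    and rs_eq: "rs = r * (\<integral>w. W w \<partial>P)"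
    and \<theta>_eq: "\<theta> = (\<mu>, rs)"
    \<comment> \<open>the assumptions\<close>
    and A1: "integrable P (\<lambda>w. 1 / norm (X w - \<mu>) ^ 2)"
    and A2: "integrable P (\<lambda>w. norm (X w - \<mu>) ^ 2)"
    and A3: "R\<^sub>\<mu> > 0" "R\<^sub>r > 0"
          "\<exists>A. (norm (\<integral>w. U w \<partial>P))\<^sup>2 < A \<and> A < 1 \<and>
             (SUP z\<in>cball \<mu> R\<^sub>\<mu>. ereal (lambda_max (Gamma_mat P X z)))
               < ereal ((1 - (norm (\<integral>w. U w \<partial>P))\<^sup>2 / A) / (rs + 3 / 2 * R\<^sub>r))"
    and A4: "pos_def_mat (Gamma_theta P X \<mu> rs)"
    and moment: "integrable P (\<lambda>w. norm (X w - \<mu>) ^ 12)"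
    \<comment> \<open>the compact set and the projection\<close>
    and K: "compact K" "convex K" "K \<subseteq> UNIV \<times> {0<..}" "K \<subseteq> cball \<mu> R\<^sub>\<mu> \<times> cball rs R\<^sub>r"
          "\<theta> \<in> K - frontier K"
    and \<pi>: "range \<pi> \<subseteq> K" "\<forall>y\<in>K. \<pi> y = y" "\<forall>y y'. norm (\<pi> y - \<pi> y') \<le> norm (y - y')"
          "\<forall>y. y \<notin> K \<longrightarrow> \<pi> y \<in> frontier K"
    \<comment> \<open>the sample and the algorithm\<close>
    and Xs_indep: "prob_space.indep_vars M (\<lambda>_. borel) Xs {1..}"
    and Xs_law: "\<forall>n\<ge>1. distr M borel (Xs n) = distr P borel X"
    and c_pos: "c > 0" and \<alpha>: "1 / 2 < \<alpha>" "\<alpha> < 1"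
    and \<gamma>_eq: "\<forall>n\<ge>1. \<gamma> n = c * real n powr (- \<alpha>)"
    and init: "\<theta>\<^sub>1 \<in> K" "\<forall>w\<in>space M. \<theta>h 1 w = \<theta>\<^sub>1"
    and rec: "\<forall>n\<ge>1. \<forall>w\<in>space M.
          \<theta>h (n + 1) w = \<pi> (\<theta>h n w - \<gamma> n *\<^sub>R grad_g (Xs (n + 1) w) (\<theta>h n w))"
    and average: "\<forall>n\<ge>1. \<forall>w\<in>space M. \<theta>bar n w = (1 / real n) *\<^sub>R (\<Sum>k=1..n. \<theta>h k w)"
  shows "conv_in_distribution M
           (\<lambda>n w. join_vec (sqrt (real n) *\<^sub>R (\<theta>bar n w - \<theta>)))
           (normal_law 0
             (matrix_inv (Gamma_theta P X \<mu> rs) ** Sigma_mat P X \<mu> rs **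
              matrix_inv (Gamma_theta P X \<mu> rs)))"
proof -
  interpret P: prob_space P by (rule prob_P)
  interpret M: prob_space M by (rule prob_M)
  interpret sl: spherical_law P X \<mu> rs
    unfolding rs_eq by (rule spherical_law_of_model(1)[OF dim prob_P r_pos W_measurable W_pos \<Omega>(1,2) U_unif indep X_eq A1 A2])
  have m: "sl.m = (\<integral>w. U w \<partial>P)"
    by (rule spherical_law_of_model(2)[OF dim prob_P r_pos W_measurable W_pos \<Omega>(1,2) U_unif indep X_eq A1 A2])
  have \<theta>_int: "\<theta> \<in> interior K" using K(5) closure_subset[of K] by (auto simp: frontier_def)
  then obtain d where d: "d > 0" "ball \<theta> d \<subseteq> K" by (auto simp: mem_interior)
  have rs: "rs > 0" using K(3,5) by (auto simp: \<theta>_eq)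
  obtain A where A: "(norm sl.m)\<^sup>2 < A" "A < 1"
    "(SUP z\<in>cball \<mu> R\<^sub>\<mu>. ereal (lambda_max (Gamma_mat P X z))) < ereal ((1 - (norm sl.m)\<^sup>2 / A) / (rs + 3 / 2 * R\<^sub>r))"
    using A3(3) unfolding m by blast
  \<comment> \<open>A real number strictly between the supremum, which is taken in the extended
    reals, and the bound of [A3]; the room above it becomes \<kappa>.\<close>
  then obtain \<Lambda>0 where \<Lambda>0: "(SUP z\<in>cball \<mu> R\<^sub>\<mu>. ereal (lambda_max (Gamma_mat P X z))) < ereal \<Lambda>0"
    "ereal \<Lambda>0 < ereal ((1 - (norm sl.m)\<^sup>2 / A) / (rs + 3 / 2 * R\<^sub>r))"
    using ereal_dense2 by blast
  \<comment> \<open>The monotonicity estimate needs a nonnegative constant; the strict upper bound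
    survives because it is positive.\<close>
  define \<Lambda> where "\<Lambda> = max \<Lambda>0 0"
  have lam: "lambda_max (Gamma_mat P X (\<mu> + z)) \<le> \<Lambda>" if "norm z \<le> R\<^sub>\<mu>" for z
  proof -
    have "ereal (lambda_max (Gamma_mat P X (\<mu> + z))) \<le> (SUP z\<in>cball \<mu> R\<^sub>\<mu>. ereal (lambda_max (Gamma_mat P X z)))"
      using that by (intro SUP_upper) (simp add: dist_norm)
    then have "ereal (lambda_max (Gamma_mat P X (\<mu> + z))) < ereal \<Lambda>0" using \<Lambda>0(1) by (rule le_less_trans)
    then show ?thesis by (simp add: \<Lambda>_def)
  qed
  have den: "rs + 3 / 2 * R\<^sub>r > 0" using rs A3(2) by simp
  have A0: "A > 0" using A(1) by (meson le_less_trans zero_le_power2)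
  have "(norm sl.m)\<^sup>2 / A < 1" using A(1) A0 by simp
  then have "\<Lambda> < (1 - (norm sl.m)\<^sup>2 / A) / (rs + 3 / 2 * R\<^sub>r)" using \<Lambda>0(2) den by (simp add: \<Lambda>_def)
  then have gap: "\<Lambda> * (rs + 3 / 2 * R\<^sub>r) < 1 - (norm sl.m)\<^sup>2 / A" using den by (simp add: pos_less_divide_eq)
  define \<kappa> where "\<kappa> = min (1 - A) (1 - (norm sl.m)\<^sup>2 / A - \<Lambda> * (rs + 3 / 2 * R\<^sub>r))"
  have \<kappa>: "\<kappa> > 0" "\<kappa> \<le> 1 - A" "\<kappa> + \<Lambda> * (rs + 3 / 2 * R\<^sub>r) \<le> 1 - (norm sl.m)\<^sup>2 / A"
    using gap A(2) by (auto simp: \<kappa>_def)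
  \<comment> \<open>On K this bounds both the displacement of the center and the radius.\<close>
  define R where "R = R\<^sub>\<mu> + rs + R\<^sub>r"
  define B1 B2 B3 where "B1 = 32 + 8 * rs\<^sup>2 * sl.I2" and "B2 = 4 + (4 * rs + 4) * sl.I2"
    and "B3 = 8 * (\<integral>w. (norm (X w - \<mu>))\<^sup>2 \<partial>P) + 32 * R\<^sup>2"
  have B: "B1 \<ge> 0" "B2 \<ge> 0" "B3 \<ge> 0"
    using sl.I2_nonneg rs by (simp_all add: B1_def B2_def B3_def)
  have split: "\<exists>h b. y = (\<mu> + h, rs + b) \<and> y - \<theta> = (h, b) \<and> norm h \<le> R\<^sub>\<mu> \<and> b \<le> R\<^sub>r \<and> rs + b \<ge> 0
      \<and> norm h \<le> R \<and> \<bar>rs + b\<bar> \<le> R" if y: "y \<in> K" for y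
  proof -
    obtain z a where za: "y = (z, a)" by (cases y)
    then have "z \<in> cball \<mu> R\<^sub>\<mu>" "a \<in> cball rs R\<^sub>r" "a > 0" using y K(3,4) by auto
    then have "norm (z - \<mu>) \<le> R\<^sub>\<mu>" "a - rs \<le> R\<^sub>r" "a > 0" by (auto simp: dist_norm norm_minus_commute)
    then show ?thesis using za rs A3(1,2)
      by (intro exI[of _ "z - \<mu>"] exI[of _ "a - rs"]) (auto simp: \<theta>_eq R_def)
  qed
  define Q where "Q = distr P borel X"
  have tr: "(\<integral>x. f x \<partial>Q) = (\<integral>w. f (X w) \<partial>P)" if [measurable]: "f \<in> borel_measurable borel"
    for f :: "real^'n \<Rightarrow> 'z::{banach, second_countable_topology}"
    unfolding Q_def by (subst integral_distr) auto
  have tri: "integrable Q f \<longleftrightarrow> integrable P (\<lambda>w. f (X w))" if [measurable]: "f \<in> borel_measurable borel"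
    for f :: "real^'n \<Rightarrow> 'z::{banach, second_countable_topology}"
    unfolding Q_def by (subst integrable_distr_eq) auto
  note gm [measurable] = sl.grad_g_measurable
  have gm1 [measurable]: "(\<lambda>x. grad_g x y) \<in> borel_measurable borel" for y :: "(real^'n) \<times> real"
  proof -
    have "(\<lambda>x. (\<lambda>(x, y). grad_g x y) (x, y)) \<in> borel_measurable borel" by measurable
    then show ?thesis by simp
  qed
  \<comment> \<open>B1 is the Lipschitz constant, B2 that of the expansion and B3 the second moment
    bound; their sum dominates each of them.\<close>
  interpret rm: projected_robbins_monro M Xs Q grad_g K \<theta> \<theta>\<^sub>1 \<pi> sl.L \<gamma> "B1 + B2 + B3" c d \<alpha> \<kappa> \<theta>h
  proof (intro projected_robbins_monro.intro projected_robbins_monro_axioms.intro prob_M)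
    show "M.indep_vars (\<lambda>_. borel) Xs {1..}" by (rule Xs_indep)
    show "distr M borel (Xs n) = Q" if "n \<ge> 1" for n using Xs_law that by (simp add: Q_def)
    show "(\<lambda>(x, y). grad_g x y) \<in> borel_measurable (borel \<Otimes>\<^sub>M borel :: ((real^'n) \<times> ((real^'n) \<times> real)) measure)" by (rule gm)
    show "linear sl.L" by (rule sl.linear_L)
    show "bounded K" using K(1) by (rule compact_imp_bounded)
    show "(\<integral>x. grad_g x \<theta> \<partial>Q) = 0" using sl.mean_grad_g_root by (simp add: tr \<theta>_eq)
  next
    fix y assume "y \<in> K"
    then obtain h b where y: "y = (\<mu> + h, rs + b)" "y - \<theta> = (h, b)" and hb: "norm h \<le> R\<^sub>\<mu>" "b \<le> R\<^sub>r" "rs + b \<ge> 0"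
      "norm h \<le> R" "\<bar>rs + b\<bar> \<le> R" using split by blast
    show "integrable Q (\<lambda>x. (norm (grad_g x y))\<^sup>2)"
      using sl.grad_g_square(1)[OF hb(4,5)] by (simp add: tri y(1))
    show "(\<integral>x. (norm (grad_g x y))\<^sup>2 \<partial>Q) \<le> B1 + B2 + B3"
      using sl.grad_g_square(2)[OF hb(4,5)] B by (simp add: tr y(1) B3_def)
    show "(\<integral>x. (norm (grad_g x y - grad_g x \<theta>))\<^sup>2 \<partial>Q) \<le> (B1 + B2 + B3) * (norm (y - \<theta>))\<^sup>2"
    proof -
      have "(\<integral>x. (norm (grad_g x y - grad_g x \<theta>))\<^sup>2 \<partial>Q) \<le> B1 * (norm (h, b))\<^sup>2"
        using sl.grad_g_lipschitz[of h b] by (simp add: tr y(1) \<theta>_eq B1_def)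
      also have "\<dots> \<le> (B1 + B2 + B3) * (norm (h, b))\<^sup>2" using B by (intro mult_right_mono) auto
      finally show ?thesis by (simp add: y(2))
    qed
    show "norm ((\<integral>x. grad_g x y \<partial>Q) - sl.L (y - \<theta>)) \<le> (B1 + B2 + B3) * (norm (y - \<theta>))\<^sup>2"
    proof -
      have "norm ((\<integral>x. grad_g x y \<partial>Q) - sl.L (y - \<theta>)) \<le> B2 * (norm (h, b))\<^sup>2"
        using sl.mean_grad_g_expansion[of h b] unfolding y(2) by (simp add: tr y(1) B2_def)
      also have "\<dots> \<le> (B1 + B2 + B3) * (norm (h, b))\<^sup>2" using B by (intro mult_right_mono) auto
      finally show ?thesis by (simp add: y(2))
    qed
    have "\<kappa> * (norm (h, b))\<^sup>2 \<le> (\<integral>w. grad_g (X w) (\<mu> + h, rs + b) \<partial>P) \<bullet> (h, b)"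
      by (rule sl.mean_grad_g_monotone[where R=R\<^sub>\<mu> and \<Lambda>=\<Lambda> and S=R\<^sub>r and A=A])
        (use lam hb A3(1,2) rs A(1,2) \<kappa> in \<open>auto simp: \<Lambda>_def\<close>)
    then show "\<kappa> * (norm (y - \<theta>))\<^sup>2 \<le> (\<integral>x. grad_g x y \<partial>Q) \<bullet> (y - \<theta>)"
      unfolding y(2) by (simp add: tr y(1))
  qed (use \<kappa> d c_pos \<alpha> \<pi> \<gamma>_eq init rec in auto)

  let ?G = "Gamma_theta P X \<mu> rs" and ?S = "Sigma_mat P X \<mu> rs"
  define I where "I = matrix_inv ?G"
  have I: "I ** ?G = mat 1" "transpose I = I" unfolding I_def by (rule pos_def_mat_inverse[OF A4])+
  have I_symm: "x \<bullet> (I *v y) = (I *v x) \<bullet> y" for x y using inner_transpose_mult[of x I y] I(2) by simp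
  define \<zeta> where "\<zeta> x = join_vec (grad_g x \<theta>)" for x :: "real^'n"
  have jm [measurable]: "(join_vec :: (real^'n) \<times> real \<Rightarrow> _) \<in> borel_measurable borel"
    using linear_join_vec by (intro borel_measurable_continuous_onI linear_continuous_on) (simp add: linear_conv_bounded_linear)
  have \<zeta>_meas [measurable]: "\<zeta> \<in> borel_measurable borel" unfolding \<zeta>_def by measurable
  have G\<theta>_int: "integrable Q (\<lambda>x. grad_g x \<theta>)" by (rule rm.G_integrable[OF rm.theta_in_K])
  have \<zeta>_mean: "(\<integral>x. \<zeta> x \<partial>Q) = 0"
    unfolding \<zeta>_def using integral_bounded_linear[OF _ G\<theta>_int, of join_vec] rm.mean_root linear_join_vec
    by (simp add: linear_conv_bounded_linear linear_0)
  have \<zeta>_sq: "integrable Q (\<lambda>x. (norm (\<zeta> x))\<^sup>2)"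
    unfolding \<zeta>_def norm_join_vec by (rule rm.G_square_integrable[OF rm.theta_in_K])
  have om [measurable]: "(\<lambda>x. outer (\<zeta> x) (\<zeta> x)) \<in> borel_measurable borel"
    by (rule measurable_compose[OF \<zeta>_meas borel_measurable_outer_self])
  have S: "?S = (\<integral>x. outer (\<zeta> x) (\<zeta> x) \<partial>Q)"
    unfolding tr[OF om] unfolding Sigma_mat_def \<zeta>_def \<theta>_eq ..
  have \<zeta>Q: "\<zeta> \<in> borel_measurable Q" by simp
  note cov = covariance_matrix[OF \<zeta>Q \<zeta>_sq, folded S]
  define N where "N = I ** ?S ** I"
  have N_form: "t \<bullet> (N *v t) = (I *v t) \<bullet> (?S *v (I *v t))" for t
    by (simp add: N_def matrix_vector_mul_assoc[symmetric] I_symm)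
  have N_sym: "transpose N = N" by (simp add: N_def matrix_transpose_mul I(2) cov(1) matrix_mul_assoc)
  have N_psd: "0 \<le> t \<bullet> (N *v t)" for t unfolding N_form cov(2) by (intro integral_nonneg_AE) simp
  \<comment> \<open>Y is the quantity of interest and Z the linear statistic that carries the limit:
    minus the inverse Hessian applied to the normalized sum of gradients at \<theta>. Their
    difference is the inverse Hessian applied to T / sqrt n, which vanishes in mean.\<close>
  define Y where "Y n w = join_vec (sqrt (real n) *\<^sub>R (\<theta>bar n w - \<theta>))" for n w
  define Z where "Z n w = - (I *v ((\<Sum>k=1..n. \<zeta> (Xs (k + 1) w)) /\<^sub>R sqrt (real n)))" for n w
  define T where "T n w = (\<Sum>k=1..n. sl.L (\<theta>h k w - \<theta>) + grad_g (Xs (k + 1) w) \<theta>)" for n w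
  have Xs_meas [measurable]: "k \<ge> 1 \<Longrightarrow> Xs k \<in> borel_measurable M" for k by (rule rm.X_measurable_M)
  have Im [measurable]: "(\<lambda>x. I *v x) \<in> borel_measurable borel"
    by (intro borel_measurable_continuous_onI continuous_intros)
  have Y_meas: "Y n \<in> borel_measurable M" for n
  \<comment> \<open>The average at 0 is arbitrary, but the factor sqrt 0 makes \<open>Y 0\<close>
    constant.\<close>
  proof (cases "n = 0")
    case False
    have "(\<lambda>w. join_vec (sqrt (real n) *\<^sub>R ((1 / real n) *\<^sub>R (\<Sum>k=1..n. \<theta>h k w) - \<theta>))) \<in> borel_measurable M"
      by (intro measurable_compose[OF _ jm] borel_measurable_scaleR borel_measurable_diff borel_measurable_sum
        measurable_const rm.\<theta>h_measurable) auto
    then show ?thesis using False average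
      by (subst measurable_cong[where g="\<lambda>w. join_vec (sqrt (real n) *\<^sub>R ((1 / real n) *\<^sub>R (\<Sum>k=1..n. \<theta>h k w) - \<theta>))"])
        (auto simp: Y_def)
  qed (simp add: Y_def[abs_def])
  have Z_meas: "Z n \<in> borel_measurable M" for n
    unfolding Z_def[abs_def]
    by (intro borel_measurable_uminus measurable_compose[OF _ Im] borel_measurable_scaleR borel_measurable_sum
      measurable_compose[OF Xs_meas \<zeta>_meas] measurable_const) auto
  have diff: "Y n w - Z n w = I *v join_vec (T n w /\<^sub>R sqrt (real n))" if n: "n \<ge> 1" and w: "w \<in> space M" for n w
  proof -
    have "sqrt (real n) *\<^sub>R (\<theta>bar n w - \<theta>) = (\<Sum>k=1..n. \<theta>h k w - \<theta>) /\<^sub>R sqrt (real n)"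
    proof -
      have "(\<Sum>k=1..n. \<theta>h k w - \<theta>) = real n *\<^sub>R (\<theta>bar n w - \<theta>)"
        using average n w by (simp add: sum_subtractf scaleR_diff_right sum_constant_scaleR)
      moreover have "real n / sqrt (real n) = sqrt (real n)" by (rule real_div_sqrt) simp
      ultimately show ?thesis by (simp add: divide_inverse mult.commute)
    qed
    then have "?G *v Y n w = join_vec (sl.L ((\<Sum>k=1..n. \<theta>h k w - \<theta>) /\<^sub>R sqrt (real n)))"
      by (simp add: Y_def sl.Gamma_theta_L)
    also have "\<dots> = join_vec ((\<Sum>k=1..n. sl.L (\<theta>h k w - \<theta>)) /\<^sub>R sqrt (real n))"
      by (simp add: linear_scale[OF sl.linear_L] linear_sum[OF sl.linear_L])
    finally have GY: "?G *v Y n w = join_vec ((\<Sum>k=1..n. sl.L (\<theta>h k w - \<theta>)) /\<^sub>R sqrt (real n))" .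
    have "Y n w = I *v (?G *v Y n w)" by (simp add: I(1) matrix_vector_mul_assoc)
    also have "\<dots> = I *v join_vec ((\<Sum>k=1..n. sl.L (\<theta>h k w - \<theta>)) /\<^sub>R sqrt (real n))" unfolding GY ..
    finally show ?thesis
      by (simp add: Z_def T_def \<zeta>_def sum.distrib scaleR_add_right linear_add[OF linear_join_vec]
          linear_scale[OF linear_join_vec] linear_sum[OF linear_join_vec] matrix_vector_right_distrib)
  qed
  have bl: "bounded_linear (\<lambda>x. I *v x)" by (rule matrix_vector_mul_bounded_linear)
  obtain C where C: "C > 0" "\<And>x. norm (I *v x) \<le> norm x * C" using bounded_linear.pos_bounded[OF bl] by blast
  have T_int: "integrable M (\<lambda>w. norm (T n w))" for n
    unfolding T_def by (rule rm.linearization_integrable)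
  have diff_le: "norm (Y n w - Z n w) \<le> C * (norm (T n w) / sqrt (real n))" if "n \<ge> 1" "w \<in> space M" for n w
    unfolding diff[OF that] using C(2)[of "join_vec (T n w /\<^sub>R sqrt (real n))"]
    by (simp add: norm_join_vec divide_inverse mult_ac)
  have diff_int: "integrable M (\<lambda>w. norm (Y n w - Z n w))" if "n \<ge> 1" for n
  proof (rule Bochner_Integration.integrable_bound)
    show "integrable M (\<lambda>w. C * (norm (T n w) / sqrt (real n)))" using T_int by simp
    show "(\<lambda>w. norm (Y n w - Z n w)) \<in> borel_measurable M"
      using Y_meas[of n] Z_meas[of n] by measurable
    show "AE w in M. norm (norm (Y n w - Z n w)) \<le> norm (C * (norm (T n w) / sqrt (real n)))"
      using order_trans[OF diff_le[OF that] abs_ge_self] by (intro AE_I2) simp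
  qed
  have diff_lim: "(\<lambda>n. \<integral>w. norm (Y n w - Z n w) \<partial>M) \<longlonglongrightarrow> 0"
  proof (rule tendsto_sandwich[OF _ _ tendsto_const])
    show "\<forall>\<^sub>F n in sequentially. 0 \<le> (\<integral>w. norm (Y n w - Z n w) \<partial>M)"
      by (intro always_eventually allI integral_nonneg_AE AE_I2) simp
    show "\<forall>\<^sub>F n in sequentially. (\<integral>w. norm (Y n w - Z n w) \<partial>M) \<le> C * ((\<integral>w. norm (T n w) \<partial>M) / sqrt (real n))"
    proof (rule eventually_sequentiallyI[of 1])
      fix n :: nat assume n: "n \<ge> 1"
      have "(\<integral>w. norm (Y n w - Z n w) \<partial>M) \<le> (\<integral>w. C * (norm (T n w) / sqrt (real n)) \<partial>M)"
        by (intro integral_mono diff_int[OF n] diff_le[OF n]) (use T_int in auto)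
      then show "(\<integral>w. norm (Y n w - Z n w) \<partial>M) \<le> C * ((\<integral>w. norm (T n w) \<partial>M) / sqrt (real n))" by simp
    qed
    show "(\<lambda>n. C * ((\<integral>w. norm (T n w) \<partial>M) / sqrt (real n))) \<longlonglongrightarrow> 0"
      using tendsto_mult[OF tendsto_const[of C] rm.linearization_tendsto_0] by (simp add: T_def)
  qed
  have "conv_in_distribution M Y (normal_law 0 N)"
  proof (rule M.conv_in_distribution_char[OF Y_meas normal_law_char(1,2)[OF N_sym N_psd]])
    fix t
    \<comment> \<open>Symmetry moves the inverse Hessian to the frequency, so the limit for the
      plain gradient sums at frequency -I t suffices.\<close>
    have "t \<bullet> Z n w = (- (I *v t)) \<bullet> ((\<Sum>k=1..n. \<zeta> (Xs (k + 1) w)) /\<^sub>R sqrt (real n))" for n w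
      unfolding Z_def inner_minus_left inner_minus_right I_symm ..
    then have "(\<lambda>n. \<integral>w. cis (t \<bullet> Z n w) \<partial>M)
        \<longlonglongrightarrow> complex_of_real (exp (- ((- (I *v t)) \<bullet> (?S *v (- (I *v t)))) / 2))"
      unfolding S using M.iid_char_tendsto_vec[OF Xs_indep rm.X_law \<zeta>_meas \<zeta>_mean \<zeta>_sq, of "- (I *v t)"]
      by (simp only:)
    also have "(- (I *v t)) \<bullet> (?S *v (- (I *v t))) = t \<bullet> (N *v t)"
      unfolding N_form by (simp add: linear_neg[OF matrix_vector_mul_linear])
    finally have Z_lim: "(\<lambda>n. \<integral>w. cis (t \<bullet> Z n w) \<partial>M) \<longlonglongrightarrow> (\<integral>x. cis (t \<bullet> x) \<partial>normal_law 0 N)"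
      unfolding normal_law_char(3)[OF N_sym N_psd] .
    show "(\<lambda>n. \<integral>w. cis (t \<bullet> Y n w) \<partial>M) \<longlonglongrightarrow> (\<integral>x. cis (t \<bullet> x) \<partial>normal_law 0 N)"
      by (rule M.char_slutsky[OF Y_meas Z_meas diff_int diff_lim Z_lim])
  qed
  then show ?thesis unfolding Y_def[abs_def] N_def I_def .
qed

end
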